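(* Let $k, k', n$ be positive integers with $k' \le k < n$ and $k + k' \le n$. Then \[ \dim \Phi(k, k', \mathbb{R}^n) = k(n-k) + k'(n-k') - k' \] and \[ \Phi(k,k', \mathbb{R}^n) = \begin{cases} \mathrm{SO}(n) &\text{if }k = k' \text{ and } n = 2k \text{ or } 2k + 1, \\ \mathrm{SO}^{-}(n) &\text{if }k = k'+1 \text{ and } n = 2k - 1 \text{ or } 2k. \end{cases} \]
   Context: $\mathrm{O}(n)=\{X\in\mathbb{R}^{n\times n}: X^{\mathsf T}X=I_n\}$, $\mathrm{SO}(n)=\{X\in \mathrm{O}(n):\det X=1\}$, $\mathrm{SO}^{-}(n)=\{X\in \mathrm{O}(n):\det X=-1\}$. The real Grassmannian (involution model) is $\mathrm{Gr}(k,\mathbb{R}^n)=\{X\in \mathrm{O}(n): X^2=I_n,\ \operatorname{tr}(X)=2k-n\}$. Define $\Phi(k,k',\mathbb{R}^n)=\{XY : X\in \mathrm{Gr}(k,\mathbb{R}^n),\ Y\in \mathrm{Gr}(k',\mathbb{R}^n)\}\subseteq \mathrm{O}(n)$ (matrix products). $\dim$ denotes the real dimension of a real semialgebraic set. *)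

theory Defs
  imports "HOL-Analysis.Analysis" "HOL-Algebra.Ideal"
begin

definition O_group :: "(real^'n^'n) set" where
  "O_group = {X. orthogonal_matrix X}"

definition SO_group :: "(real^'n^'n) set" where
  "SO_group = {X \<in> O_group. det X = 1}"

definition SO_minus :: "(real^'n^'n) set" where
  "SO_minus = {X \<in> O_group. det X = -1}"

definition Gr :: "nat \<Rightarrow> (real^'n^'n) set" where
  "Gr k = {X \<in> O_group. X ** X = mat 1 \<and> trace X = 2 * real k - real CARD('n)}"

definition Phi :: "nat \<Rightarrow> nat \<Rightarrow> (real^'n^'n) set" where
  "Phi k k' = {X ** Y | X Y. X \<in> Gr k \<and> Y \<in> Gr k'}"

text \<open>
  The dimension of a semialgebraic set \<open>S\<close> is, as in Bochnak, Coste and Roy, Real Algebraic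
  Geometry, Definition 2.8.1, the Krull dimension of the ring of polynomial functions on \<open>S\<close>,
  i.e. of the polynomial ring modulo the ideal of the polynomials that vanish on \<open>S\<close>.
  A class of this quotient is represented by the restriction to \<open>S\<close> of its members.
\<close>

definition poly_fun_ring :: "'a::euclidean_space set \<Rightarrow> ('a \<Rightarrow> real) ring" where
  "poly_fun_ring S =
    \<lparr>carrier = {restrict f S | f. real_polynomial_function f},
     mult = (\<lambda>f g. \<lambda>x\<in>S. f x * g x),
     one = (\<lambda>x\<in>S. 1),
     zero = (\<lambda>x\<in>S. 0),
     add = (\<lambda>f g. \<lambda>x\<in>S. f x + g x)\<rparr>"

lemma cring_poly_fun_ring: "cring (poly_fun_ring S)"
proof -
  let ?R = "poly_fun_ring S"
  have ops: "f \<otimes>\<^bsub>?R\<^esub> g = (\<lambda>x\<in>S. f x * g x)" "f \<oplus>\<^bsub>?R\<^esub> g = (\<lambda>x\<in>S. f x + g x)"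
    "\<one>\<^bsub>?R\<^esub> = (\<lambda>x\<in>S. 1)" "\<zero>\<^bsub>?R\<^esub> = (\<lambda>x\<in>S. 0)" for f g
    by (simp_all add: poly_fun_ring_def)
  have in_carrier: "restrict f S \<in> carrier ?R" if "real_polynomial_function f" for f
    using that by (auto simp: poly_fun_ring_def)
  have carrierE: "\<exists>f. x = restrict f S \<and> real_polynomial_function f" if "x \<in> carrier ?R" for x
    using that by (auto simp: poly_fun_ring_def)
  have closed: "x \<oplus>\<^bsub>?R\<^esub> y \<in> carrier ?R \<and> x \<otimes>\<^bsub>?R\<^esub> y \<in> carrier ?R"
    if xy: "x \<in> carrier ?R" "y \<in> carrier ?R" for x y
  proof -
    from xy carrierE obtain f g where fg: "x = restrict f S" "y = restrict g S"
      "real_polynomial_function f" "real_polynomial_function g" by meson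
    have "x \<oplus>\<^bsub>?R\<^esub> y = (\<lambda>x\<in>S. f x + g x)" "x \<otimes>\<^bsub>?R\<^esub> y = (\<lambda>x\<in>S. f x * g x)"
      by (auto simp: ops fg(1,2) fun_eq_iff)
    then show ?thesis
      using in_carrier[OF real_polynomial_function.intros(3)[OF fg(3,4)]]
        in_carrier[OF real_polynomial_function.intros(4)[OF fg(3,4)]] by simp
  qed
  have units01: "\<zero>\<^bsub>?R\<^esub> \<in> carrier ?R" "\<one>\<^bsub>?R\<^esub> \<in> carrier ?R"
    unfolding ops by (intro in_carrier real_polynomial_function.intros(2))+
  show ?thesis
  proof (rule cringI)
    show "abelian_group ?R"
    proof (rule abelian_groupI)
      fix x assume "x \<in> carrier ?R"
      with carrierE obtain f where f: "x = restrict f S" "real_polynomial_function f" by meson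
      have "restrict (\<lambda>x. - f x) S \<oplus>\<^bsub>?R\<^esub> x = \<zero>\<^bsub>?R\<^esub>"
        by (auto simp: ops f(1) fun_eq_iff)
      then show "\<exists>y\<in>carrier ?R. y \<oplus>\<^bsub>?R\<^esub> x = \<zero>\<^bsub>?R\<^esub>"
        using in_carrier[OF real_polynomial_function_minus[OF f(2)]] by blast
      show "\<zero>\<^bsub>?R\<^esub> \<oplus>\<^bsub>?R\<^esub> x = x" by (auto simp: ops f(1) fun_eq_iff)
    qed (auto simp: closed units01, auto simp: ops fun_eq_iff)
    show "comm_monoid ?R"
    proof (rule comm_monoidI)
      fix x assume "x \<in> carrier ?R"
      with carrierE obtain f where f: "x = restrict f S" by meson
      show "\<one>\<^bsub>?R\<^esub> \<otimes>\<^bsub>?R\<^esub> x = x" by (auto simp: ops f fun_eq_iff)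
    qed (auto simp: closed units01, auto simp: ops fun_eq_iff)
  qed (auto simp: ops fun_eq_iff algebra_simps)
qed

text \<open>
  The supremum of the lengths \<open>l\<close> of the strict chains of prime ideals \<open>P 0, \<dots>, P l\<close>;
  it is \<open>- \<infinity>\<close> for the zero ring, hence for the dimension of the empty set.
\<close>

definition krull_dim :: "('a, 'b) ring_scheme \<Rightarrow> ereal" where
  "krull_dim R = Sup {ereal (real l) | l. \<exists>P :: nat \<Rightarrow> 'a set.
     (\<forall>i\<le>l. primeideal (P i) R) \<and> (\<forall>i<l. P i \<subset> P (Suc i))}"

definition semialg_dim :: "'a::euclidean_space set \<Rightarrow> ereal" where
  "semialg_dim S = krull_dim (poly_fun_ring S)"

end

theory Submission
  imports Defs
begin

text \<open>
  An orthogonal \<open>M\<close> splits \<open>\<real>\<^sup>n\<close> into its \<open>\<plusminus> 1\<close>-eigenspaces and planes that it rotates, and on a rotated plane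
  it is a product of two reflections in lines, the second of which may be any line of the plane. Hence \<open>M\<close> lies in
  \<open>\<Phi>(k, k')\<close> as soon as \<open>det M = (-1) ^ (k - k')\<close> and the eigenvalues \<open>-1\<close> and \<open>1\<close> have multiplicities at least
  \<open>k - k'\<close> and \<open>n - k - k'\<close>, which gives the description of \<open>SO(n)\<close> and \<open>SO\<^sup>-(n)\<close>. Choosing the second lines
  orthogonal to a fixed vector \<open>e\<close> shows moreover that \<open>\<Phi>(k, k')\<close> is the image of \<open>Gr(k, \<real>\<^sup>n) \<times> Gr(k', e\<^sup>\<bottom>)\<close>,
  which has dimension \<open>d = k(n - k) + k'(n - 1 - k')\<close>.

  For the upper bound, finitely many rational charts with \<open>d\<close> parameters cover this product, so any \<open>d + 1\<close>
  polynomial functions on \<open>\<Phi>(k, k')\<close> are algebraically dependent; elements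
  \<open>x\<^sub>i \<in> P\<^sub>i\<^sub>+\<^sub>1 - P\<^sub>i\<close> taken from a chain of primes, however, satisfy no algebraic relation (Coquand and Lombardi).
  For the lower bound, the elements \<open>(I - A)(I + A)\<^sup>-\<^sup>1 (I - 2 P\<^sub>E)\<close> of \<open>\<Phi>(k, k')\<close>, with \<open>E\<close> of dimension \<open>k - k'\<close>
  and \<open>A\<close> skew of rank \<open>2k'\<close> vanishing on \<open>E\<close>, have a rational parametrization by \<open>d\<close> numbers that can be
  recovered one after the other; the coordinate subspaces of the parameter space give \<open>d + 1\<close> nested irreducible sets.
\<close>

section \<open>Chains of primes in rings of polynomial functions\<close>

text \<open>The dimension is that of an abstract ring, so no generic fibres are at hand: the excess
  of dim Gr(k) + dim Gr(k') over the answer, one free angle in each of k' rotated planes, has to be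
  removed before parameters are counted, and this is what e achieves. The normalized product does
  not serve for the lower bound, because its factors are hard to recover from it. The Cayley form
  does: there A solves a linear system in the matrix M and E is the kernel of M + I, so Cramer's
  rule yields polynomial functions of M that detect one parameter at a time. That these elements lie
  in the image follows from the eigenvalue criterion: M is -1 on E, and 1 on the part of ker A
  orthogonal to E, of dimension at least n-k-k'. Their parameters are (k-k')(n-k+k') for E,
  k'(2k'-1) for a skew form of size 2k', and 2k'(n-k-k') for the position of its kernel. Subspaces
  are handled as symmetric idempotents, so that inclusion, orthogonality and dimension become matrix
  equations.\<close>

definition vanishing_ideal :: "'a::euclidean_space set \<Rightarrow> 'a set \<Rightarrow> ('a \<Rightarrow> real) set" where
  "vanishing_ideal S T = {restrict f S | f. real_polynomial_function f \<and> (\<forall>x\<in>T. f x = 0)}"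

text \<open>Irreducibility of the Zariski closure of \<open>T\<close>. Stated through polynomials on
  \<open>T\<close> itself, it applies to images of charts whose closures are never computed.\<close>

definition poly_irreducible :: "'a::euclidean_space set \<Rightarrow> bool" where
  "poly_irreducible T \<longleftrightarrow> T \<noteq> {} \<and>
    (\<forall>f g. real_polynomial_function f \<and> real_polynomial_function g \<and> (\<forall>x\<in>T. f x * g x = 0)
      \<longrightarrow> (\<forall>x\<in>T. f x = 0) \<or> (\<forall>x\<in>T. g x = 0))"

lemma restrict_in_vanishing_ideal:
  assumes "T \<subseteq> S" "real_polynomial_function f"
  shows "restrict f S \<in> vanishing_ideal S T \<longleftrightarrow> (\<forall>x\<in>T. f x = 0)"
proof
  assume "restrict f S \<in> vanishing_ideal S T"
  then obtain g where g: "restrict f S = restrict g S" "\<forall>x\<in>T. g x = 0"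
    by (auto simp: vanishing_ideal_def)
  show "\<forall>x\<in>T. f x = 0"
  proof
    fix x assume "x \<in> T"
    with assms(1) have "x \<in> S" by blast
    then have "f x = g x" using g(1) by (metis restrict_apply')
    with g(2) \<open>x \<in> T\<close> show "f x = 0" by simp
  qed
qed (use assms in \<open>auto simp: vanishing_ideal_def\<close>)

lemma carrier_poly_fun_ring: "carrier (poly_fun_ring S) = {restrict f S | f. real_polynomial_function f}"
  by (simp add: poly_fun_ring_def)

lemma add_poly_fun_ring:
  "restrict f S \<oplus>\<^bsub>poly_fun_ring S\<^esub> restrict g S = restrict (\<lambda>x. f x + g x) S"
  by (auto simp: poly_fun_ring_def)

lemma mult_poly_fun_ring:
  "restrict f S \<otimes>\<^bsub>poly_fun_ring S\<^esub> restrict g S = restrict (\<lambda>x. f x * g x) S"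
  by (auto simp: poly_fun_ring_def)

lemma one_poly_fun_ring: "\<one>\<^bsub>poly_fun_ring S\<^esub> = restrict (\<lambda>x. 1) S"
  and zero_poly_fun_ring: "\<zero>\<^bsub>poly_fun_ring S\<^esub> = restrict (\<lambda>x. 0) S"
  by (simp_all add: poly_fun_ring_def)

lemma primeideal_vanishing_ideal:
  assumes T: "T \<subseteq> S" "poly_irreducible T"
  shows "primeideal (vanishing_ideal S T) (poly_fun_ring S)"
proof -
  let ?R = "poly_fun_ring S"
  interpret cring ?R by (rule cring_poly_fun_ring)
  have "ideal (vanishing_ideal S T) ?R"
  proof (rule idealI)
    show "ring ?R" ..
    show "subgroup (vanishing_ideal S T) (add_monoid ?R)"
    proof (rule add.subgroupI)
      show "vanishing_ideal S T \<subseteq> carrier ?R"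
        by (auto simp: vanishing_ideal_def carrier_poly_fun_ring)
      have "restrict (\<lambda>x. 0) S \<in> vanishing_ideal S T"
        using T by (subst restrict_in_vanishing_ideal) auto
      then show "vanishing_ideal S T \<noteq> {}" by blast
    next
      fix a assume "a \<in> vanishing_ideal S T"
      then obtain f where f: "a = restrict f S" "real_polynomial_function f" "\<forall>x\<in>T. f x = 0"
        by (auto simp: vanishing_ideal_def)
      have m: "restrict (\<lambda>x. - f x) S \<in> carrier ?R"
        using f(2) by (auto simp: carrier_poly_fun_ring)
      have c: "a \<in> carrier ?R" using f by (auto simp: carrier_poly_fun_ring)
      have "restrict (\<lambda>x. - f x) S \<oplus>\<^bsub>?R\<^esub> a = \<zero>\<^bsub>?R\<^esub>"
        unfolding f(1) add_poly_fun_ring zero_poly_fun_ring by simp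
      then have e: "\<ominus>\<^bsub>?R\<^esub> a = restrict (\<lambda>x. - f x) S"
        using m c minus_equality by blast
      show "\<ominus>\<^bsub>?R\<^esub> a \<in> vanishing_ideal S T"
        unfolding e using T f by (subst restrict_in_vanishing_ideal) auto
    next
      fix a b assume "a \<in> vanishing_ideal S T" "b \<in> vanishing_ideal S T"
      then obtain f g where f: "a = restrict f S" "real_polynomial_function f" "\<forall>x\<in>T. f x = 0"
        and g: "b = restrict g S" "real_polynomial_function g" "\<forall>x\<in>T. g x = 0"
        by (auto simp: vanishing_ideal_def)
      show "a \<oplus>\<^bsub>?R\<^esub> b \<in> vanishing_ideal S T"
        unfolding f(1) g(1) add_poly_fun_ring
        using T f g by (subst restrict_in_vanishing_ideal) (auto intro: real_polynomial_function.intros)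
    qed
  next
    fix a b assume "a \<in> vanishing_ideal S T" and b: "b \<in> carrier ?R"
    then obtain f g where f: "a = restrict f S" "real_polynomial_function f" "\<forall>x\<in>T. f x = 0"
      and g: "b = restrict g S" "real_polynomial_function g"
      by (auto simp: vanishing_ideal_def carrier_poly_fun_ring)
    show "b \<otimes>\<^bsub>?R\<^esub> a \<in> vanishing_ideal S T"
      unfolding f(1) g(1) mult_poly_fun_ring
      using T f g by (subst restrict_in_vanishing_ideal) (auto intro: real_polynomial_function.intros)
    show "a \<otimes>\<^bsub>?R\<^esub> b \<in> vanishing_ideal S T"
      unfolding f(1) g(1) mult_poly_fun_ring
      using T f g by (subst restrict_in_vanishing_ideal) (auto intro: real_polynomial_function.intros)
  qed
  then show ?thesis
  proof (rule primeidealI)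
    show "cring ?R" ..
    have "restrict (\<lambda>x. 1) S \<notin> vanishing_ideal S T"
      using T by (subst restrict_in_vanishing_ideal)
        (auto simp: poly_irreducible_def intro: real_polynomial_function.intros)
    moreover have "restrict (\<lambda>x. 1) S \<in> carrier ?R"
      using one_closed one_poly_fun_ring by metis
    ultimately show "carrier ?R \<noteq> vanishing_ideal S T" by blast
  next
    fix a b assume ab: "a \<in> carrier ?R" "b \<in> carrier ?R" "a \<otimes>\<^bsub>?R\<^esub> b \<in> vanishing_ideal S T"
    then obtain f g where f: "a = restrict f S" "real_polynomial_function f"
      and g: "b = restrict g S" "real_polynomial_function g"
      by (auto simp: carrier_poly_fun_ring)
    have "\<forall>x\<in>T. f x * g x = 0"
      using ab(3) restrict_in_vanishing_ideal[OF T(1) real_polynomial_function.intros(4)[OF f(2) g(2)]]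
      unfolding f(1) g(1) mult_poly_fun_ring by simp
    with f(2) g(2) T(2) have "(\<forall>x\<in>T. f x = 0) \<or> (\<forall>x\<in>T. g x = 0)"
      unfolding poly_irreducible_def by blast
    then show "a \<in> vanishing_ideal S T \<or> b \<in> vanishing_ideal S T"
      by (simp add: f g restrict_in_vanishing_ideal T(1))
  qed
qed

text \<open>Vanishing ideals reverse inclusions, so the chain of primes is indexed by
  \<open>d - i\<close>. The function \<open>y j\<close> separates two consecutive ideals.\<close>

lemma semialg_dim_ge:
  assumes T: "\<And>j. j \<le> d \<Longrightarrow> poly_irreducible (T j)" "\<And>j. j \<le> d \<Longrightarrow> T j \<subseteq> S"
    and mono: "\<And>j. j < d \<Longrightarrow> T j \<subseteq> T (Suc j)"
    and y: "\<And>j. j < d \<Longrightarrow> real_polynomial_function (y j)"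
      "\<And>j x. j < d \<Longrightarrow> x \<in> T j \<Longrightarrow> y j x = 0"
      "\<And>j. j < d \<Longrightarrow> \<exists>x\<in>T (Suc j). y j x \<noteq> 0"
  shows "ereal (real d) \<le> semialg_dim S"
proof -
  define P where "P i = vanishing_ideal S (T (d - i))" for i
  have "primeideal (P i) (poly_fun_ring S)" for i
    unfolding P_def using T by (intro primeideal_vanishing_ideal) auto
  moreover have "P i \<subset> P (Suc i)" if "i < d" for i
  proof -
    define j where "j = d - Suc i"
    have j: "j < d" "d - i = Suc j" using that by (auto simp: j_def)
    have "P i \<subseteq> P (Suc i)"
      using mono[OF j(1)] by (auto simp: P_def j(2) vanishing_ideal_def simp flip: j_def)
    moreover have "restrict (y j) S \<in> P (Suc i)"
      unfolding P_def j_def[symmetric]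
      using y[OF j(1)] j T(2)[of j] by (subst restrict_in_vanishing_ideal) auto
    moreover have "restrict (y j) S \<notin> P i"
      unfolding P_def j using y[OF j(1)] j T(2)[of "Suc j"] by (subst restrict_in_vanishing_ideal) auto
    ultimately show ?thesis by blast
  qed
  ultimately show ?thesis
    unfolding semialg_dim_def krull_dim_def by (intro Sup_upper) blast
qed

section \<open>Polynomial relations between finitely many functions\<close>

fun monom_eval :: "nat list \<Rightarrow> ('a \<Rightarrow> real) list \<Rightarrow> 'a \<Rightarrow> real" where
  "monom_eval (b # bs) (x # xs) t = x t ^ b * monom_eval bs xs t"
| "monom_eval _ _ t = 1"

lemma monom_eval_Nil: "monom_eval [] xs = (\<lambda>t. 1)" "monom_eval l [] = (\<lambda>t. 1)"
  by (cases xs; auto)+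

text \<open>Each exponent is bounded separately rather than the total degree; this gives exactly
  \<open>Suc N ^ m\<close> exponent lists and lets the first variable be split off with the same
  \<open>N\<close>.\<close>

definition exps :: "nat \<Rightarrow> nat \<Rightarrow> nat list set" where
  "exps N m = {l. length l = m \<and> set l \<subseteq> {..N}}"

definition poly_eval :: "nat \<Rightarrow> (nat list \<Rightarrow> real) \<Rightarrow> ('a \<Rightarrow> real) list \<Rightarrow> 'a \<Rightarrow> real" where
  "poly_eval N c xs t = (\<Sum>l\<in>exps N (length xs). c l * monom_eval l xs t)"

lemma finite_exps [simp]: "finite (exps N m)"
  and card_exps: "card (exps N m) = Suc N ^ m"
  using finite_lists_length_eq[of "{..N}" m] card_lists_length_eq[of "{..N}" m]
  by (simp_all add: exps_def conj_commute)

lemma exps_0: "exps N 0 = {[]}"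
  by (auto simp: exps_def)

lemma sum_exps_Suc: "(\<Sum>l\<in>exps N (Suc m). f l) = (\<Sum>b\<le>N. \<Sum>l\<in>exps N m. f (b # l))"
proof -
  have "exps N (Suc m) = (\<lambda>(b, l). b # l) ` ({..N} \<times> exps N m)"
    by (auto simp: exps_def length_Suc_conv image_iff)
  moreover have "inj_on (\<lambda>(b, l). b # l) ({..N} \<times> exps N m)"
    by (auto simp: inj_on_def)
  ultimately show ?thesis
    by (simp add: sum.reindex sum.cartesian_product case_prod_unfold)
qed

lemma poly_eval_Nil: "poly_eval N c [] t = c []"
  by (simp add: poly_eval_def exps_0)

lemma poly_eval_Cons: "poly_eval N c (x # xs) t = (\<Sum>b\<le>N. x t ^ b * poly_eval N (\<lambda>l. c (b # l)) xs t)"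
  by (simp add: poly_eval_def sum_exps_Suc sum_distrib_left mult_ac)

lemma real_polynomial_function_monom_eval:
  "(\<And>x. x \<in> set xs \<Longrightarrow> real_polynomial_function x) \<Longrightarrow> real_polynomial_function (monom_eval l xs)"
proof (induction l xs rule: list_induct2')
  case (4 b l x xs)
  then show ?case by (auto intro!: real_polynomial_function.intros(4) real_polynomial_function_power)
qed (simp_all add: real_polynomial_function.intros(2) monom_eval_Nil)

lemma real_polynomial_function_poly_eval:
  "(\<And>x. x \<in> set xs \<Longrightarrow> real_polynomial_function x) \<Longrightarrow> real_polynomial_function (poly_eval N c xs)"
  unfolding poly_eval_def
  by (intro real_polynomial_function_sum real_polynomial_function.intros(2,4)
      real_polynomial_function_monom_eval) auto

text \<open>
  The lexicographically least monomial of the relation is stripped off one variable at a time: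
  \<open>x\<^sub>i\<close> is invertible modulo \<open>P i\<close> and zero modulo \<open>P (Suc i)\<close>.
\<close>
lemma poly_eval_prime_chain:
  fixes P :: "nat \<Rightarrow> ('a::euclidean_space \<Rightarrow> real) set"
  assumes "\<And>x. x \<in> set xs \<Longrightarrow> real_polynomial_function x"
    and "\<And>i f g. f \<in> P i \<Longrightarrow> g \<in> P i \<Longrightarrow> (\<lambda>t. f t - g t) \<in> P i"
    and "\<And>i f g. f \<in> P i \<Longrightarrow> real_polynomial_function g \<Longrightarrow> (\<lambda>t. f t * g t) \<in> P i"
    and "\<And>i f g. real_polynomial_function f \<Longrightarrow> real_polynomial_function g
           \<Longrightarrow> (\<lambda>t. f t * g t) \<in> P i \<Longrightarrow> f \<in> P i \<or> g \<in> P i"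
    and "\<And>i. (\<lambda>t. 1) \<notin> P i"
    and "\<And>i. i < length xs \<Longrightarrow> P i \<subseteq> P (Suc i)"
    and "\<And>i. i < length xs \<Longrightarrow> xs ! i \<in> P (Suc i) - P i"
    and "poly_eval N c xs \<in> P 0" and "l \<in> exps N (length xs)"
  shows "c l = 0"
  using assms
proof (induction xs arbitrary: P c l)
  case Nil
  have "c [] = 0"
  proof (rule ccontr)
    assume "c [] \<noteq> 0"
    have "(\<lambda>t. poly_eval N c [] t * inverse (c [])) \<in> P 0"
      using Nil.prems by (intro Nil.prems(3)) (auto intro: real_polynomial_function.intros(2))
    with \<open>c [] \<noteq> 0\<close> Nil.prems(5) show False by (simp add: poly_eval_Nil)
  qed
  with Nil show ?case by (simp add: exps_0)
next
  case (Cons x xs)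
  note poly = Cons.prems(1)
  let ?g = "\<lambda>b. poly_eval N (\<lambda>l. c (b # l)) xs"
  have x: "x \<in> P 1" "x \<notin> P 0" using Cons.prems(7)[of 0] by auto
  have xp: "real_polynomial_function x" using poly by simp
  have gp: "real_polynomial_function (?g b)" for b
    using poly by (intro real_polynomial_function_poly_eval) auto
  \<comment> \<open>\<open>x\<close> lies outside the prime \<open>P 0\<close>, so powers of it can
    be cancelled there.\<close>
  have pow: "(\<lambda>t. x t ^ b * f t) \<in> P 0 \<Longrightarrow> real_polynomial_function f \<Longrightarrow> f \<in> P 0" for b f
  proof (induction b)
    case (Suc b)
    have "(\<lambda>t. x t * (x t ^ b * f t)) \<in> P 0" using Suc by (simp add: mult_ac)
    then have "x \<in> P 0 \<or> (\<lambda>t. x t ^ b * f t) \<in> P 0"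
      using xp Suc.prems by (intro Cons.prems(4))
        (auto intro!: real_polynomial_function.intros(4) real_polynomial_function_power)
    with Suc x show ?case by simp
  qed simp
  have zero: "c (b # l) = 0" if "b \<le> N" "l \<in> exps N (length xs)" for b l
    using that
  proof (induction b arbitrary: l rule: less_induct)
    case (less b)
    \<comment> \<open>By induction the coefficients of powers of \<open>x\<close> below
      \<open>b\<close> vanish, so \<open>x ^ b\<close> factors out of the relation;
      \<open>x * h\<close> is the part of the quotient that comes from the powers above
      \<open>b\<close>.\<close>
    define h where "h = (\<lambda>t. \<Sum>i\<in>{Suc b..N}. x t ^ (i - Suc b) * ?g i t)"
    have hp: "real_polynomial_function h"
      unfolding h_def using xp gp
      by (intro real_polynomial_function_sum)
        (auto intro!: real_polynomial_function.intros(4) real_polynomial_function_power)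
    have "poly_eval N c (x # xs) t = x t ^ b * (?g b t + x t * h t)" for t
    proof -
      have "poly_eval N c (x # xs) t = (\<Sum>i\<in>{b..N}. x t ^ i * ?g i t)"
        unfolding poly_eval_Cons
        using less by (intro sum.mono_neutral_right) (auto simp: poly_eval_def)
      also have "\<dots> = x t ^ b * ?g b t + (\<Sum>i\<in>{Suc b..N}. x t ^ i * ?g i t)"
        using less(2) by (simp add: sum.atLeast_Suc_atMost)
      also have "(\<Sum>i\<in>{Suc b..N}. x t ^ i * ?g i t) = x t ^ b * (x t * h t)"
        unfolding h_def sum_distrib_left
      proof (intro sum.cong refl)
        fix i assume "i \<in> {Suc b..N}"
        then have "i = b + Suc (i - Suc b)" by simp
        then have eq: "x t ^ i = x t ^ b * (x t * x t ^ (i - Suc b))" by (metis power_add power_Suc)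
        show "x t ^ i * ?g i t = x t ^ b * (x t * (x t ^ (i - Suc b) * ?g i t))"
          by (simp only: eq mult.assoc)
      qed
      finally show ?thesis by (simp add: distrib_left)
    qed
    then have "(\<lambda>t. x t ^ b * (?g b t + x t * h t)) \<in> P 0"
      using Cons.prems(8) by (metis (no_types, lifting) ext)
    then have "(\<lambda>t. ?g b t + x t * h t) \<in> P 0"
      by (rule pow) (intro real_polynomial_function.intros gp hp xp)+
    \<comment> \<open>Passing from \<open>P 0\<close> to \<open>P 1\<close>, which contains
      \<open>x\<close>, leaves a relation \<open>?g b\<close> in the other variables, to which the
      induction hypothesis applies along the shifted chain.\<close>
    then have "(\<lambda>t. ?g b t + x t * h t) \<in> P 1" using Cons.prems(6)[of 0] by auto
    from Cons.prems(2)[OF this Cons.prems(3)[OF x(1) hp]] have "?g b \<in> P 1" by simp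
    then have g0: "?g b \<in> P (Suc 0)" by simp
    have sub: "P (Suc i) \<subseteq> P (Suc (Suc i))" if "i < length xs" for i
      using Cons.prems(6)[of "Suc i"] that by simp
    have nth: "xs ! i \<in> P (Suc (Suc i)) - P (Suc i)" if "i < length xs" for i
      using Cons.prems(7)[of "Suc i"] that by simp
    have poly': "real_polynomial_function f" if "f \<in> set xs" for f using poly that by simp
    show ?case
      by (rule Cons.IH[of "\<lambda>i. P (Suc i)" "\<lambda>l. c (b # l)", OF poly' Cons.prems(2-5) sub nth g0 less(3)])
  qed
  from Cons.prems(9) obtain b l' where "l = b # l'" "b \<le> N" "l' \<in> exps N (length xs)"
    by (auto simp: exps_def length_Suc_conv)
  with zero show ?case by simp
qed

lemma semialg_dim_le:
  fixes S :: "'a::euclidean_space set"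
  assumes dep: "\<And>xs :: ('a \<Rightarrow> real) list. length xs = Suc d \<Longrightarrow>
      (\<And>x. x \<in> set xs \<Longrightarrow> real_polynomial_function x) \<Longrightarrow>
      \<exists>N c. (\<exists>l\<in>exps N (Suc d). c l \<noteq> 0) \<and> (\<forall>t\<in>S. poly_eval N c xs t = 0)"
  shows "semialg_dim S \<le> ereal (real d)"
  unfolding semialg_dim_def krull_dim_def
proof (rule Sup_least, clarsimp)
  let ?R = "poly_fun_ring S"
  fix l :: nat and P :: "nat \<Rightarrow> ('a \<Rightarrow> real) set"
  assume prime: "\<forall>i\<le>l. primeideal (P i) ?R" and strict: "\<forall>i<l. P i \<subset> P (Suc i)"
  show "l \<le> d"
  proof (rule ccontr)
    assume "\<not> l \<le> d"
    then have l: "Suc d \<le> l" by simp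
    \<comment> \<open>Pulling the primes back to polynomial functions on the whole space replaces
      arithmetic of restrictions by pointwise arithmetic. \<open>min i l\<close> continues the chain
      constantly, so that every index yields a prime.\<close>
    define Q where "Q i = {f. real_polynomial_function f \<and> restrict f S \<in> P (min i l)}" for i
    have pr: "primeideal (P (min i l)) ?R" for i using prime by simp
    have id: "ideal (P (min i l)) ?R" for i using pr primeideal.axioms(1) by blast
    have carr: "restrict f S \<in> carrier ?R" if "real_polynomial_function f" for f
      using that by (auto simp: carrier_poly_fun_ring)
    have Qmult: "(\<lambda>t. f t * g t) \<in> Q i" if "f \<in> Q i" "real_polynomial_function g" for f g i
      using that ideal.I_r_closed[OF id _ carr, of "restrict f S" i g]
      by (auto simp: Q_def mult_poly_fun_ring intro: real_polynomial_function.intros)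
    have Qadd: "(\<lambda>t. f t + g t) \<in> Q i" if "f \<in> Q i" "g \<in> Q i" for f g i
      using that additive_subgroup.a_closed[OF ideal.axioms(1)[OF id], of "restrict f S" i "restrict g S"]
      by (auto simp: Q_def add_poly_fun_ring intro: real_polynomial_function.intros)
    have Qdiff: "(\<lambda>t. f t - g t) \<in> Q i" if "f \<in> Q i" "g \<in> Q i" for f g i
      using Qadd[OF that(1) Qmult[OF that(2) real_polynomial_function.intros(2)[of "-1"]]] by simp
    have Qprime: "f \<in> Q i \<or> g \<in> Q i" if "real_polynomial_function f" "real_polynomial_function g"
      "(\<lambda>t. f t * g t) \<in> Q i" for f g i
      using that primeideal.I_prime[OF pr carr carr, of f g i]
      by (auto simp: Q_def mult_poly_fun_ring)
    have Q1: "(\<lambda>t. 1) \<notin> Q i" for i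
      using ideal.one_imp_carrier[OF id, of i] primeideal.I_notcarr[OF pr, of i]
      by (auto simp: Q_def one_poly_fun_ring)
    have Qz: "f \<in> Q i" if "real_polynomial_function f" "\<forall>t\<in>S. f t = 0" for f i
    proof -
      have "restrict f S = \<zero>\<^bsub>?R\<^esub>" using that(2) by (auto simp: zero_poly_fun_ring)
      then show ?thesis
        using that(1) additive_subgroup.zero_closed[OF ideal.axioms(1)[OF id]] by (simp add: Q_def)
    qed
    have "\<exists>x. x \<in> Q (Suc i) - Q i" if "i < Suc d" for i
    proof -
      have "P i \<subset> P (Suc i)" using strict that l by simp
      then obtain z where z: "z \<in> P (Suc i)" "z \<notin> P i" by blast
      have "z \<in> carrier ?R"
        using z(1) id[of "Suc i"] that l additive_subgroup.a_subset[OF ideal.axioms(1)] by (auto simp: min_def)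
      then obtain f where "z = restrict f S" "real_polynomial_function f"
        by (auto simp: carrier_poly_fun_ring)
      with z that l show ?thesis by (auto simp: Q_def min_def)
    qed
    then obtain x where x: "\<And>i. i < Suc d \<Longrightarrow> x i \<in> Q (Suc i) - Q i" by metis
    define xs where "xs = map x [0..<Suc d]"
    have len: "length xs = Suc d" by (simp add: xs_def)
    have nth: "xs ! i = x i" if "i < Suc d" for i
      using that by (auto simp: xs_def simp del: upt_Suc)
    have poly: "real_polynomial_function f" if "f \<in> set xs" for f
      using that x by (auto simp: xs_def Q_def simp del: upt_Suc)
    obtain N c l' where c: "l' \<in> exps N (Suc d)" "c l' \<noteq> 0" "\<forall>t\<in>S. poly_eval N c xs t = 0"
      using dep[OF len] poly by blast
    have "c l' = 0"
    proof (rule poly_eval_prime_chain[of xs Q N c l'])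
      show "poly_eval N c xs \<in> Q 0"
        by (intro Qz real_polynomial_function_poly_eval poly) (use c in auto)
      show "Q i \<subseteq> Q (Suc i)" if "i < length xs" for i
        using that l len strict[rule_format, of i] by (auto simp: Q_def min_def)
      show "xs ! i \<in> Q (Suc i) - Q i" if "i < length xs" for i
        using x[of i] nth[of i] that len by simp
      show "l' \<in> exps N (length xs)" using c(1) len by simp
      show "real_polynomial_function f" if "f \<in> set xs" for f using that by (rule poly)
      show "(\<lambda>t. f t - g t) \<in> Q i" if "f \<in> Q i" "g \<in> Q i" for i f g using that by (rule Qdiff)
      show "(\<lambda>t. f t * g t) \<in> Q i" if "f \<in> Q i" "real_polynomial_function g" for i f g
        using that by (rule Qmult)
      show "f \<in> Q i \<or> g \<in> Q i" if "real_polynomial_function f" "real_polynomial_function g"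
        "(\<lambda>t. f t * g t) \<in> Q i" for i f g using that by (rule Qprime)
      show "(\<lambda>t. 1) \<notin> Q i" for i by (rule Q1)
    qed
    with c show False by simp
  qed
qed

section \<open>Rational charts\<close>

text \<open>Parameters are functions on an arbitrary index type, so sets of matrix positions can
  index them directly; \<open>A\<close> records which of them may occur, and only
  \<open>card A\<close> enters the dimension count.\<close>

inductive coord_poly :: "'p set \<Rightarrow> (('p \<Rightarrow> real) \<Rightarrow> real) \<Rightarrow> bool" for A where
  coord_poly_const: "coord_poly A (\<lambda>t. c)"
| coord_poly_var: "i \<in> A \<Longrightarrow> coord_poly A (\<lambda>t. t i)"
| coord_poly_add: "coord_poly A f \<Longrightarrow> coord_poly A g \<Longrightarrow> coord_poly A (\<lambda>t. f t + g t)"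
| coord_poly_mult: "coord_poly A f \<Longrightarrow> coord_poly A g \<Longrightarrow> coord_poly A (\<lambda>t. f t * g t)"

lemma coord_poly_uminus: "coord_poly A f \<Longrightarrow> coord_poly A (\<lambda>t. - f t)"
  using coord_poly_mult[OF coord_poly_const[of A "-1"]] by simp

lemma coord_poly_diff: "coord_poly A f \<Longrightarrow> coord_poly A g \<Longrightarrow> coord_poly A (\<lambda>t. f t - g t)"
  using coord_poly_add[OF _ coord_poly_uminus] by force

lemma coord_poly_sum: "(\<And>x. x \<in> X \<Longrightarrow> coord_poly A (f x)) \<Longrightarrow> coord_poly A (\<lambda>t. \<Sum>x\<in>X. f x t)"
  by (induction X rule: infinite_finite_induct) (auto intro: coord_poly.intros)

lemma coord_poly_prod: "(\<And>x. x \<in> X \<Longrightarrow> coord_poly A (f x)) \<Longrightarrow> coord_poly A (\<lambda>t. \<Prod>x\<in>X. f x t)"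
  by (induction X rule: infinite_finite_induct) (auto intro: coord_poly.intros)

lemma coord_poly_power: "coord_poly A f \<Longrightarrow> coord_poly A (\<lambda>t. f t ^ n)"
  by (induction n) (auto intro: coord_poly.intros)

lemma coord_poly_on_line:
  assumes "coord_poly A f"
  shows "\<exists>p. \<forall>s. f (\<lambda>i. a i + s * b i) = poly p s"
  using assms
proof induction
  case (coord_poly_const c)
  show ?case by (intro exI[of _ "[:c:]"]) simp
next
  case (coord_poly_var i)
  show ?case by (intro exI[of _ "[:a i, b i:]"]) simp
next
  case (coord_poly_add f g)
  then show ?case by (metis poly_add)
next
  case (coord_poly_mult f g)
  then show ?case by (metis poly_mult)
qed

definition monomial :: "'p set \<Rightarrow> ('p \<Rightarrow> nat) \<Rightarrow> ('p \<Rightarrow> real) \<Rightarrow> real" where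
  "monomial A \<alpha> t = (\<Prod>i\<in>A. t i ^ \<alpha> i)"

text \<open>The degree is bounded in each variable: the monomials form a box with
  \<open>(D + 1) ^ card A\<close> elements, and the bounds add under multiplication.\<close>

definition multidegree_le :: "'p set \<Rightarrow> nat \<Rightarrow> (('p \<Rightarrow> real) \<Rightarrow> real) \<Rightarrow> bool" where
  "multidegree_le A D f \<longleftrightarrow> (\<exists>c. \<forall>t. f t = (\<Sum>\<alpha>\<in>PiE A (\<lambda>_. {..D}). c \<alpha> * monomial A \<alpha> t))"

context
  fixes A :: "'p set"
  assumes fin: "finite A"
begin

lemma finite_PiE_atMost: "finite (PiE A (\<lambda>_. {..D::nat}))"
  using fin by (intro finite_PiE) auto

lemma multidegree_le_monomial:
  assumes "\<And>i. i \<in> A \<Longrightarrow> \<alpha> i \<le> D"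
  shows "multidegree_le A D (\<lambda>t. c * monomial A \<alpha> t)"
proof -
  let ?\<beta> = "restrict \<alpha> A"
  have "?\<beta> \<in> PiE A (\<lambda>_. {..D})" using assms by auto
  moreover have "monomial A ?\<beta> t = monomial A \<alpha> t" for t
    by (auto simp: monomial_def intro: prod.cong)
  ultimately show ?thesis
    unfolding multidegree_le_def
    by (intro exI[of _ "\<lambda>\<gamma>. if \<gamma> = ?\<beta> then c else 0"])
      (simp add: if_distrib[of "\<lambda>x. x * _"] sum.delta finite_PiE_atMost cong: if_cong)
qed

lemma multidegree_le_add:
  assumes "multidegree_le A D f" "multidegree_le A D g"
  shows "multidegree_le A D (\<lambda>t. f t + g t)"
proof -
  from assms obtain c d where
    "\<forall>t. f t = (\<Sum>\<alpha>\<in>PiE A (\<lambda>_. {..D}). c \<alpha> * monomial A \<alpha> t)"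
    "\<forall>t. g t = (\<Sum>\<alpha>\<in>PiE A (\<lambda>_. {..D}). d \<alpha> * monomial A \<alpha> t)"
    unfolding multidegree_le_def by blast
  then show ?thesis
    unfolding multidegree_le_def
    by (intro exI[of _ "\<lambda>\<alpha>. c \<alpha> + d \<alpha>"]) (simp add: distrib_right sum.distrib)
qed

lemma multidegree_le_const: "multidegree_le A D (\<lambda>t. c)"
  using multidegree_le_monomial[of "\<lambda>_. 0" D c] by (simp add: monomial_def)

lemma multidegree_le_sum:
  "(\<And>x. x \<in> X \<Longrightarrow> multidegree_le A D (f x)) \<Longrightarrow> multidegree_le A D (\<lambda>t. \<Sum>x\<in>X. f x t)"
  by (induction X rule: infinite_finite_induct) (auto intro: multidegree_le_const multidegree_le_add)

lemma multidegree_le_mono: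
  assumes "multidegree_le A D f" "D \<le> E"
  shows "multidegree_le A E f"
proof -
  from assms obtain c where c: "\<And>t. f t = (\<Sum>\<alpha>\<in>PiE A (\<lambda>_. {..D}). c \<alpha> * monomial A \<alpha> t)"
    unfolding multidegree_le_def by blast
  have "multidegree_le A E (\<lambda>t. \<Sum>\<alpha>\<in>PiE A (\<lambda>_. {..D}). c \<alpha> * monomial A \<alpha> t)"
    using assms(2) by (intro multidegree_le_sum multidegree_le_monomial) (force simp: PiE_iff)
  moreover have "f = (\<lambda>t. \<Sum>\<alpha>\<in>PiE A (\<lambda>_. {..D}). c \<alpha> * monomial A \<alpha> t)" using c by blast
  ultimately show ?thesis by simp
qed

lemma multidegree_le_mult:
  assumes "multidegree_le A D f" "multidegree_le A E g"
  shows "multidegree_le A (D + E) (\<lambda>t. f t * g t)"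
proof -
  from assms obtain c d where
    c: "\<And>t. f t = (\<Sum>\<alpha>\<in>PiE A (\<lambda>_. {..D}). c \<alpha> * monomial A \<alpha> t)" and
    d: "\<And>t. g t = (\<Sum>\<beta>\<in>PiE A (\<lambda>_. {..E}). d \<beta> * monomial A \<beta> t)"
    unfolding multidegree_le_def by blast
  have "(c \<alpha> * monomial A \<alpha> t) * (d \<beta> * monomial A \<beta> t) = (c \<alpha> * d \<beta>) * monomial A (\<lambda>i. \<alpha> i + \<beta> i) t"
    for \<alpha> \<beta> t
    by (simp add: monomial_def power_add prod.distrib)
  then have "(\<lambda>t. f t * g t) = (\<lambda>t. \<Sum>\<alpha>\<in>PiE A (\<lambda>_. {..D}). \<Sum>\<beta>\<in>PiE A (\<lambda>_. {..E}).
      (c \<alpha> * d \<beta>) * monomial A (\<lambda>i. \<alpha> i + \<beta> i) t)"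
    by (simp only: c d sum_product)
  moreover have "multidegree_le A (D + E) \<dots>"
    by (intro multidegree_le_sum multidegree_le_monomial) (force simp: PiE_iff intro: add_mono)
  ultimately show ?thesis by simp
qed

lemma multidegree_le_power:
  "multidegree_le A E f \<Longrightarrow> multidegree_le A (n * E) (\<lambda>t. f t ^ n)"
proof (induction n)
  case (Suc n)
  from multidegree_le_mult[OF Suc.prems Suc.IH[OF Suc.prems]] show ?case by simp
qed (auto intro: multidegree_le_const)

lemma coord_poly_multidegree_le:
  assumes "coord_poly A f"
  shows "\<exists>D. multidegree_le A D f"
  using assms
proof induction
  case (coord_poly_var i)
  have "t i = 1 * monomial A (\<lambda>j. if j = i then 1 else 0) t" for t
  proof -
    have "monomial A (\<lambda>j. if j = i then 1 else 0) t = (\<Prod>j\<in>A. if j = i then t i else 1)"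
      unfolding monomial_def by (intro prod.cong) auto
    with fin coord_poly_var show ?thesis by simp
  qed
  then have eq: "(\<lambda>t. t i) = (\<lambda>t. 1 * monomial A (\<lambda>j. if j = i then 1 else 0) t)" by blast
  have "multidegree_le A 1 (\<lambda>t. 1 * monomial A (\<lambda>j. if j = i then 1 else 0) t)"
    by (rule multidegree_le_monomial) simp
  from ssubst[OF eq, of "multidegree_le A 1", OF this] show ?case by blast
next
  case (coord_poly_add f g)
  then obtain D E where "multidegree_le A D f" "multidegree_le A E g" by blast
  then have "multidegree_le A (max D E) f" "multidegree_le A (max D E) g"
    using multidegree_le_mono by (metis max.cobounded1, metis max.cobounded2)
  then show ?case using multidegree_le_add by blast
qed (use multidegree_le_const multidegree_le_mult in blast)+

end

text \<open>Gaussian elimination: an equation with a nonzero coefficient at \<open>u0\<close>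
  determines \<open>c u0\<close> from the other unknowns, and substitution into the remaining
  equations removes one equation and one unknown.\<close>

lemma underdetermined_system:
  fixes a :: "'v \<Rightarrow> 'u \<Rightarrow> real"
  assumes "finite V" "finite U" "card V < card U"
  shows "\<exists>c. (\<exists>u\<in>U. c u \<noteq> 0) \<and> (\<forall>v\<in>V. (\<Sum>u\<in>U. c u * a v u) = 0)"
  using assms
proof (induction V arbitrary: U a rule: finite_induct)
  case empty
  then have "U \<noteq> {}" by auto
  then show ?case by (intro exI[of _ "\<lambda>_. 1"]) auto
next
  case (insert v V)
  show ?case
  proof (cases "\<forall>u\<in>U. a v u = 0")
    case True
    have "card V < card U" using insert by simp
    with insert.IH[of U a] insert.prems True show ?thesis by auto
  next
    case False
    then obtain u0 where u0: "u0 \<in> U" "a v u0 \<noteq> 0" by blast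
    let ?U = "U - {u0}"
    have "card V < card ?U" using insert u0 by simp
    then obtain c where c: "\<exists>u\<in>?U. c u \<noteq> 0"
      "\<forall>w\<in>V. (\<Sum>u\<in>?U. c u * (a w u - a w u0 * a v u / a v u0)) = 0"
      using insert.IH[of ?U "\<lambda>w u. a w u - a w u0 * a v u / a v u0"] insert.prems by auto
    define r where "r = (\<Sum>u\<in>?U. c u * a v u)"
    define c' where "c' = c(u0 := - r / a v u0)"
    have split: "(\<Sum>u\<in>U. c' u * a w u) = - r / a v u0 * a w u0 + (\<Sum>u\<in>?U. c u * a w u)" for w
      using u0 insert.prems by (simp add: sum.remove[of U u0] c'_def)
    have "(\<Sum>u\<in>U. c' u * a v u) = 0"
      unfolding split using u0 by (simp add: r_def)
    moreover have "(\<Sum>u\<in>U. c' u * a w u) = 0" if "w \<in> V" for w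
    proof -
      have "0 = (\<Sum>u\<in>?U. c u * a w u - a w u0 / a v u0 * (c u * a v u))"
        unfolding c(2)[rule_format, OF that, symmetric]
        by (intro sum.cong refl) (simp add: right_diff_distrib)
      also have "\<dots> = (\<Sum>u\<in>?U. c u * a w u) - a w u0 / a v u0 * r"
        by (simp add: sum_subtractf sum_distrib_left r_def)
      finally show ?thesis unfolding split by simp
    qed
    moreover have "\<exists>u\<in>U. c' u \<noteq> 0" using c(1) by (auto simp: c'_def)
    ultimately show ?thesis by auto
  qed
qed

text \<open>All coordinates share the denominator \<open>q\<close>, so a single power of
  \<open>q\<close> clears a polynomial in them. Where \<open>q\<close> vanishes,
  \<open>\<phi>\<close> is unconstrained.\<close>

definition rational_chart ::
  "'p set \<Rightarrow> (('p \<Rightarrow> real) \<Rightarrow> real) \<Rightarrow> (('p \<Rightarrow> real) \<Rightarrow> 'a::euclidean_space) \<Rightarrow> bool" where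
  "rational_chart A q \<phi> \<longleftrightarrow> coord_poly A q \<and>
     (\<forall>b\<in>Basis. \<exists>p. coord_poly A p \<and> (\<forall>t. q t \<noteq> 0 \<longrightarrow> \<phi> t \<bullet> b = p t / q t))"

lemma rational_chart_poly:
  assumes chart: "rational_chart A q \<phi>" and f: "real_polynomial_function f"
  shows "\<exists>D g. coord_poly A g \<and> (\<forall>t. q t \<noteq> 0 \<longrightarrow> q t ^ D * f (\<phi> t) = g t)"
  using f
proof induction
  case (linear f)
  from chart obtain p where
    p: "\<And>b. b \<in> Basis \<Longrightarrow> coord_poly A (p b)" "\<And>b t. b \<in> Basis \<Longrightarrow> q t \<noteq> 0 \<Longrightarrow> \<phi> t \<bullet> b = p b t / q t"
    unfolding rational_chart_def by metis
  have "q t ^ 1 * f (\<phi> t) = (\<Sum>b\<in>Basis. p b t * f b)" if "q t \<noteq> 0" for t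
  proof -
    have "f (\<phi> t) = f (\<Sum>b\<in>Basis. (\<phi> t \<bullet> b) *\<^sub>R b)" by (simp add: euclidean_representation)
    also have "\<dots> = (\<Sum>b\<in>Basis. (\<phi> t \<bullet> b) * f b)"
      using linear by (simp add: bounded_linear.linear linear_sum linear_cmul)
    finally show ?thesis
      using that by (simp add: sum_distrib_left p(2))
  qed
  moreover have "coord_poly A (\<lambda>t. \<Sum>b\<in>Basis. p b t * f b)"
    by (intro coord_poly_sum coord_poly_mult p(1) coord_poly_const)
  ultimately show ?case by blast
next
  case (const c)
  have "coord_poly A (\<lambda>t. c)" "\<forall>t. q t \<noteq> 0 \<longrightarrow> q t ^ 0 * c = c"
    by (auto intro: coord_poly_const)
  then show ?case by blast
next
  case (add f1 f2)
  have q: "coord_poly A q" using chart by (simp add: rational_chart_def)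
  from add obtain D1 D2 g1 g2 where g: "coord_poly A g1" "coord_poly A g2"
    "\<And>t. q t \<noteq> 0 \<Longrightarrow> q t ^ D1 * f1 (\<phi> t) = g1 t" "\<And>t. q t \<noteq> 0 \<Longrightarrow> q t ^ D2 * f2 (\<phi> t) = g2 t"
    by metis
  have "q t ^ (D1 + D2) * (f1 (\<phi> t) + f2 (\<phi> t)) = q t ^ D2 * g1 t + q t ^ D1 * g2 t" if "q t \<noteq> 0" for t
    by (simp add: power_add algebra_simps flip: g(3,4)[OF that])
  moreover have "coord_poly A (\<lambda>t. q t ^ D2 * g1 t + q t ^ D1 * g2 t)"
    by (intro coord_poly_add coord_poly_mult coord_poly_power g q)
  ultimately show ?case by blast
next
  case (mult f1 f2)
  from mult obtain D1 D2 g1 g2 where g: "coord_poly A g1" "coord_poly A g2"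
    "\<And>t. q t \<noteq> 0 \<Longrightarrow> q t ^ D1 * f1 (\<phi> t) = g1 t" "\<And>t. q t \<noteq> 0 \<Longrightarrow> q t ^ D2 * f2 (\<phi> t) = g2 t"
    by metis
  have "q t ^ (D1 + D2) * (f1 (\<phi> t) * f2 (\<phi> t)) = g1 t * g2 t" if "q t \<noteq> 0" for t
    by (simp add: power_add mult_ac flip: g(3,4)[OF that])
  moreover have "coord_poly A (\<lambda>t. g1 t * g2 t)"
    by (intro coord_poly_mult g)
  ultimately show ?case by blast
qed

text \<open>Neither the power of \<open>q\<close> nor the degree bound may depend on the exponents
  \<open>l\<close>: one factor must bring all monomials into one space. A variable with exponent
  \<open>b\<close> therefore receives \<open>q ^ (D * N)\<close>, of which
  \<open>q ^ (D * (N - b))\<close> is left over as a polynomial factor.\<close>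

lemma monom_eval_multidegree_le:
  assumes fin: "finite A"
    and E: "\<And>x. x \<in> set xs \<Longrightarrow> \<exists>g. multidegree_le A E g \<and> (\<forall>t. q t \<noteq> 0 \<longrightarrow> q t ^ D * x (\<phi> t) = g t)"
    and qE: "multidegree_le A E (\<lambda>t. q t ^ D)"
    and l: "l \<in> exps N (length xs)"
  shows "\<exists>h. multidegree_le A (N * (length xs * E)) h \<and>
    (\<forall>t. q t \<noteq> 0 \<longrightarrow> q t ^ (length xs * (D * N)) * monom_eval l xs (\<phi> t) = h t)"
  using E l
proof (induction xs arbitrary: l)
  case Nil
  then show ?case using multidegree_le_const[OF fin, of 0 1] by (auto simp: monom_eval_Nil)
next
  case (Cons x xs)
  from Cons.prems(2) obtain b l' where l: "l = b # l'" "b \<le> N" "l' \<in> exps N (length xs)"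
    by (auto simp: exps_def length_Suc_conv)
  obtain h where h: "multidegree_le A (N * (length xs * E)) h"
    "\<forall>t. q t \<noteq> 0 \<longrightarrow> q t ^ (length xs * (D * N)) * monom_eval l' xs (\<phi> t) = h t"
    using Cons.IH[OF Cons.prems(1) l(3)] by auto
  obtain g where g: "multidegree_le A E g" "\<forall>t. q t \<noteq> 0 \<longrightarrow> q t ^ D * x (\<phi> t) = g t"
    using Cons.prems(1) by auto
  have "multidegree_le A ((b * E + (N - b) * E) + N * (length xs * E)) (\<lambda>t. (g t ^ b * (q t ^ D) ^ (N - b)) * h t)"
    by (intro multidegree_le_mult multidegree_le_power fin g h qE)
  also have "(b * E + (N - b) * E) + N * (length xs * E) = N * (length (x # xs) * E)"
    using l(2) by (simp add: algebra_simps flip: add_mult_distrib)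
  finally have "multidegree_le A (N * (length (x # xs) * E)) (\<lambda>t. (g t ^ b * (q t ^ D) ^ (N - b)) * h t)" .
  moreover have "q t ^ (length (x # xs) * (D * N)) * monom_eval l (x # xs) (\<phi> t)
      = (g t ^ b * (q t ^ D) ^ (N - b)) * h t" if "q t \<noteq> 0" for t
  proof -
    have "(q t ^ D) ^ N = (q t ^ D) ^ b * (q t ^ D) ^ (N - b)"
      using l(2) by (simp flip: power_add)
    then have "q t ^ (length (x # xs) * (D * N))
        = (q t ^ D) ^ b * (q t ^ D) ^ (N - b) * q t ^ (length xs * (D * N))"
      by (simp add: power_add power_mult)
    then show ?thesis
      unfolding l(1) monom_eval.simps g(2)[rule_format, OF that, symmetric]
        h(2)[rule_format, OF that, symmetric] power_mult_distrib
      by (simp only: mult_ac)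
  qed
  ultimately show ?case by blast
qed

text \<open>The point is that \<open>E\<close> is chosen before \<open>N\<close>: the degree of the
  cleared monomials grows only linearly in \<open>N\<close>, although the power \<open>r\<close> of
  the denominator may vary with \<open>N\<close>.\<close>

lemma rational_chart_monom_eval:
  assumes chart: "rational_chart A q \<phi>" and fin: "finite A"
    and xs: "\<And>x. x \<in> set xs \<Longrightarrow> real_polynomial_function x"
  shows "\<exists>E. \<forall>N. \<exists>r. \<forall>l\<in>exps N (length xs). \<exists>h. multidegree_le A (N * E) h \<and>
    (\<forall>t. q t \<noteq> 0 \<longrightarrow> q t ^ r * monom_eval l xs (\<phi> t) = h t)"
proof -
  have q: "coord_poly A q" using chart by (simp add: rational_chart_def)
  have "\<forall>x\<in>set xs. \<exists>D g. coord_poly A g \<and> (\<forall>t. q t \<noteq> 0 \<longrightarrow> q t ^ D * x (\<phi> t) = g t)"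
    using rational_chart_poly[OF chart xs] by blast
  then obtain D g where g: "\<And>x. x \<in> set xs \<Longrightarrow> coord_poly A (g x)"
    "\<And>x t. x \<in> set xs \<Longrightarrow> q t \<noteq> 0 \<Longrightarrow> q t ^ D x * x (\<phi> t) = g x t"
    by metis
  define D' where "D' = sum_list (map D xs)"
  have le: "D x \<le> D'" if "x \<in> set xs" for x
    unfolding D'_def using that by (intro member_le_sum_list) auto
  define g' where "g' x t = q t ^ (D' - D x) * g x t" for x t
  have g'p: "coord_poly A (g' x)" if "x \<in> set xs" for x
    unfolding g'_def by (intro coord_poly_mult coord_poly_power q g that)
  have g': "q t ^ D' * x (\<phi> t) = g' x t" if "x \<in> set xs" "q t \<noteq> 0" for x t
    unfolding g'_def using g(2)[OF that] le[OF that(1)]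
    by (metis (no_types, opaque_lifting) le_add_diff_inverse2 mult.assoc power_add)
  have "\<forall>x\<in>set xs. \<exists>e. multidegree_le A e (g' x)"
    using coord_poly_multidegree_le[OF fin g'p] by blast
  then obtain e where e: "\<And>x. x \<in> set xs \<Longrightarrow> multidegree_le A (e x) (g' x)" by metis
  obtain e0 where e0: "multidegree_le A e0 (\<lambda>t. q t ^ D')"
    using coord_poly_multidegree_le[OF fin coord_poly_power[OF q]] by blast
  define E where "E = e0 + sum_list (map e xs)"
  have eE: "e x \<le> E" if "x \<in> set xs" for x
    using member_le_sum_list[of "e x" "map e xs"] that by (auto simp: E_def)
  have "\<exists>g. multidegree_le A E g \<and> (\<forall>t. q t \<noteq> 0 \<longrightarrow> q t ^ D' * x (\<phi> t) = g t)" if "x \<in> set xs" for x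
    using multidegree_le_mono[OF fin e[OF that] eE[OF that]] g'[OF that] by blast
  moreover have "multidegree_le A E (\<lambda>t. q t ^ D')"
    by (rule multidegree_le_mono[OF fin e0]) (simp add: E_def)
  ultimately show ?thesis
    using monom_eval_multidegree_le[OF fin, of xs E q D' \<phi>] by blast
qed

text \<open>
  Counting: on each chart the pullbacks of the \<open>(N + 1) ^ (d + 1)\<close> monomials in \<open>d + 1\<close> functions lie,
  after clearing denominators, in a space of dimension \<open>O(N ^ d)\<close>.
\<close>
lemma semialg_dim_le_charts:
  fixes \<phi> :: "'i \<Rightarrow> ('p \<Rightarrow> real) \<Rightarrow> 'a::euclidean_space"
  assumes I: "finite I"
    and chart: "\<And>i. i \<in> I \<Longrightarrow> rational_chart (A i) (q i) (\<phi> i)"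
    and A: "\<And>i. i \<in> I \<Longrightarrow> finite (A i)" "\<And>i. i \<in> I \<Longrightarrow> card (A i) = d"
    and S: "\<And>x. x \<in> S \<Longrightarrow> \<exists>i\<in>I. \<exists>t. q i t \<noteq> 0 \<and> x = \<phi> i t"
  shows "semialg_dim S \<le> ereal (real d)"
proof (rule semialg_dim_le)
  fix xs :: "('a \<Rightarrow> real) list"
  assume len: "length xs = Suc d" and xs: "\<And>x. x \<in> set xs \<Longrightarrow> real_polynomial_function x"
  have "\<forall>i\<in>I. \<exists>E. \<forall>N. \<exists>r. \<forall>l\<in>exps N (length xs). \<exists>h. multidegree_le (A i) (N * E) h \<and>
      (\<forall>t. q i t \<noteq> 0 \<longrightarrow> q i t ^ r * monom_eval l xs (\<phi> i t) = h t)"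
    using rational_chart_monom_eval[OF chart A(1) xs] by blast
  then obtain E where E: "\<And>i N. i \<in> I \<Longrightarrow> \<exists>r. \<forall>l\<in>exps N (length xs). \<exists>h. multidegree_le (A i) (N * E i) h \<and>
      (\<forall>t. q i t \<noteq> 0 \<longrightarrow> q i t ^ r * monom_eval l xs (\<phi> i t) = h t)"
    by metis
  define F where "F = sum E I"
  have EF: "E i \<le> F" if "i \<in> I" for i unfolding F_def using that I by (simp add: member_le_sum)
  \<comment> \<open>\<open>N\<close> is chosen so that \<open>card I\<close> charts with at most
    \<open>((F + 1) * (N + 1)) ^ d\<close> monomials each give at most
    \<open>N * (N + 1) ^ d\<close> equations, fewer than the \<open>(N + 1) ^ (d + 1)\<close>
    unknown coefficients.\<close>
  define N where "N = card I * Suc F ^ d"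
  have "\<exists>r c. \<forall>l\<in>exps N (Suc d). \<forall>t. q i t \<noteq> 0 \<longrightarrow> q i t ^ r * monom_eval l xs (\<phi> i t)
      = (\<Sum>\<alpha>\<in>PiE (A i) (\<lambda>_. {..N * F}). c l \<alpha> * monomial (A i) \<alpha> t)" if i: "i \<in> I" for i
  proof -
    obtain r where r: "\<forall>l\<in>exps N (length xs). \<exists>h. multidegree_le (A i) (N * E i) h \<and>
      (\<forall>t. q i t \<noteq> 0 \<longrightarrow> q i t ^ r * monom_eval l xs (\<phi> i t) = h t)"
      using E[OF i] by blast
    have "\<forall>l\<in>exps N (Suc d). \<exists>c. \<forall>t. q i t \<noteq> 0 \<longrightarrow> q i t ^ r * monom_eval l xs (\<phi> i t)
      = (\<Sum>\<alpha>\<in>PiE (A i) (\<lambda>_. {..N * F}). c \<alpha> * monomial (A i) \<alpha> t)"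
    proof
      fix l assume l: "l \<in> exps N (Suc d)"
      obtain h where h: "multidegree_le (A i) (N * E i) h"
        "\<forall>t. q i t \<noteq> 0 \<longrightarrow> q i t ^ r * monom_eval l xs (\<phi> i t) = h t"
        using r l len by auto
      have "multidegree_le (A i) (N * F) h"
        by (rule multidegree_le_mono[OF A(1)[OF i] h(1)]) (simp add: EF i)
      then obtain c where "\<forall>t. h t = (\<Sum>\<alpha>\<in>PiE (A i) (\<lambda>_. {..N * F}). c \<alpha> * monomial (A i) \<alpha> t)"
        unfolding multidegree_le_def by blast
      with h(2) show "\<exists>c. \<forall>t. q i t \<noteq> 0 \<longrightarrow> q i t ^ r * monom_eval l xs (\<phi> i t)
        = (\<Sum>\<alpha>\<in>PiE (A i) (\<lambda>_. {..N * F}). c \<alpha> * monomial (A i) \<alpha> t)"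
        by (intro exI[of _ c]) simp
    qed
    from bchoice[OF this] show ?thesis by blast
  qed
  then have "\<forall>i\<in>I. \<exists>r c. \<forall>l\<in>exps N (Suc d). \<forall>t. q i t \<noteq> 0 \<longrightarrow>
      q i t ^ r * monom_eval l xs (\<phi> i t)
      = (\<Sum>\<alpha>\<in>PiE (A i) (\<lambda>_. {..N * F}). c l \<alpha> * monomial (A i) \<alpha> t)" by blast
  from bchoice[OF this] obtain r where "\<forall>i\<in>I. \<exists>c. \<forall>l\<in>exps N (Suc d). \<forall>t. q i t \<noteq> 0 \<longrightarrow>
      q i t ^ r i * monom_eval l xs (\<phi> i t)
      = (\<Sum>\<alpha>\<in>PiE (A i) (\<lambda>_. {..N * F}). c l \<alpha> * monomial (A i) \<alpha> t)" by blast
  from bchoice[OF this] obtain c where c: "\<And>i l t. i \<in> I \<Longrightarrow> l \<in> exps N (Suc d) \<Longrightarrow> q i t \<noteq> 0 \<Longrightarrow>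
      q i t ^ r i * monom_eval l xs (\<phi> i t)
      = (\<Sum>\<alpha>\<in>PiE (A i) (\<lambda>_. {..N * F}). c i l \<alpha> * monomial (A i) \<alpha> t)"
    by blast
  \<comment> \<open>There is one linear equation for each chart and each monomial in its parameters:
    that this monomial cancels in the cleared relation.\<close>
  let ?V = "Sigma I (\<lambda>i. PiE (A i) (\<lambda>_. {..N * F}))"
  have finV: "finite ?V" using I A(1) by (auto intro!: finite_PiE)
  have "card ?V = card I * Suc (N * F) ^ d"
    using I A by (simp add: card_SigmaI finite_PiE card_PiE)
  also have "\<dots> \<le> card I * (Suc F * Suc N) ^ d"
    by (intro mult_left_mono power_mono) (auto simp: algebra_simps)
  also have "\<dots> = N * Suc N ^ d"
    by (simp only: N_def power_mult_distrib mult.assoc)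
  also have "\<dots> < Suc N * Suc N ^ d" by simp
  also have "\<dots> = card (exps N (Suc d))" by (simp add: card_exps)
  finally obtain a where a: "\<exists>l\<in>exps N (Suc d). a l \<noteq> 0"
    "\<forall>v\<in>?V. (\<Sum>l\<in>exps N (Suc d). a l * (case v of (i, \<alpha>) \<Rightarrow> c i l \<alpha>)) = 0"
    using underdetermined_system[OF finV, of "exps N (Suc d)" "\<lambda>(i, \<alpha>) l. c i l \<alpha>"]
    by (auto simp: case_prod_unfold)
  have "poly_eval N a xs x = 0" if "x \<in> S" for x
  proof -
    from S[OF that] obtain i t where it: "i \<in> I" "q i t \<noteq> 0" "x = \<phi> i t" by blast
    have "q i t ^ r i * poly_eval N a xs x
        = (\<Sum>l\<in>exps N (Suc d). a l * (q i t ^ r i * monom_eval l xs (\<phi> i t)))"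
      by (simp add: poly_eval_def len it sum_distrib_left mult_ac)
    also have "\<dots> = (\<Sum>l\<in>exps N (Suc d). \<Sum>\<alpha>\<in>PiE (A i) (\<lambda>_. {..N * F}).
        a l * c i l \<alpha> * monomial (A i) \<alpha> t)"
      by (intro sum.cong refl) (simp add: c it sum_distrib_left mult.assoc)
    also have "\<dots> = (\<Sum>\<alpha>\<in>PiE (A i) (\<lambda>_. {..N * F}).
        (\<Sum>l\<in>exps N (Suc d). a l * c i l \<alpha>) * monomial (A i) \<alpha> t)"
      by (subst sum.swap) (simp add: sum_distrib_right)
    also have "\<dots> = 0"
      using a(2) it by (intro sum.neutral) auto
    finally show ?thesis using it by simp
  qed
  with a(1) show "\<exists>N c. (\<exists>l\<in>exps N (Suc d). c l \<noteq> 0) \<and> (\<forall>t\<in>S. poly_eval N c xs t = 0)" by blast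
qed

text \<open>If neither factor vanished identically, a line would join a point where \<open>f\<close>
  is nonzero to a point where \<open>g\<close> is nonzero. It stays in the coordinate subspace of
  \<open>B\<close>, and along it the numerators and the denominator are nonzero univariate
  polynomials whose product is zero.\<close>

lemma poly_irreducible_chart_image:
  assumes chart: "rational_chart A q \<phi>" and q0: "q (\<lambda>_. 0) \<noteq> 0"
  shows "poly_irreducible (\<phi> ` {t. q t \<noteq> 0 \<and> (\<forall>i. i \<notin> B \<longrightarrow> t i = 0)})"
  unfolding poly_irreducible_def
proof (intro conjI allI impI)
  show "\<phi> ` {t. q t \<noteq> 0 \<and> (\<forall>i. i \<notin> B \<longrightarrow> t i = 0)} \<noteq> {}" using q0 by auto
next
  let ?T = "{t. q t \<noteq> 0 \<and> (\<forall>i. i \<notin> B \<longrightarrow> t i = 0)}"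
  fix f g assume "real_polynomial_function f \<and> real_polynomial_function g \<and> (\<forall>x\<in>\<phi> ` ?T. f x * g x = 0)"
  then have f: "real_polynomial_function f" and g: "real_polynomial_function g"
    and fg: "\<And>t. t \<in> ?T \<Longrightarrow> f (\<phi> t) * g (\<phi> t) = 0" by auto
  show "(\<forall>x\<in>\<phi> ` ?T. f x = 0) \<or> (\<forall>x\<in>\<phi> ` ?T. g x = 0)"
  proof (rule ccontr)
    assume "\<not> ((\<forall>x\<in>\<phi> ` ?T. f x = 0) \<or> (\<forall>x\<in>\<phi> ` ?T. g x = 0))"
    then obtain a b where a: "a \<in> ?T" "f (\<phi> a) \<noteq> 0" and b: "b \<in> ?T" "g (\<phi> b) \<noteq> 0" by auto
    obtain D F where F: "coord_poly A F" "\<forall>t. q t \<noteq> 0 \<longrightarrow> q t ^ D * f (\<phi> t) = F t"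
      using rational_chart_poly[OF chart f] by blast
    obtain E G where G: "coord_poly A G" "\<forall>t. q t \<noteq> 0 \<longrightarrow> q t ^ E * g (\<phi> t) = G t"
      using rational_chart_poly[OF chart g] by blast
    let ?L = "\<lambda>s i. a i + s * (b i - a i)"
    obtain u where u: "\<forall>s. F (?L s) = poly u s"
      using coord_poly_on_line[OF F(1), of a "\<lambda>i. b i - a i"] by blast
    obtain v where v: "\<forall>s. G (?L s) = poly v s"
      using coord_poly_on_line[OF G(1), of a "\<lambda>i. b i - a i"] by blast
    obtain w where w: "\<forall>s. q (?L s) = poly w s"
      using coord_poly_on_line[of A q a "\<lambda>i. b i - a i"] chart by (auto simp: rational_chart_def)
    \<comment> \<open>The factor \<open>w\<close> covers the values of \<open>s\<close> at which the
      line meets the zero set of the denominator.\<close>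
    have "poly (u * v * w) s = 0" for s
    proof (cases "q (?L s) = 0")
      case False
      then have "?L s \<in> ?T" using a b by auto
      from fg[OF this] have "f (\<phi> (?L s)) = 0 \<or> g (\<phi> (?L s)) = 0" by simp
      then have "F (?L s) = 0 \<or> G (?L s) = 0"
        by (auto simp flip: F(2)[rule_format, OF False] G(2)[rule_format, OF False])
      then show ?thesis by (auto simp flip: u[rule_format] v[rule_format])
    qed (simp flip: w[rule_format])
    then have "u * v * w = 0" using poly_all_0_iff_0 by blast
    moreover have "?L 0 = a" "?L 1 = b" by auto
    then have "poly u 0 \<noteq> 0" "poly v 1 \<noteq> 0" "poly w 0 \<noteq> 0"
      using a b F(2)[rule_format, of a] G(2)[rule_format, of b] u[rule_format, of 0] v[rule_format, of 1] w[rule_format, of 0]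
      by auto
    ultimately show False by auto
  qed
qed

text \<open>\<open>y\<close> has to be polynomial on the ambient space of \<open>S\<close>, not in
  the parameters. It need detect the newest parameter only while all later ones are zero.\<close>

lemma semialg_dim_ge_chart:
  fixes \<phi> :: "('p \<Rightarrow> real) \<Rightarrow> 'a::euclidean_space"
  assumes chart: "rational_chart A q \<phi>" and q0: "q (\<lambda>_. 0) \<noteq> 0"
    and S: "\<And>t. q t \<noteq> 0 \<Longrightarrow> \<phi> t \<in> S"
    and y: "\<And>j. j < length ps \<Longrightarrow> \<exists>y. real_polynomial_function y
        \<and> (\<forall>t. q t \<noteq> 0 \<longrightarrow> (\<forall>i. i \<notin> set (take j ps) \<longrightarrow> t i = 0) \<longrightarrow> y (\<phi> t) = 0)
        \<and> (\<exists>t. q t \<noteq> 0 \<and> (\<forall>i. i \<notin> set (take (Suc j) ps) \<longrightarrow> t i = 0) \<and> y (\<phi> t) \<noteq> 0)"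
  shows "ereal (real (length ps)) \<le> semialg_dim S"
proof -
  define T where "T j = \<phi> ` {t. q t \<noteq> 0 \<and> (\<forall>i. i \<notin> set (take j ps) \<longrightarrow> t i = 0)}" for j
  from y obtain y where y: "\<And>j. j < length ps \<Longrightarrow> real_polynomial_function (y j)"
    "\<And>j t. j < length ps \<Longrightarrow> q t \<noteq> 0 \<Longrightarrow> (\<forall>i. i \<notin> set (take j ps) \<longrightarrow> t i = 0) \<Longrightarrow> y j (\<phi> t) = 0"
    "\<And>j. j < length ps \<Longrightarrow> \<exists>t. q t \<noteq> 0 \<and> (\<forall>i. i \<notin> set (take (Suc j) ps) \<longrightarrow> t i = 0) \<and> y j (\<phi> t) \<noteq> 0"
    by metis
  show ?thesis
  proof (rule semialg_dim_ge[of _ T S y])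
    show "poly_irreducible (T j)" for j
      unfolding T_def by (rule poly_irreducible_chart_image[OF chart q0])
    show "T j \<subseteq> S" for j using S by (auto simp: T_def)
    show "T j \<subseteq> T (Suc j)" if "j < length ps" for j
      unfolding T_def using that by (intro image_mono) (auto simp: take_Suc_conv_app_nth)
    show "y j x = 0" if "j < length ps" "x \<in> T j" for j x
      using that y(2) by (auto simp: T_def)
    show "\<exists>x\<in>T (Suc j). y j x \<noteq> 0" if "j < length ps" for j
      using y(3)[OF that] by (auto simp: T_def)
  qed (rule y(1))
qed

section \<open>Orthogonal projections\<close>

lemma matrix_add_rdistrib: "((B :: 'a::semiring_1^'n^'m) + C) ** A = B ** A + C ** A"
  by (simp add: matrix_matrix_mult_def vec_eq_iff sum.distrib distrib_right)

lemma matrix_diff_ldistrib: "(A :: real^'n^'m) ** (B - C) = A ** B - A ** C"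
  by (simp add: matrix_matrix_mult_def vec_eq_iff sum_subtractf right_diff_distrib)

lemma matrix_diff_rdistrib: "((B :: real^'n^'m) - C) ** A = B ** A - C ** A"
  by (simp add: matrix_matrix_mult_def vec_eq_iff sum_subtractf left_diff_distrib)

lemma matrix_minus_left: "(- A :: real^'n^'m) ** B = - (A ** B)"
  by (simp add: matrix_matrix_mult_def vec_eq_iff sum_negf)

lemma matrix_minus_right: "(A :: real^'n^'m) ** (- B) = - (A ** B)"
  by (simp add: matrix_matrix_mult_def vec_eq_iff sum_negf)

lemma matrix_zero_left: "(0 :: real^'n^'m) ** B = 0"
  and matrix_zero_right: "(A :: real^'n^'m) ** 0 = 0"
  by (simp_all add: matrix_matrix_mult_def vec_eq_iff)

lemma matrix_scaleR_left: "(c *\<^sub>R (A :: real^'n^'m)) ** B = c *\<^sub>R (A ** B)"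
  and matrix_scaleR_right: "(A :: real^'n^'m) ** (c *\<^sub>R B) = c *\<^sub>R (A ** B)"
  by (simp_all add: matrix_matrix_mult_def vec_eq_iff sum_distrib_left mult_ac)

lemmas matrix_ring = matrix_add_ldistrib matrix_add_rdistrib matrix_diff_ldistrib matrix_diff_rdistrib
  matrix_minus_left matrix_minus_right matrix_zero_left matrix_zero_right
  matrix_scaleR_left matrix_scaleR_right matrix_mul_lid matrix_mul_rid

lemma transpose_add: "transpose (A + B) = transpose A + transpose B"
  and transpose_diff: "transpose (C - D) = transpose C - transpose (D :: real^'n^'m)"
  and transpose_minus: "transpose (- C) = - transpose C"
  and transpose_zero: "transpose 0 = (0 :: real^'m^'n)"
  by (simp_all add: transpose_def vec_eq_iff)

lemmas transpose_ring = transpose_add transpose_diff transpose_minus transpose_zero transpose_scalar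
  matrix_transpose_mul transpose_mat transpose_transpose

lemma trace_ring: "trace (A + B) = trace A + trace B" "trace (A - B) = trace A - trace B"
  "trace (- A) = - trace A" "trace (c *\<^sub>R A) = c * trace A" "trace 0 = 0"
  "trace (mat 1 :: real^'n^'n) = real CARD('n)" for A B :: "real^'n^'n"
  by (simp_all add: trace_def mat_def sum.distrib sum_subtractf sum_negf sum_distrib_left)

section \<open>Rank-one matrices\<close>

definition outer :: "real^'m \<Rightarrow> real^'n \<Rightarrow> real^'n^'m" where
  "outer v w = (\<chi> i j. v $ i * w $ j)"

lemma outer_mult_outer: "outer v w ** outer x y = (w \<bullet> x) *\<^sub>R outer v y"
  by (simp add: outer_def matrix_matrix_mult_def vec_eq_iff inner_vec_def sum_distrib_left sum_distrib_right mult_ac)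

lemma mult_outer: "A ** outer v w = outer (A *v v) w"
  by (simp add: outer_def matrix_matrix_mult_def matrix_vector_mult_def vec_eq_iff sum_distrib_left
      sum_distrib_right mult_ac)

lemma outer_mult: "outer v w ** A = outer v (transpose A *v w)"
  by (simp add: outer_def matrix_matrix_mult_def matrix_vector_mult_def transpose_def vec_eq_iff
      sum_distrib_left mult_ac del: transpose_matrix_vector)

lemma outer_vec: "outer v w *v x = (w \<bullet> x) *\<^sub>R v"
  by (simp add: outer_def matrix_vector_mult_def vec_eq_iff inner_vec_def sum_distrib_left sum_distrib_right mult_ac)

lemma transpose_outer: "transpose (outer v w) = outer w v"
  by (simp add: outer_def transpose_def vec_eq_iff)

lemma trace_outer: "trace (outer v w) = v \<bullet> w"
  by (simp add: outer_def trace_def inner_vec_def)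

lemma outer_linear:
  "outer (v + v') w = outer v w + outer v' w" "outer v (w + w') = outer v w + outer v w'"
  "outer (v - v') w = outer v w - outer v' w" "outer v (w - w') = outer v w - outer v w'"
  "outer (- v) w = - outer v w" "outer v (- w) = - outer v w"
  "outer (c *\<^sub>R v) w = c *\<^sub>R outer v w" "outer v (c *\<^sub>R w) = c *\<^sub>R outer v w"
  "outer 0 w = 0" "outer v 0 = 0"
  by (simp_all add: outer_def vec_eq_iff algebra_simps)

text \<open>A subspace is represented by its orthogonal projection: \<open>P ** Q = Q\<close> says
  that the range of \<open>Q\<close> lies in that of \<open>P\<close>, \<open>P ** Q = 0\<close>
  that the ranges are orthogonal, and the trace is the dimension.\<close>

definition proj :: "real^'n^'n \<Rightarrow> bool" where
  "proj P \<longleftrightarrow> transpose P = P \<and> P ** P = P"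

lemma projD: "proj P \<Longrightarrow> transpose P = P" "proj P \<Longrightarrow> P ** P = P"
  by (simp_all add: proj_def)

lemma proj_commute_mult: "proj P \<Longrightarrow> proj Q \<Longrightarrow> P ** Q = Q \<Longrightarrow> Q ** P = Q"
  by (metis matrix_transpose_mul proj_def)

lemma proj_orthogonal_commute: "proj P \<Longrightarrow> proj Q \<Longrightarrow> P ** Q = 0 \<Longrightarrow> Q ** P = 0"
  by (metis matrix_transpose_mul proj_def transpose_zero)

lemma proj_add:
  assumes "proj P" "proj Q" "P ** Q = 0"
  shows "proj (P + Q)"
  using assms proj_orthogonal_commute[OF assms] by (simp add: proj_def matrix_ring transpose_ring)

lemma proj_diff:
  assumes "proj P" "proj Q" "P ** Q = Q"
  shows "proj (P - Q)"
  using assms proj_commute_mult[OF assms] by (simp add: proj_def matrix_ring transpose_ring)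

lemma proj_zero: "proj 0" and proj_one: "proj (mat 1)"
  by (simp_all add: proj_def matrix_ring transpose_ring)

lemma proj_outer: "norm v = 1 \<Longrightarrow> proj (outer v v)"
  by (simp add: proj_def transpose_outer outer_mult_outer flip: power2_norm_eq_inner)

lemma trace_proj: "proj P \<Longrightarrow> trace P = (\<Sum>i\<in>UNIV. \<Sum>j\<in>UNIV. (P $ i $ j)\<^sup>2)"
proof -
  assume P: "proj P"
  have "trace P = trace (P ** transpose P)" using projD[OF P] by simp
  also have "\<dots> = (\<Sum>i\<in>UNIV. \<Sum>j\<in>UNIV. (P $ i $ j)\<^sup>2)"
    by (simp add: trace_def matrix_matrix_mult_def transpose_def power2_eq_square)
  finally show ?thesis .
qed

lemma trace_proj_nonneg: "proj P \<Longrightarrow> 0 \<le> trace P"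
  by (simp add: trace_proj sum_nonneg)

lemma trace_proj_eq_0: "proj P \<Longrightarrow> trace P = 0 \<Longrightarrow> P = 0"
  by (simp add: trace_proj sum_nonneg_eq_0_iff sum_nonneg vec_eq_iff)

lemma proj_unit_vector:
  assumes P: "proj P" "P \<noteq> 0"
  shows "\<exists>v. norm v = 1 \<and> P *v v = v"
proof -
  obtain x where x: "P *v x \<noteq> 0" using P(2) by (metis matrix_eq matrix_vector_mult_0)
  let ?v = "(1 / norm (P *v x)) *\<^sub>R (P *v x)"
  have "P *v ?v = ?v"
    by (simp add: matrix_vector_mult_scaleR matrix_vector_mul_assoc projD[OF P(1)])
  moreover have "norm ?v = 1" using x by simp
  ultimately show ?thesis by blast
qed

text \<open>Splits a line off the range of \<open>P\<close>; the inductions on the dimension of a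
  subspace run on this step.\<close>

lemma proj_peel:
  assumes P: "proj P" and v: "norm v = 1" "P *v v = v"
  shows "proj (P - outer v v)" "P ** outer v v = outer v v" "trace (P - outer v v) = trace P - 1"
    "(P - outer v v) ** outer v v = 0" "(P - outer v v) *v v = 0"
proof -
  have vv: "v \<bullet> v = 1" using v by (simp flip: power2_norm_eq_inner)
  show 1: "P ** outer v v = outer v v" by (simp add: mult_outer v)
  show "proj (P - outer v v)" by (rule proj_diff[OF P proj_outer[OF v(1)] 1])
  show "trace (P - outer v v) = trace P - 1" by (simp add: trace_ring trace_outer vv)
  show "(P - outer v v) ** outer v v = 0" by (simp add: matrix_ring 1 outer_mult_outer vv)
  show "(P - outer v v) *v v = 0"
    by (simp add: matrix_vector_mult_diff_rdistrib v outer_vec vv)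
qed

text \<open>Unit vectors are peeled off while \<open>P\<close> is nonzero. The induction is on an
  integer bound for the trace, since the trace is not yet known to be an integer.\<close>

lemma trace_proj_nat: "proj P \<Longrightarrow> \<exists>m::nat. trace P = real m"
proof -
  have "trace P < real N \<Longrightarrow> proj P \<Longrightarrow> \<exists>m::nat. trace P = real m" for N and P :: "real^'n^'n"
  proof (induction N arbitrary: P)
    case 0
    then show ?case using trace_proj_nonneg[of P] by simp
  next
    case (Suc N)
    show ?case
    proof (cases "P = 0")
      case True
      then show ?thesis by (auto simp: trace_ring intro: exI[of _ 0])
    next
      case False
      then obtain v where v: "norm v = 1" "P *v v = v" using proj_unit_vector Suc.prems by blast
      note peel = proj_peel[OF Suc.prems(2) v]
      have "trace (P - outer v v) < real N" using Suc.prems peel(3) by simp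
      from Suc.IH[OF this peel(1)] obtain m where "trace P - 1 = real m" unfolding peel(3) by blast
      then have "trace P = real (Suc m)" by simp
      then show ?thesis by blast
    qed
  qed
  moreover assume "proj P"
  moreover obtain N where "trace P < real N" using reals_Archimedean2 by blast
  ultimately show ?thesis by blast
qed

lemma proj_vec_eq: "P ** Q = Q \<Longrightarrow> Q *v x = x \<Longrightarrow> P *v x = x"
  by (metis matrix_vector_mul_assoc)

text \<open>Each vector of \<open>W\<close> costs one dimension: the component of \<open>w\<close>
  in the current subspace spans the line that is removed. If this component is zero, an arbitrary
  line is removed, so that the trace comes out exactly.\<close>

lemma proj_subspace_avoiding:
  fixes P :: "real^'n^'n"
  assumes "proj P" "finite W" "trace P = real (m + card W)"
  shows "\<exists>R. proj R \<and> P ** R = R \<and> trace R = real m \<and> (\<forall>w\<in>W. R *v w = 0)"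
  using assms(2,3)
proof (induction W arbitrary: m rule: finite_induct)
  case empty
  then show ?case using assms(1) projD(2) by (intro exI[of _ P]) auto
next
  case (insert w W)
  have "trace P = real (Suc m + card W)" using insert by simp
  from insert.IH[OF this] obtain R where R: "proj R" "P ** R = R" "trace R = real (Suc m)" "\<forall>w\<in>W. R *v w = 0"
    by blast
  have "\<exists>v. norm v = 1 \<and> R *v v = v \<and> (R - outer v v) *v w = 0"
  proof (cases "R *v w = 0")
    case True
    have "R \<noteq> 0" using R(3) by (auto simp: trace_ring)
    then obtain v where v: "norm v = 1" "R *v v = v" using proj_unit_vector R(1) by blast
    have "v \<bullet> w = v \<bullet> (R *v w)"
      by (metis R(1) dot_lmul_matrix projD(1) transpose_matrix_vector v(2))
    then show ?thesis using True v by (intro exI[of _ v]) (simp add: matrix_vector_mult_diff_rdistrib outer_vec)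
  next
    case False
    define z where "z = R *v w"
    define v where "v = (1 / norm z) *\<^sub>R z"
    have Rz: "R *v z = z" by (simp add: z_def matrix_vector_mul_assoc projD[OF R(1)])
    have "z \<bullet> w = z \<bullet> (R *v w)"
      by (metis R(1) Rz dot_lmul_matrix projD(1) transpose_matrix_vector)
    then have zw: "z \<bullet> w = (norm z)\<^sup>2" by (simp add: power2_norm_eq_inner flip: z_def)
    have "norm v = 1" "R *v v = v" using False by (auto simp: v_def Rz matrix_vector_mult_scaleR simp flip: z_def)
    moreover have "(R - outer v v) *v w = 0"
      using False by (simp add: matrix_vector_mult_diff_rdistrib outer_vec v_def zw power2_eq_square flip: z_def)
    ultimately show ?thesis by blast
  qed
  then obtain v where v: "norm v = 1" "R *v v = v" "(R - outer v v) *v w = 0" by blast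
  note peel = proj_peel[OF R(1) v(1,2)]
  let ?R = "R - outer v v"
  have RR: "?R ** R = ?R" using peel(1,2) R(1)
    by (metis (no_types, lifting) matrix_diff_ldistrib proj_commute_mult projD(2))
  have "?R *v x = 0" if "x \<in> W" for x
    using R(4) that RR by (metis matrix_vector_mul_assoc matrix_vector_mult_0_right)
  moreover have "P ** ?R = ?R"
  proof -
    have "P *v v = v" using R(2) v(2) by (rule proj_vec_eq)
    then show ?thesis by (simp add: matrix_ring R(2) mult_outer)
  qed
  ultimately show ?case using peel(1,3) v R(3) by (intro exI[of _ ?R]) auto
qed

lemma proj_subspace_avoiding_le:
  fixes P :: "real^'n^'n"
  assumes P: "proj P" and W: "finite W" "card W \<le> b" and tr: "trace P = real (m + b)"
  shows "\<exists>R. proj R \<and> P ** R = R \<and> trace R = real m \<and> (\<forall>w\<in>W. R *v w = 0)"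
proof -
  have "infinite (UNIV :: (real^'n) set)" using not_bounded_UNIV finite_imp_bounded by blast
  then have "infinite (UNIV - W)" using W(1) by (rule Diff_infinite_finite[rotated])
  \<comment> \<open>Padding \<open>W\<close> with arbitrary further vectors to exactly
    \<open>b\<close> elements only adds conditions.\<close>
  then obtain T where T: "finite T" "card T = b - card W" "T \<subseteq> UNIV - W"
    using infinite_arbitrarily_large by blast
  have "card (W \<union> T) = b" using T W by (subst card_Un_disjoint) auto
  then show ?thesis
    using proj_subspace_avoiding[OF P, of "W \<union> T" m] W(1) T(1) tr by auto
qed

text \<open>The unit vectors peeled off \<open>Q\<close> span its range.\<close>

lemma proj_spanning:
  fixes Q :: "real^'n^'n"
  assumes "proj Q" "trace Q = real b"
  shows "\<exists>W. finite W \<and> card W \<le> b \<and> (\<forall>R :: real^'n^'n. (\<forall>w\<in>W. R *v w = 0) \<longrightarrow> R ** Q = 0)"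
  using assms
proof (induction b arbitrary: Q)
  case 0
  then have "Q = 0" using trace_proj_eq_0 by auto
  then show ?case by (intro exI[of _ "{}"]) (simp add: matrix_ring)
next
  case (Suc b)
  then have "Q \<noteq> 0" by (auto simp: trace_ring)
  then obtain v where v: "norm v = 1" "Q *v v = v" using proj_unit_vector Suc.prems by blast
  note peel = proj_peel[OF Suc.prems(1) v]
  obtain W where W: "finite W" "card W \<le> b" "\<And>R :: real^'n^'n. (\<forall>w\<in>W. R *v w = 0) \<Longrightarrow> R ** (Q - outer v v) = 0"
    using Suc.IH[OF peel(1)] Suc.prems(2) peel(3) by auto
  have "R ** Q = 0" if "\<forall>w\<in>insert v W. R *v w = 0" for R :: "real^'n^'n"
    using W(3)[of R] that by (simp add: matrix_ring mult_outer outer_linear)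
  then show ?case using W(1,2) by (intro exI[of _ "insert v W"]) (auto simp: card_insert_if)
qed

text \<open>Being orthogonal to a \<open>b\<close>-dimensional space amounts to \<open>b\<close>
  linear conditions, each of which costs at most one dimension.\<close>

lemma proj_complement_in:
  fixes P Q :: "real^'n^'n"
  assumes "proj P" "proj Q" "trace P = real (m + b)" "trace Q = real b"
  shows "\<exists>R. proj R \<and> P ** R = R \<and> Q ** R = 0 \<and> trace R = real m"
proof -
  obtain W where W: "finite W" "card W \<le> b" "\<And>R :: real^'n^'n. (\<forall>w\<in>W. R *v w = 0) \<Longrightarrow> R ** Q = 0"
    using proj_spanning[OF assms(2,4)] by blast
  from proj_subspace_avoiding_le[OF assms(1) W(1,2) assms(3)] obtain R where R: "proj R" "P ** R = R"
    "trace R = real m" "\<forall>w\<in>W. R *v w = 0" by blast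
  with W(3)[of R] have "Q ** R = 0" using proj_orthogonal_commute assms(2) by blast
  with R show ?thesis by blast
qed

text \<open>A maximum point v of the quadratic form of \<open>S\<close> on the unit sphere of the
  range of \<open>P\<close> is an eigenvector: the residual h = S v - c v is orthogonal to v, and
  moving from v towards h would raise the form to first order unless h = 0.\<close>

lemma symmetric_eigenvector:
  fixes S P :: "real^'n^'n"
  assumes P: "proj P" "P \<noteq> 0" and S: "transpose S = S" "P ** S = S ** P"
  shows "\<exists>v c. norm v = 1 \<and> P *v v = v \<and> S *v v = c *\<^sub>R v"
proof -
  have symm: "x \<bullet> (S *v y) = (S *v x) \<bullet> y" for x y
    using S(1) by (metis dot_lmul_matrix transpose_matrix_vector)
  define K where "K = {x. norm x = 1 \<and> P *v x = x}"
  have "K = sphere 0 1 \<inter> {x. P *v x = x}" by (auto simp: K_def)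
  moreover have "closed {x. P *v x = x}"
    by (intro closed_Collect_eq continuous_intros linear_continuous_on matrix_vector_mul_bounded_linear)
  ultimately have "compact K" by (simp add: compact_Int_closed)
  moreover have "K \<noteq> {}" using proj_unit_vector[OF P] by (auto simp: K_def)
  moreover have "continuous_on K (\<lambda>x. x \<bullet> (S *v x))"
    by (intro continuous_intros linear_continuous_on matrix_vector_mul_bounded_linear)
  ultimately obtain v where v: "v \<in> K" "\<And>x. x \<in> K \<Longrightarrow> x \<bullet> (S *v x) \<le> v \<bullet> (S *v v)"
    using continuous_attains_sup by metis
  define c where "c = v \<bullet> (S *v v)"
  have nv: "v \<bullet> v = 1" "P *v v = v" using v(1) by (auto simp: K_def simp flip: power2_norm_eq_inner)
  have bound: "x \<bullet> (S *v x) \<le> c * (x \<bullet> x)" if "P *v x = x" for x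
  proof (cases "x = 0")
    case False
    have "(1 / norm x) *\<^sub>R x \<in> K" using that False by (simp add: K_def matrix_vector_mult_scaleR)
    from v(2)[OF this] have "(x \<bullet> (S *v x)) / (norm x)\<^sup>2 \<le> c"
      by (simp add: c_def matrix_vector_mult_scaleR power2_eq_square)
    then show ?thesis using False by (simp add: divide_le_eq power2_norm_eq_inner)
  qed simp
  define h where "h = S *v v - c *\<^sub>R v"
  have Ph: "P *v h = h"
    unfolding h_def by (simp add: matrix_vector_mult_diff_distrib matrix_vector_mult_scaleR nv matrix_vector_mul_assoc S(2))
      (simp add: nv flip: matrix_vector_mul_assoc)
  have hv: "h \<bullet> v = 0" by (simp add: h_def inner_diff_left nv c_def inner_commute[of v "S *v v"])
  have hS: "h \<bullet> (S *v v) = h \<bullet> h" using hv by (simp add: h_def inner_diff_right)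
  define K2 where "K2 = c * (h \<bullet> h) - h \<bullet> (S *v h)"
  have ineq: "2 * (h \<bullet> h) \<le> t * K2" if t: "t > 0" for t
  proof -
    have "P *v (v + t *\<^sub>R h) = v + t *\<^sub>R h"
      by (simp add: matrix_vector_right_distrib matrix_vector_mult_scaleR nv Ph)
    from bound[OF this]
    have "c + 2 * t * (h \<bullet> h) + t * t * (h \<bullet> (S *v h)) \<le> c * (1 + t * t * (h \<bullet> h))"
      using hv hS symm[of v h]
      by (simp add: matrix_vector_right_distrib matrix_vector_mult_scaleR inner_add_left inner_add_right
          nv inner_commute[of v h] inner_commute[of "S *v v" h] flip: c_def)
        (simp add: algebra_simps)
    then have "t * (2 * (h \<bullet> h)) \<le> t * (t * K2)" by (simp add: K2_def algebra_simps)
    then show ?thesis using t by simp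
  qed
  \<comment> \<open>This lets \<open>t\<close> tend to 0 in \<open>ineq\<close>.\<close>
  have "2 * (h \<bullet> h) \<le> 0"
  proof (rule field_le_epsilon)
    fix e :: real assume "e > 0"
    define t where "t = e / (\<bar>K2\<bar> + 1)"
    have "t > 0" using \<open>e > 0\<close> by (simp add: t_def)
    have "t * K2 \<le> t * (\<bar>K2\<bar> + 1)" using \<open>t > 0\<close> by (intro mult_left_mono) auto
    also have "\<dots> = e" by (simp add: t_def)
    finally show "2 * (h \<bullet> h) \<le> 0 + e" using ineq[OF \<open>t > 0\<close>] by simp
  qed
  then have "h \<bullet> h = 0" using inner_ge_zero[of h] by linarith
  then have "h = 0" by simp
  then show ?thesis using v(1) by (intro exI[of _ v] exI[of _ c]) (simp add: K_def h_def)
qed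

section \<open>Orthogonal matrices as products of two reflections\<close>

text \<open>
  On the subspace with orthogonal projection \<open>U\<close>, the map \<open>M\<close> is a product of two reflections with
  \<open>+1\<close>-eigenspaces of dimensions \<open>a\<close> and \<open>b\<close>, the second of which is orthogonal to \<open>e\<close>.
\<close>
definition reflections_on ::
  "real^'n^'n \<Rightarrow> real^'n \<Rightarrow> real^'n^'n \<Rightarrow> nat \<Rightarrow> nat \<Rightarrow> bool" where
  "reflections_on M e U a b \<longleftrightarrow> proj U \<and> (\<exists>P Q. proj P \<and> proj Q \<and> U ** P = P \<and> U ** Q = Q
     \<and> trace P = real a \<and> trace Q = real b \<and> Q *v e = 0 \<and> M ** U = (P + P - U) ** (Q + Q - U))"

lemma reflections_on_zero: "reflections_on M e 0 0 0"
  unfolding reflections_on_def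
  by (intro conjI exI[of _ 0]) (simp_all add: proj_zero matrix_ring trace_ring)

lemma reflections_on_add:
  assumes "reflections_on M e U a b" "reflections_on M e V c d" and UV: "U ** V = 0"
  shows "reflections_on M e (U + V) (a + c) (b + d)"
proof -
  obtain P Q where 1: "proj U" "proj P" "proj Q" "U ** P = P" "U ** Q = Q"
    "trace P = real a" "trace Q = real b" "Q *v e = 0" "M ** U = (P + P - U) ** (Q + Q - U)"
    using assms(1) by (auto simp: reflections_on_def)
  obtain R S where 2: "proj V" "proj R" "proj S" "V ** R = R" "V ** S = S"
    "trace R = real c" "trace S = real d" "S *v e = 0" "M ** V = (R + R - V) ** (S + S - V)"
    using assms(2) by (auto simp: reflections_on_def)
  have VU: "V ** U = 0" using proj_orthogonal_commute 1 2 UV by blast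
  note PU = proj_commute_mult[OF 1(1,2,4)] proj_commute_mult[OF 1(1,3,5)]
  note RV = proj_commute_mult[OF 2(1,2,4)] proj_commute_mult[OF 2(1,3,5)]
  have cross: "X ** Y = 0" if "X ** U = X" "V ** Y = Y" for X Y
    using UV that by (metis matrix_mul_assoc matrix_zero_left matrix_zero_right)
  have cross': "X ** Y = 0" if "X ** V = X" "U ** Y = Y" for X Y
    using VU that by (metis matrix_mul_assoc matrix_zero_left matrix_zero_right)
  have UU: "U ** U = U" "V ** V = V" using 1 2 projD by auto
  have z: "P ** R = 0" "Q ** S = 0" "U ** R = 0" "U ** S = 0" "V ** P = 0" "V ** Q = 0"
    by (intro cross cross' PU RV 1 2 UU)+
  have "proj (P + R)" "proj (Q + S)" "proj (U + V)" using 1 2 z UV by (auto intro: proj_add)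
  moreover have "(U + V) ** (P + R) = P + R" "(U + V) ** (Q + S) = Q + S"
    using 1 2 z by (simp_all add: matrix_ring)
  moreover have "trace (P + R) = real (a + c)" "trace (Q + S) = real (b + d)"
    using 1 2 by (simp_all add: trace_ring)
  moreover have "(Q + S) *v e = 0" using 1 2 by (simp add: matrix_vector_mult_add_rdistrib)
  moreover have "M ** (U + V) = (P + R + (P + R) - (U + V)) ** (Q + S + (Q + S) - (U + V))"
  proof -
    have c1: "(P + P - U) ** (S + S - V) = 0"
      by (rule cross) (simp_all only: matrix_ring PU RV 1 2 UU)
    have c2: "(R + R - V) ** (Q + Q - U) = 0"
      by (rule cross') (simp_all only: matrix_ring PU RV 1 2 UU)
    have "(P + R + (P + R) - (U + V)) = (P + P - U) + (R + R - V)"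
      "(Q + S + (Q + S) - (U + V)) = (Q + Q - U) + (S + S - V)" by simp_all
    then show ?thesis
      by (simp only: matrix_add_ldistrib matrix_add_rdistrib c1 c2 1(9) 2(9)) simp
  qed
  ultimately show ?thesis unfolding reflections_on_def by blast
qed

text \<open>With \<open>Q = 0\<close> the condition on \<open>e\<close> is automatic: -1 is the
  product of 1 and -1, and only the first factor receives a dimension.\<close>

lemma reflections_on_minus:
  assumes "norm v = 1" "M *v v = - v"
  shows "reflections_on M e (outer v v) 1 0"
  unfolding reflections_on_def
proof (intro conjI exI)
  have "v \<bullet> v = 1" using assms by (simp flip: power2_norm_eq_inner)
  then show "M ** outer v v = (outer v v + outer v v - outer v v) ** (0 + 0 - outer v v)"
    "outer v v ** outer v v = outer v v" "trace (outer v v) = real 1"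
    using assms by (simp_all add: mult_outer outer_linear matrix_ring outer_vec trace_outer)
qed (simp_all add: proj_outer[OF assms(1)] proj_zero matrix_ring trace_ring)

text \<open>Here 1 is the product of -1 and -1 rather than of 1 and 1, so that neither factor
  receives a dimension and nothing is demanded of \<open>e\<close>.\<close>

lemma reflections_on_plus:
  assumes "norm v = 1" "M *v v = v"
  shows "reflections_on M e (outer v v) 0 0"
  unfolding reflections_on_def
proof (intro conjI exI)
  have "v \<bullet> v = 1" using assms by (simp flip: power2_norm_eq_inner)
  then have "(0 + 0 - outer v v) ** (0 + 0 - outer v v) = outer v v"
    by (simp add: matrix_minus_left matrix_minus_right outer_mult_outer)
  then show "M ** outer v v = (0 + 0 - outer v v) ** (0 + 0 - outer v v)"
    using assms by (simp add: mult_outer)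
qed (simp_all add: proj_outer[OF assms(1)] proj_zero matrix_ring trace_ring)

lemma reflections_on_plane_aux:
  assumes wu: "w \<bullet> w = 1" "u \<bullet> u = 1" "w \<bullet> u = 0"
    and M: "M *v w = c *\<^sub>R w + s *\<^sub>R u" "M *v u = c *\<^sub>R u - s *\<^sub>R w" and cs: "c\<^sup>2 + s\<^sup>2 = 1"
    and e: "w \<bullet> e = 0"
  shows "reflections_on M e (outer w w + outer u u) 1 1"
proof -
  have uw: "u \<bullet> w = 0" using wu by (simp add: inner_commute)
  have cs2: "s * s = 1 - c * c" using cs by (simp add: power2_eq_square)
  let ?U = "outer w w + outer u u"
  \<comment> \<open>For \<open>c\<close> = cos x and \<open>s\<close> = sin x this is the projection
    onto the line at angle x/2 from \<open>w\<close>, by the half-angle formulas. The second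
    reflection is in the line of \<open>w\<close>, which is orthogonal to \<open>e\<close>.\<close>
  define P where "P = ((1 + c) / 2) *\<^sub>R outer w w + (s / 2) *\<^sub>R (outer w u + outer u w) + ((1 - c) / 2) *\<^sub>R outer u u"
  have mult: "(a *\<^sub>R outer w w + b *\<^sub>R (outer w u + outer u w) + d *\<^sub>R outer u u) **
      (a' *\<^sub>R outer w w + b' *\<^sub>R (outer w u + outer u w) + d' *\<^sub>R outer u u) =
      (a * a' + b * b') *\<^sub>R outer w w + (a * b' + b * d') *\<^sub>R outer w u
      + (b * a' + d * b') *\<^sub>R outer u w + (b * b' + d * d') *\<^sub>R outer u u" for a b d a' b' d'
    by (simp add: matrix_ring outer_mult_outer wu uw algebra_simps)
  have coeffs: "(1 + c) / 2 * ((1 + c) / 2) + s / 2 * (s / 2) = (1 + c) / 2"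
    "(1 + c) / 2 * (s / 2) + s / 2 * ((1 - c) / 2) = s / 2"
    "s / 2 * ((1 + c) / 2) + (1 - c) / 2 * (s / 2) = s / 2"
    "s / 2 * (s / 2) + (1 - c) / 2 * ((1 - c) / 2) = (1 - c) / 2"
    using cs2 by (simp_all add: field_simps)
  have "P ** P = P"
    unfolding P_def mult coeffs by (simp add: scaleR_add_right)
  then have "proj P"
    by (simp add: proj_def P_def transpose_ring transpose_outer add.commute)
  moreover have "proj ?U" "proj (outer w w)"
    using wu uw by (auto simp: proj_def transpose_ring transpose_outer matrix_ring outer_mult_outer)
  moreover have "?U ** P = P" "?U ** outer w w = outer w w"
    by (simp_all add: P_def matrix_ring outer_mult_outer wu uw algebra_simps)
  moreover have "trace P = real 1" "trace (outer w w) = real 1"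
    by (simp_all add: P_def trace_ring trace_outer wu uw field_simps)
  moreover have "outer w w *v e = 0" by (simp add: outer_vec e)
  moreover have "M ** ?U = (P + P - ?U) ** (outer w w + outer w w - ?U)"
  proof -
    have 1: "P + P - ?U = c *\<^sub>R outer w w + s *\<^sub>R (outer w u + outer u w) - c *\<^sub>R outer u u"
      by (simp add: P_def vec_eq_iff field_simps)
    have 2: "M ** ?U = outer (M *v w) w + outer (M *v u) u"
      by (simp add: matrix_add_ldistrib mult_outer)
    show ?thesis
      unfolding 1 2 by (simp add: matrix_ring M outer_linear outer_mult_outer wu uw algebra_simps)
  qed
  ultimately show ?thesis unfolding reflections_on_def by blast
qed

text \<open>A rotated orthonormal basis gives the same projection onto the plane and the same form
  of the rotation, so the first basis vector can be taken orthogonal to \<open>e\<close>: its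
  coordinates are proportional to \<open>(\<beta>, - \<alpha>)\<close>.\<close>

lemma reflections_on_plane:
  assumes vw: "v \<bullet> v = 1" "w \<bullet> w = 1" "v \<bullet> w = 0"
    and M: "M *v v = c *\<^sub>R v + s *\<^sub>R w" "M *v w = c *\<^sub>R w - s *\<^sub>R v" and cs: "c\<^sup>2 + s\<^sup>2 = 1"
  shows "reflections_on M e (outer v v + outer w w) 1 1"
proof (cases "v \<bullet> e = 0")
  case True
  then show ?thesis using reflections_on_plane_aux assms by blast
next
  case False
  define \<alpha> \<beta> r where "\<alpha> = v \<bullet> e" and "\<beta> = w \<bullet> e" and "r = sqrt (\<alpha>\<^sup>2 + \<beta>\<^sup>2)"
  define a b where "a = \<beta> / r" and "b = - \<alpha> / r"
  have "\<alpha>\<^sup>2 + \<beta>\<^sup>2 > 0" using False by (simp add: \<alpha>_def add_pos_nonneg)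
  then have r: "r > 0" unfolding r_def by (rule real_sqrt_gt_zero)
  have "r * r = \<beta> * \<beta> + \<alpha> * \<alpha>"
    by (simp add: r_def flip: power2_eq_square)
  then have "(\<beta> * \<beta> + \<alpha> * \<alpha>) / (r * r) = 1" using r by (metis divide_self mult_eq_0_iff less_irrefl)
  then have ab: "a * a + b * b = 1" by (simp add: a_def b_def add_divide_distrib)
  have abe: "a * \<alpha> + b * \<beta> = 0" by (simp add: a_def b_def)
  have wv: "w \<bullet> v = 0" using vw by (simp add: inner_commute)
  define x y where "x = a *\<^sub>R v + b *\<^sub>R w" and "y = a *\<^sub>R w - b *\<^sub>R v"
  have "reflections_on M e (outer x x + outer y y) 1 1"
  proof (rule reflections_on_plane_aux)
    show "x \<bullet> x = 1" "y \<bullet> y = 1" "x \<bullet> y = 0"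
      using ab by (simp_all add: x_def y_def inner_add_left inner_add_right inner_diff_left inner_diff_right vw wv)
    show "M *v x = c *\<^sub>R x + s *\<^sub>R y" "M *v y = c *\<^sub>R y - s *\<^sub>R x"
      by (simp_all add: x_def y_def matrix_vector_right_distrib matrix_vector_mult_diff_distrib
          matrix_vector_mult_scaleR M algebra_simps)
    show "x \<bullet> e = 0" using abe by (simp add: x_def inner_add_left \<alpha>_def \<beta>_def)
  qed (rule cs)
  moreover have "outer x x + outer y y = (a * a + b * b) *\<^sub>R (outer v v + outer w w)"
    by (simp add: x_def y_def outer_linear algebra_simps)
  ultimately show ?thesis by (simp add: ab)
qed

lemma reflections_on_peel:
  assumes P: "proj P" and v: "norm v = 1" "P *v v = v"
    and "reflections_on M e (P - outer v v) a b" "reflections_on M e (outer v v) c d"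
  shows "reflections_on M e P (a + c) (b + d)"
  using reflections_on_add[OF assms(4,5) proj_peel(4)[OF P v]] by simp

lemma proj_unit_vector_of_trace:
  assumes "proj P" "trace P = real (Suc m)"
  shows "\<exists>v. norm v = 1 \<and> P *v v = v"
proof -
  have "P \<noteq> 0" using assms(2) by (auto simp: trace_ring)
  then show ?thesis using proj_unit_vector assms(1) by blast
qed

lemma inner_unit: "norm v = 1 \<Longrightarrow> v \<bullet> v = 1"
  by (simp flip: power2_norm_eq_inner)

lemma proj_peel_inner:
  assumes "proj P" "norm v = 1" "P *v v = v" "(P - outer v v) *v w = w"
  shows "v \<bullet> w = 0" "P *v w = w"
proof -
  have "v \<bullet> ((P - outer v v) *v w) = ((P - outer v v) *v v) \<bullet> w"
    using projD(1)[OF proj_peel(1)[OF assms(1-3)]] by (metis dot_lmul_matrix transpose_matrix_vector)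
  then show *: "v \<bullet> w = 0" using proj_peel(5)[OF assms(1-3)] assms(4) by simp
  show "P *v w = w" using assms(4) by (simp add: matrix_vector_mult_diff_rdistrib outer_vec *)
qed

text \<open>A plane on which \<open>M\<close> is 1 or -1 is rotated by the angle 0 or pi and gives
  one dimension to each factor. The number \<open>a\<close> of such planes is free; the other
  \<open>m - 2 * a\<close> dimensions are treated as lines, which go to the first factor if
  \<open>c = -1\<close> and to neither if \<open>c = 1\<close>.\<close>

lemma reflections_on_scalar:
  assumes P: "proj P" "trace P = real m" and ev: "\<And>v. P *v v = v \<Longrightarrow> M *v v = c *\<^sub>R v"
    and c: "c = 1 \<or> c = -1" and a: "2 * a \<le> m"
  shows "reflections_on M e P (if c = 1 then a else m - a) a"
  using P ev a
proof (induction m arbitrary: P a rule: less_induct)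
  case (less m)
  note P = less.prems(1,2) and ev = less.prems(3) and a = less.prems(4)
  have evs: "reflections_on M e (outer v v) (if c = 1 then 0 else 1) 0" if "norm v = 1" "P *v v = v" for v
    using ev[OF that(2)] c that(1) reflections_on_plus reflections_on_minus by auto
  have sub: "M *v x = c *\<^sub>R x" if "norm v = 1" "P *v v = v" "(P - outer v v) *v x = x" for v x
    using ev proj_peel_inner(2)[OF P(1) that] by blast
  show ?case
  proof (cases m)
    case 0
    then have "P = 0" using P trace_proj_eq_0 by auto
    with 0 a show ?thesis by (auto intro: reflections_on_zero)
  next
    case (Suc m')
    then obtain v where v: "norm v = 1" "P *v v = v" using proj_unit_vector_of_trace P by blast
    let ?P = "P - outer v v"
    have tr: "trace ?P = real m'" using proj_peel(3)[OF P(1) v] P(2) Suc by simp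
    note pj = proj_peel(1)[OF P(1) v]
    show ?thesis
    proof (cases a)
      case 0
      have "reflections_on M e ?P (if c = 1 then 0 else m' - 0) 0"
        by (rule less.IH) (use Suc tr pj sub[OF v] in auto)
      from reflections_on_peel[OF P(1) v this evs[OF v]] show ?thesis
        using 0 Suc by (auto split: if_splits)
    next
      case (Suc a')
      then obtain m'' where m'': "m' = Suc m''" using a \<open>m = Suc m'\<close> by (cases m') auto
      then obtain w where w: "norm w = 1" "?P *v w = w" using proj_unit_vector_of_trace pj tr by blast
      let ?Q = "?P - outer w w"
      have tr2: "trace ?Q = real m''" using proj_peel(3)[OF pj w] tr m'' by simp
      note vw = proj_peel_inner[OF P(1) v w(2)]
      have Q: "reflections_on M e ?Q (if c = 1 then a' else m'' - a') a'"
      proof (rule less.IH)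
        show "M *v x = c *\<^sub>R x" if "?Q *v x = x" for x
          by (rule sub[OF v]) (rule proj_peel_inner(2)[OF pj w that])
        show "2 * a' \<le> m''" using a Suc \<open>m = Suc m'\<close> m'' by simp
      qed (use \<open>m = Suc m'\<close> m'' tr2 proj_peel(1)[OF pj w] in auto)
      have "reflections_on M e (outer v v + outer w w) 1 1"
        using ev v vw c
        by (intro reflections_on_plane[where c = c and s = 0])
          (auto simp: inner_unit[OF v(1)] inner_unit[OF w(1)])
      moreover have "?Q ** (outer v v + outer w w) = 0"
      proof -
        have "?Q *v w = 0" by (rule proj_peel(5)[OF pj w])
        moreover have "?Q *v v = 0"
          using proj_peel(5)[OF P(1) v] vw(1)
          by (simp add: matrix_vector_mult_diff_rdistrib outer_vec inner_commute)
        ultimately show ?thesis by (simp add: matrix_add_ldistrib mult_outer outer_linear)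
      qed
      ultimately have "reflections_on M e (?Q + (outer v v + outer w w)) ((if c = 1 then a' else m'' - a') + 1) (a' + 1)"
        using reflections_on_add Q by blast
      moreover have "?Q + (outer v v + outer w w) = P" by simp
      moreover have "m'' - a' + 1 = m - a" using a Suc \<open>m = Suc m'\<close> m'' by simp
      ultimately show ?thesis using Suc by (auto split: if_splits)
    qed
  qed
qed

lemma orthogonal_matrix_vec:
  assumes "orthogonal_matrix M"
  shows "transpose M *v (M *v x) = x" "M *v (transpose M *v x) = x"
  using assms unfolding orthogonal_matrix_def
  by (simp_all add: matrix_vector_mul_assoc del: transpose_matrix_vector)

text \<open>An eigenvector v of the symmetric matrix \<open>M + transpose M\<close> satisfies M (M
  v) = l (M v) - v, so v and M v span an invariant space of dimension 1 or 2.\<close>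

lemma orthogonal_decomposition_step:
  fixes M :: "real^'n^'n"
  assumes M: "orthogonal_matrix M" and P: "proj P" "M ** P = P ** M" "P \<noteq> 0"
  shows "(\<exists>v. norm v = 1 \<and> P *v v = v \<and> (M *v v = v \<or> M *v v = - v) \<and>
            M ** outer v v = outer v v ** M)
       \<or> (\<exists>v w. norm v = 1 \<and> norm w = 1 \<and> v \<bullet> w = 0 \<and> P *v v = v \<and> P *v w = w \<and>
            M ** (outer v v + outer w w) = (outer v v + outer w w) ** M \<and>
            reflections_on M e (outer v v + outer w w) 1 1)"
proof -
  let ?T = "transpose M"
  have PT: "P ** ?T = ?T ** P"
    using P(1,2) by (metis matrix_transpose_mul projD(1))
  have "transpose (M + ?T) = M + ?T" "P ** (M + ?T) = (M + ?T) ** P"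
    by (simp_all add: transpose_ring matrix_ring PT P(2) add.commute)
  then obtain v l where v: "norm v = 1" "P *v v = v" "(M + ?T) *v v = l *\<^sub>R v"
    using symmetric_eigenvector[OF P(1,3)] by blast
  have vv: "v \<bullet> v = 1" using v by (simp add: inner_unit)
  have Tv: "?T *v v = l *\<^sub>R v - M *v v"
    using v(3) by (simp add: matrix_vector_mult_add_rdistrib algebra_simps del: transpose_matrix_vector)
  show ?thesis
  proof (cases "M *v v = v \<or> M *v v = - v")
    case True
    then have "?T *v v = M *v v"
      using orthogonal_matrix_vec(1)[OF M, of v] orthogonal_matrix_vec(1)[OF M, of "- v"]
        linear_neg[OF matrix_vector_mul_linear[of ?T], of v] linear_neg[OF matrix_vector_mul_linear[of M], of v]
      by (auto simp del: transpose_matrix_vector)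
    then have "M ** outer v v = outer v v ** M"
      using True by (auto simp: mult_outer outer_mult outer_linear simp del: transpose_matrix_vector)
    then show ?thesis using True v by blast
  next
    case False
    define c where "c = v \<bullet> (M *v v)"
    \<comment> \<open>Gram-Schmidt: \<open>x\<close> is the part of M v orthogonal to
      \<open>v\<close>, and \<open>c\<close>, \<open>s\<close> become the cosine and sine of the
      rotation.\<close>
    define x where "x = M *v v - c *\<^sub>R v"
    define s where "s = norm x"
    have MM: "(M *v v) \<bullet> (M *v v) = 1"
      using M vv orthogonal_matrix_vec(1)[OF M, of v]
      by (metis dot_lmul_matrix inner_commute transpose_matrix_vector)
    have ss: "s\<^sup>2 = 1 - c\<^sup>2"
      by (simp add: s_def power2_norm_eq_inner x_def inner_diff_left inner_diff_right MM vv
          inner_commute[of "M *v v" v] flip: c_def) (simp add: power2_eq_square)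
    have s0: "s \<noteq> 0"
    proof
      assume "s = 0"
      then have "M *v v = c *\<^sub>R v" by (simp add: s_def x_def)
      moreover have "c = 1 \<or> c = -1" using ss \<open>s = 0\<close> by (simp add: power2_eq_1_iff)
      ultimately show False using False by auto
    qed
    define w where "w = (1 / s) *\<^sub>R x"
    have Mv: "M *v v = c *\<^sub>R v + s *\<^sub>R w" using s0 by (simp add: w_def x_def)
    have w: "norm w = 1" using s0 by (simp add: w_def s_def)
    have vw: "v \<bullet> w = 0" by (simp add: w_def x_def inner_diff_right vv flip: c_def)
    have "l = v \<bullet> ((M + ?T) *v v)" using v(3) vv by simp
    also have "\<dots> = c + v \<bullet> (?T *v v)"
      by (simp add: matrix_vector_mult_add_rdistrib inner_add_right c_def del: transpose_matrix_vector)
    also have "v \<bullet> (?T *v v) = c"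
      by (metis c_def dot_lmul_matrix inner_commute transpose_matrix_vector)
    finally have l: "l = 2 * c" by simp
    have Tv': "?T *v v = c *\<^sub>R v - s *\<^sub>R w"
      unfolding Tv Mv l by (simp add: algebra_simps flip: scaleR_add_left)
    \<comment> \<open>\<open>Tv'\<close> expresses the multiple of \<open>w\<close> by
      \<open>s\<close> through \<open>v\<close> and \<open>?T *v v\<close>; applying
      \<open>M\<close> undoes the transpose.\<close>
    have "s *\<^sub>R (M *v w) = M *v (c *\<^sub>R v - (?T *v v))"
      unfolding Tv' by (simp add: matrix_vector_mult_scaleR)
    also have "\<dots> = c *\<^sub>R (M *v v) - v"
      by (simp only: matrix_vector_mult_diff_distrib matrix_vector_mult_scaleR orthogonal_matrix_vec[OF M])
    also have "\<dots> = (c\<^sup>2 - 1) *\<^sub>R v + (s * c) *\<^sub>R w"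
      unfolding Mv by (simp add: algebra_simps power2_eq_square)
    also have "c\<^sup>2 - 1 = s * - s" using ss by (simp add: power2_eq_square)
    also have "(s * - s) *\<^sub>R v + (s * c) *\<^sub>R w = s *\<^sub>R (c *\<^sub>R w - s *\<^sub>R v)"
      by (simp add: algebra_simps)
    finally have Mw: "M *v w = c *\<^sub>R w - s *\<^sub>R v" using s0 by simp
    have Tw: "?T *v w = s *\<^sub>R v + c *\<^sub>R w"
    proof -
      have "s *\<^sub>R v + c *\<^sub>R w = ?T *v (M *v (s *\<^sub>R v + c *\<^sub>R w))"
        by (simp only: orthogonal_matrix_vec[OF M])
      also have "M *v (s *\<^sub>R v + c *\<^sub>R w) = (s\<^sup>2 + c\<^sup>2) *\<^sub>R w"
        by (simp add: matrix_vector_right_distrib matrix_vector_mult_scaleR Mv Mw algebra_simps power2_eq_square)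
      also have "s\<^sup>2 + c\<^sup>2 = 1" using ss by simp
      finally show ?thesis by simp
    qed
    have "M ** (outer v v + outer w w) = (outer v v + outer w w) ** M"
      by (simp add: matrix_ring mult_outer outer_mult Mv Mw Tv' Tw outer_linear del: transpose_matrix_vector)
    moreover have "P *v w = w"
    proof -
      have "P *v (M *v v) = M *v v" by (metis P(2) matrix_vector_mul_assoc v(2))
      then show ?thesis
        by (simp add: w_def x_def matrix_vector_mult_scaleR matrix_vector_mult_diff_distrib v(2))
    qed
    moreover have "reflections_on M e (outer v v + outer w w) 1 1"
      using ss by (intro reflections_on_plane[OF vv inner_unit[OF w] vw Mv Mw]) simp
    ultimately show ?thesis using v w vw by blast
  qed
qed

lemma proj_below: "proj P \<Longrightarrow> proj Q \<Longrightarrow> P ** Q = Q \<Longrightarrow> P *v x = 0 \<Longrightarrow> Q *v x = 0"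
  by (metis matrix_vector_mul_assoc matrix_vector_mult_0_right proj_commute_mult)

text \<open>Induction on the dimension: each invariant line joins \<open>E\<close> or
  \<open>F\<close> according to its eigenvalue, each rotated plane joins \<open>U\<close>. Since
  \<open>M\<close> commutes with what is split off, it commutes with the remaining
  projection.\<close>

lemma orthogonal_decomposition:
  fixes M :: "real^'n^'n"
  assumes M: "orthogonal_matrix M" and P: "proj P" "M ** P = P ** M"
  shows "\<exists>E F U r. proj E \<and> proj F \<and> proj U \<and> E ** F = 0 \<and> E ** U = 0 \<and> F ** U = 0 \<and> P = E + F + U
    \<and> M ** E = - E \<and> M ** F = F \<and> reflections_on M e U r r \<and> trace U = real (2 * r)"
proof -
  obtain m :: nat where "trace P = real m" using trace_proj_nat P by blast
  then show ?thesis using P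
  proof (induction m arbitrary: P rule: less_induct)
    case (less m)
    note tr = less.prems(1) and P = less.prems(2,3)
    show ?case
    proof (cases "P = 0")
      case True
      then show ?thesis
        by (intro exI[of _ 0]) (simp add: proj_zero matrix_ring trace_ring reflections_on_zero)
    next
      case False
      have below: "X *v x = 0" if "proj X" "Q ** X = X" "proj Q" "Q *v x = 0" for X Q :: "real^'n^'n" and x
        using proj_below that by blast
      have sums: "(E + F + U) ** E = E" "(E + F + U) ** F = F" "(E + F + U) ** U = U"
        if "proj E" "proj F" "proj U" "E ** F = 0" "E ** U = 0" "F ** U = 0" for E F U :: "real^'n^'n"
        using that proj_orthogonal_commute[of E F] proj_orthogonal_commute[of E U] proj_orthogonal_commute[of F U]
        by (simp_all add: matrix_ring projD)
      from orthogonal_decomposition_step[OF M P False, of e] consider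
          (line) v where "norm v = 1" "P *v v = v" "M *v v = v \<or> M *v v = - v"
            "M ** outer v v = outer v v ** M"
        | (plane) v w where "norm v = 1" "norm w = 1" "v \<bullet> w = 0" "P *v v = v" "P *v w = w"
            "M ** (outer v v + outer w w) = (outer v v + outer w w) ** M"
            "reflections_on M e (outer v v + outer w w) 1 1"
        by blast
      then show ?thesis
      proof cases
        case line
        note v = line(1,2) and Mv = line(3) and c = line(4)
        let ?P = "P - outer v v"
        note peel = proj_peel[OF P(1) v]
        have m: "m > 0" using tr False P(1) trace_proj_eq_0 by (cases m) auto
        have "trace ?P = real (m - 1)" "M ** ?P = ?P ** M" using peel(3) tr m P c by (auto simp: matrix_ring of_nat_diff)
        from less.IH[OF _ this(1) peel(1) this(2)] m
        obtain E F U r where *: "proj E" "proj F" "proj U" "E ** F = 0" "E ** U = 0" "F ** U = 0"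
          "?P = E + F + U" "M ** E = - E" "M ** F = F" "reflections_on M e U r r" "trace U = real (2 * r)"
          by auto
        have Ov: "E *v v = 0" "F *v v = 0" "U *v v = 0"
          using peel(1,5) sums[OF *(1-6)] *(1,2,3) by (auto intro!: below[of _ ?P] simp flip: *(7))
        have z: "E ** outer v v = 0" "F ** outer v v = 0" "U ** outer v v = 0"
          by (simp_all add: mult_outer Ov outer_linear)
        have Peq: "P = E + F + U + outer v v" using *(7) by (simp add: algebra_simps)
        have vE: "outer v v ** E = 0" "outer v v ** F = 0" "outer v v ** U = 0"
          using z * proj_outer[OF v(1)] by (auto intro: proj_orthogonal_commute)
        from Mv show ?thesis
        proof
          assume "M *v v = v"
          then show ?thesis using * z vE Peq proj_outer[OF v(1)]
            by (intro exI[of _ E] exI[of _ "F + outer v v"] exI[of _ U] exI[of _ r])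
              (auto simp: matrix_ring mult_outer outer_linear intro: proj_add)
        next
          assume "M *v v = - v"
          then show ?thesis using * z vE Peq proj_outer[OF v(1)]
            by (intro exI[of _ "E + outer v v"] exI[of _ F] exI[of _ U] exI[of _ r])
              (auto simp: matrix_ring mult_outer outer_linear intro: proj_add)
        qed
      next
        case plane
        note vw = plane(1-5) and c = plane(6) and refl = plane(7)
        let ?W = "outer v v + outer w w"
        let ?P = "P - ?W"
        have W: "proj ?W" using refl by (simp add: reflections_on_def)
        have PW: "P ** ?W = ?W" by (simp add: matrix_ring mult_outer vw)
        have pj: "proj ?P" by (rule proj_diff[OF P(1) W PW])
        have trP: "trace ?P = real m - 2" using vw by (simp add: trace_ring trace_outer inner_unit tr)
        then have m: "m \<ge> 2" using trace_proj_nonneg[OF pj] by simp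
        have "trace ?P = real (m - 2)" "M ** ?P = ?P ** M" using trP m P c by (auto simp: matrix_diff_ldistrib matrix_diff_rdistrib of_nat_diff)
        from less.IH[OF _ this(1) pj this(2)] m
        obtain E F U r where *: "proj E" "proj F" "proj U" "E ** F = 0" "E ** U = 0" "F ** U = 0"
          "?P = E + F + U" "M ** E = - E" "M ** F = F" "reflections_on M e U r r" "trace U = real (2 * r)"
          by auto
        have wv: "w \<bullet> v = 0" using vw by (simp add: inner_commute)
        have P0: "?P *v v = 0" "?P *v w = 0"
          using vw wv by (simp_all add: matrix_vector_mult_diff_rdistrib matrix_vector_mult_add_rdistrib outer_vec inner_unit)
        have Ov: "E *v x = 0" "F *v x = 0" "U *v x = 0" if "?P *v x = 0" for x
          using pj sums[OF *(1-6)] *(1,2,3) that by (auto intro!: below[of _ ?P x] simp flip: *(7))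
        have z: "E ** ?W = 0" "F ** ?W = 0" "U ** ?W = 0"
          by (simp_all add: matrix_ring mult_outer Ov P0 outer_linear)
        have zW: "?W ** U = 0" using z * W by (auto intro: proj_orthogonal_commute)
        have "reflections_on M e (U + ?W) (r + 1) (r + 1)"
          by (rule reflections_on_add[OF *(10) refl z(3)])
        moreover have "trace (U + ?W) = real (2 * (r + 1))"
          using * vw by (simp add: trace_ring trace_outer inner_unit)
        moreover have "proj (U + ?W)" by (rule proj_add[OF *(3) W z(3)])
        moreover have "E ** (U + ?W) = 0" "F ** (U + ?W) = 0"
          using * z by (simp_all only: matrix_add_ldistrib) auto
        moreover have "P = E + F + (U + ?W)" using *(7) by (simp add: algebra_simps)
        ultimately show ?thesis using * by blast
      qed
    qed
  qed
qed

text \<open>In this type \<open>*\<close> is the componentwise product and a numeral stands for the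
  matrix with all entries equal to it, so these products are scalar multiples; they arise from sums
  such as \<open>P + P\<close>.\<close>

lemma matrix_numeral:
  fixes A :: "real^'n^'n"
  shows "(numeral w * A) ** B = numeral w * (A ** B)" "A ** (numeral w * B) = numeral w * (A ** B)"
    "(A * numeral w) ** B = (A ** B) * numeral w" "A ** (B * numeral w) = (A ** B) * numeral w"
    "transpose (numeral w * A) = numeral w * transpose A" "trace (numeral w * A) = numeral w * trace A"
    "(numeral w * A) *v x = numeral w * (A *v x)" "outer (numeral w * x) y = numeral w * outer x y"
  by (simp_all add: matrix_matrix_mult_def matrix_vector_mult_def transpose_def trace_def outer_def
      vec_eq_iff sum_distrib_left mult_ac)

text \<open>Conjugation with an orthogonal matrix that sends a basis vector to \<open>v\<close>
  makes this reflection diagonal.\<close>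

lemma det_reflection_outer:
  fixes v :: "real^'n"
  assumes "norm v = 1"
  shows "det (mat 1 - (outer v v + outer v v)) = -1"
proof -
  fix k :: 'n
  obtain A :: "real^'n^'n" where A: "orthogonal_matrix A" "A *v axis k 1 = v"
    using orthogonal_matrix_exists_basis[OF assms] by blast
  let ?D = "mat 1 - (outer (axis k 1) (axis k 1) + outer (axis k 1) (axis k 1)) :: real^'n^'n"
  have "mat 1 - (outer v v + outer v v) = A ** ?D ** transpose A"
    using A by (simp add: matrix_ring matrix_numeral mult_outer outer_mult orthogonal_matrix_def del: transpose_matrix_vector)
  then have "det (mat 1 - (outer v v + outer v v)) = det A * det ?D * det A"
    by (simp add: det_mul)
  also have "\<dots> = det ?D * (det A * det A)" by simp
  also have "det A * det A = 1"
    using det_orthogonal_matrix[OF A(1)] by auto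
  also have "det ?D = (\<Prod>i\<in>UNIV. ?D $ i $ i)"
    by (rule det_diagonal) (auto simp: outer_def mat_def axis_def)
  also have "\<dots> = (\<Prod>i\<in>UNIV. if i = k then -1 else 1)"
    by (intro prod.cong refl) (auto simp: outer_def mat_def axis_def)
  finally show ?thesis by simp
qed

text \<open>Every vector peeled off \<open>P\<close> splits off a hyperplane reflection, of
  determinant -1, until - I remains.\<close>

lemma det_reflection:
  fixes P :: "real^'n^'n"
  assumes "proj P" "trace P = real a"
  shows "det (P + P - mat 1) = (-1) ^ (CARD('n) + a)"
  using assms
proof (induction a arbitrary: P)
  case 0
  then have "P = 0" using trace_proj_eq_0 by auto
  moreover have "det (- mat 1 :: real^'n^'n) = (-1) ^ CARD('n)"
    by (subst det_diagonal) (auto simp: mat_def)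
  ultimately show ?case by simp
next
  case (Suc a)
  then obtain v where v: "norm v = 1" "P *v v = v" using proj_unit_vector_of_trace by blast
  let ?P = "P - outer v v"
  note peel = proj_peel[OF Suc.prems(1) v]
  have "P + P - mat 1 = (?P + ?P - mat 1) ** (mat 1 - (outer v v + outer v v))"
    using peel(2) inner_unit[OF v(1)] by (simp add: matrix_ring matrix_numeral outer_mult_outer algebra_simps)
  then have "det (P + P - mat 1) = det (?P + ?P - mat 1) * -1"
    by (simp only: det_mul det_reflection_outer[OF v(1)])
  moreover have "det (?P + ?P - mat 1) = (-1) ^ (CARD('n) + a)"
    using Suc.prems peel by (intro Suc.IH) simp_all
  ultimately show ?case by simp
qed

section \<open>The Grassmannian and its products\<close>

lemma Gr_iff:
  fixes X :: "real^'n^'n"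
  shows "X \<in> Gr k \<longleftrightarrow> (\<exists>P. proj P \<and> trace P = real k \<and> X = P + P - mat 1)"
proof
  assume "X \<in> Gr k"
  then have X: "transpose X ** X = mat 1" "X ** X = mat 1" "trace X = 2 * real k - real CARD('n)"
    by (auto simp: Gr_def O_group_def orthogonal_matrix)
  have T: "transpose X = X"
    by (metis X(1,2) matrix_mul_assoc matrix_mul_lid matrix_mul_rid)
  let ?P = "(1/2) *\<^sub>R (X + mat 1)"
  have "?P ** ?P = (1/4) *\<^sub>R (X ** X + 2 *\<^sub>R X + mat 1)"
    by (simp add: matrix_ring vec_eq_iff field_simps)
  also have "\<dots> = ?P" unfolding X(2) by (simp add: vec_eq_iff field_simps)
  finally have "proj ?P" by (simp add: proj_def transpose_ring T)
  moreover have "trace ?P = real k" by (simp add: trace_ring X(3))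
  moreover have "X = ?P + ?P - mat 1" by (simp flip: scaleR_add_left)
  ultimately show "\<exists>P. proj P \<and> trace P = real k \<and> X = P + P - mat 1" by blast
next
  assume "\<exists>P. proj P \<and> trace P = real k \<and> X = P + P - mat 1"
  then obtain P where P: "proj P" "trace P = real k" "X = P + P - mat 1" by blast
  have "X ** X = mat 1" using projD(2)[OF P(1)] by (simp add: P(3) matrix_ring matrix_numeral algebra_simps)
  moreover have "transpose X = X" using projD(1)[OF P(1)] by (simp add: P(3) transpose_ring matrix_numeral)
  ultimately show "X \<in> Gr k"
    using P(2) by (simp add: Gr_def O_group_def orthogonal_matrix P(3) trace_ring matrix_numeral)
qed

lemma Gr_orthogonal: "X \<in> Gr k \<Longrightarrow> orthogonal_matrix X"
  by (simp add: Gr_def O_group_def)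

lemma Phi_orthogonal: "M \<in> Phi k k' \<Longrightarrow> orthogonal_matrix M"
  by (auto simp: Phi_def intro: orthogonal_matrix_mul Gr_orthogonal)

lemma det_Phi: "M \<in> (Phi k k' :: (real^'n^'n) set) \<Longrightarrow> det M = (-1) ^ (k + k')"
proof -
  assume "M \<in> Phi k k'"
  then obtain P Q where PQ: "proj P" "trace P = real k" "proj Q" "trace Q = real k'"
    "M = (P + P - mat 1) ** (Q + Q - mat 1)"
    by (auto simp: Phi_def Gr_iff)
  show "det M = (-1) ^ (k + k')"
    unfolding PQ(5) det_mul det_reflection[OF PQ(1,2)] det_reflection[OF PQ(3,4)]
    by (simp add: power_add)
qed

lemma reflections_on_one:
  fixes M :: "real^'n^'n"
  assumes "reflections_on M e (mat 1) a b"
  shows "\<exists>X\<in>Gr a. \<exists>Y\<in>Gr b. Y *v e = - e \<and> M = X ** Y"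
proof -
  obtain P Q where PQ: "proj P" "proj Q" "trace P = real a" "trace Q = real b" "Q *v e = 0"
    "M = (P + P - mat 1) ** (Q + Q - mat 1)"
    using assms by (auto simp: reflections_on_def)
  have "(Q + Q - mat 1) *v e = - e"
    by (simp add: matrix_vector_mult_diff_rdistrib matrix_vector_mult_add_rdistrib matrix_numeral PQ(5))
  moreover have "P + P - mat 1 \<in> Gr a" "Q + Q - mat 1 \<in> Gr b" using PQ by (auto simp: Gr_iff)
  ultimately show ?thesis using PQ(6) by blast
qed

lemma proj_add3:
  assumes "proj E" "proj F" "proj U" "E ** F = 0" "E ** U = 0" "F ** U = 0"
  shows "proj (E + F + U)" "(E + F) ** U = 0"
  using assms by (auto simp: matrix_ring intro!: proj_add)

text \<open>The sign of \<open>det M\<close> is what makes the multiplicities of the remaining eigenvalues \<open>\<plusminus> 1\<close> even.\<close>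
lemma orthogonal_factorization:
  fixes M :: "real^'n^'n"
  assumes M: "orthogonal_matrix M" and E: "proj E" "trace E = real p" "M ** E = - E"
    and F: "proj F" "trace F = real q" "M ** F = F" and EF: "E ** F = 0"
    and n: "CARD('n) = p + q + 2 * l" and det: "det M = (-1) ^ p"
  shows "\<exists>X\<in>Gr (p + l). \<exists>Y\<in>Gr l. Y *v e = - e \<and> M = X ** Y"
proof -
  have TM: "transpose M ** M = mat 1" using M by (simp add: orthogonal_matrix)
  \<comment> \<open>Orthogonality of \<open>M\<close> turns the eigenvalue relations around, so that
    \<open>M\<close> commutes with \<open>E\<close> and \<open>F\<close> and preserves the
    orthogonal complement of their ranges.\<close>
  have EM: "E ** M = - E"
  proof -
    have "E ** transpose M = - E" using E(1,3) by (metis matrix_transpose_mul projD(1) transpose_minus)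
    then have "- E ** M = E" using TM by (metis matrix_mul_assoc matrix_mul_rid)
    then show ?thesis by (metis matrix_minus_left minus_minus)
  qed
  have FM: "F ** M = F"
  proof -
    have "F ** transpose M = F" using F(1,3) by (metis matrix_transpose_mul projD(1))
    then show ?thesis using TM by (metis matrix_mul_assoc matrix_mul_rid)
  qed
  have pEF: "proj (E + F)" by (rule proj_add[OF E(1) F(1) EF])
  define P where "P = mat 1 - (E + F)"
  have P: "proj P" unfolding P_def by (rule proj_diff[OF proj_one pEF]) simp
  have trP: "trace P = real (2 * l)" by (simp add: P_def trace_ring E F n)
  have "M ** P = P ** M" by (simp add: P_def matrix_ring E F EM FM)
  from orthogonal_decomposition[OF M P this, of e] obtain E' F' U r where
    *: "proj E'" "proj F'" "proj U" "E' ** F' = 0" "E' ** U = 0" "F' ** U = 0" "P = E' + F' + U"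
    "M ** E' = - E'" "M ** F' = F'" "reflections_on M e U r r" "trace U = real (2 * r)"
    by blast
  obtain c d where cd: "trace E' = real c" "trace F' = real d" using trace_proj_nat *(1,2) by metis
  have sum: "c + d + 2 * r = 2 * l"
    using trP by (simp add: *(7) trace_ring cd *(11) flip: of_nat_add of_nat_mult)
  have evE: "M *v v = -1 *\<^sub>R v" if "X *v v = v" "M ** X = - X" for X v
  proof -
    have "M *v v = (- X) *v v" using that by (metis matrix_vector_mul_assoc)
    also have "\<dots> = - (X *v v)" by (simp add: matrix_vector_mult_def vec_eq_iff sum_negf)
    finally show ?thesis using that by simp
  qed
  have evF: "M *v v = 1 *\<^sub>R v" if "X *v v = v" "M ** X = X" for X v
    using that by (metis matrix_vector_mul_assoc scaleR_one)
  have sE: "reflections_on M e E p 0"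
    using reflections_on_scalar[OF E(1,2) evE[OF _ E(3)], of 0] by simp
  have sF: "reflections_on M e F 0 0"
    using reflections_on_scalar[OF F(1,2) evF[OF _ F(3)], of 0] by simp
  have sE': "reflections_on M e E' (c - a) a" if "2 * a \<le> c" for a
    using reflections_on_scalar[OF *(1) cd(1) evE[OF _ *(8)], of a] that by simp
  have sF': "reflections_on M e F' b b" if "2 * b \<le> d" for b
    using reflections_on_scalar[OF *(2) cd(2) evF[OF _ *(9)], of b] that by simp
  \<comment> \<open>On \<open>E\<close> and \<open>F\<close> only lines are used. In the eigenspaces
    \<open>E'\<close> and \<open>F'\<close> split off from the complement, \<open>a\<close> and
    \<open>b\<close> planes are formed; these numbers stay free until the parity is known.\<close>
  have all: "reflections_on M e (mat 1) (p + (c - a + b + r)) (a + b + r)" if ab: "2 * a \<le> c" "2 * b \<le> d" for a b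
  proof -
    have "reflections_on M e (E' + F' + U) ((c - a) + b + r) (a + b + r)"
      by (rule reflections_on_add[OF reflections_on_add[OF sE'[OF ab(1)] sF'[OF ab(2)] *(4)] *(10)])
        (rule proj_add3[OF *(1-6)])
    from reflections_on_add[OF reflections_on_add[OF sE sF EF] this]
    have "reflections_on M e (E + F + P) (p + 0 + (c - a + b + r)) (0 + 0 + (a + b + r))"
      unfolding *(7)[symmetric] using projD(2)[OF pEF] by (simp add: P_def matrix_diff_ldistrib)
    then show ?thesis by (simp add: P_def)
  qed
  \<comment> \<open>The choice \<open>a = b = 0\<close> exhibits \<open>M\<close> in some
    \<open>Phi\<close>, where the determinant is known; comparing it with \<open>det\<close> shows
    that \<open>c\<close> is even.\<close>
  have "M \<in> Phi (p + (c + r)) r"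
    using reflections_on_one[OF all[of 0 0]] by (auto simp: Phi_def)
  from det_Phi[OF this] det have "(-1 :: real) ^ p = (-1) ^ (p + c)"
    by (simp add: power_add)
  then have "even c" by (simp add: minus_one_power_iff split: if_splits)
  then obtain a where a: "c = 2 * a" by blast
  with sum have "even d" by presburger
  then obtain b where b: "d = 2 * b" by blast
  have "a + b + r = l" using sum a b by simp
  moreover from this have "p + (c - a + b + r) = p + l" using a by simp
  ultimately show ?thesis using reflections_on_one[OF all[of a b]] a b by simp
qed

text \<open>
  Every \<open>2\<close>-dimensional summand of \<open>M\<close> contains a vector orthogonal to \<open>e\<close>, so the second factor can
  be normalized; this removes the \<open>k'\<close>-dimensional generic fibre of the product map.
\<close>
lemma Phi_normalized:
  fixes M :: "real^'n^'n"
  assumes M: "M \<in> Phi k k'" and k: "k' \<le> k" "k + k' \<le> CARD('n)"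
  shows "\<exists>X\<in>Gr k. \<exists>Y\<in>Gr k'. Y *v e = - e \<and> M = X ** Y"
proof -
  obtain P Q where PQ: "proj P" "trace P = real k" "proj Q" "trace Q = real k'"
    "M = (P + P - mat 1) ** (Q + Q - mat 1)"
    using M by (auto simp: Phi_def Gr_iff)
  \<comment> \<open>On \<open>E\<close> the first factor is 1 and the second -1, on \<open>F\<close>
    below both are -1. These are the eigenvectors of \<open>M\<close> that exist for dimension
    reasons alone.\<close>
  obtain E where E: "proj E" "P ** E = E" "Q ** E = 0" "trace E = real (k - k')"
    using proj_complement_in[OF PQ(1,3) _ PQ(4), of "k - k'"] PQ(2) k by auto
  have P': "proj (mat 1 - P)" by (rule proj_diff[OF proj_one PQ(1)]) simp
  have "trace (mat 1 - P) = real ((CARD('n) - k - k') + k')"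
    using k by (simp add: trace_ring PQ(2) of_nat_diff)
  from proj_complement_in[OF P' PQ(3) this PQ(4)] obtain F where F: "proj F" "(mat 1 - P) ** F = F"
    "Q ** F = 0" "trace F = real (CARD('n) - k - k')" by blast
  have PF: "P ** F = 0" using F(2) by (simp add: matrix_ring)
  have "E ** F = 0"
    using proj_commute_mult[OF PQ(1) E(1,2)] PF by (metis matrix_mul_assoc matrix_zero_right)
  moreover have "M ** E = - E" "M ** F = F"
  proof -
    have "M ** E = (P + P - mat 1) ** ((Q + Q - mat 1) ** E)" "M ** F = (P + P - mat 1) ** ((Q + Q - mat 1) ** F)"
      by (simp_all add: PQ(5) matrix_mul_assoc)
    then show "M ** E = - E" "M ** F = F"
      by (simp_all add: matrix_ring matrix_numeral E(2,3) F(3) PF)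
  qed
  moreover have "CARD('n) = (k - k') + (CARD('n) - k - k') + 2 * k'" using k by simp
  moreover have "det M = (-1) ^ (k - k')"
  proof -
    have "even (k + k') \<longleftrightarrow> even (k - k')" using k by (simp add: even_diff_nat)
    then show ?thesis unfolding det_Phi[OF M] minus_one_power_iff by simp
  qed
  ultimately have "\<exists>X\<in>Gr ((k - k') + k'). \<exists>Y\<in>Gr k'. Y *v e = - e \<and> M = X ** Y"
    using E(1,4) F(1,4) by (intro orthogonal_factorization[OF Phi_orthogonal[OF M], of E _ F "CARD('n) - k - k'"]) auto
  then show ?thesis using k by simp
qed

text \<open>With \<open>p\<close> and \<open>q\<close> at most 1 the required eigenvectors exist by
  parity: the determinant fixes the parity of the multiplicity of -1, and the dimension then that of
  the multiplicity of 1.\<close>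

lemma orthogonal_in_Phi:
  fixes M :: "real^'n^'n"
  assumes M: "orthogonal_matrix M" and det: "det M = (-1) ^ p" and n: "CARD('n) = p + q + 2 * l"
    and pq: "p \<le> 1" "q \<le> 1"
  shows "M \<in> Phi (p + l) l"
proof -
  from orthogonal_decomposition[OF M proj_one, of 0] obtain E F U r where
    *: "proj E" "proj F" "proj U" "E ** F = 0" "E ** U = 0" "F ** U = 0" "mat 1 = E + F + U"
    "M ** E = - E" "M ** F = F" "reflections_on M 0 U r r" "trace U = real (2 * r)"
    by auto
  obtain c d where cd: "trace E = real c" "trace F = real d" using trace_proj_nat *(1,2) by metis
  have "real CARD('n) = trace (mat 1 :: real^'n^'n)" by (simp add: trace_ring)
  also have "\<dots> = real (c + d + 2 * r)" by (simp add: *(7) trace_ring cd *(11))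
  finally have sum: "CARD('n) = c + d + 2 * r" by linarith
  have evE: "M *v v = -1 *\<^sub>R v" if "E *v v = v" for v
  proof -
    have "M *v v = (- E) *v v" using that *(8) by (metis matrix_vector_mul_assoc)
    also have "\<dots> = - (E *v v)" by (simp add: matrix_vector_mult_def vec_eq_iff sum_negf)
    finally show ?thesis using that by simp
  qed
  have evF: "M *v v = 1 *\<^sub>R v" if "F *v v = v" for v
    using that *(9) by (metis matrix_vector_mul_assoc scaleR_one)
  have "reflections_on M 0 E (c - 0) 0"
    using reflections_on_scalar[OF *(1) cd(1) evE, of 0] by simp
  moreover have "reflections_on M 0 F 0 0"
    using reflections_on_scalar[OF *(2) cd(2) evF, of 0] by simp
  ultimately have "reflections_on M 0 (mat 1) (c - 0 + 0 + r) (0 + 0 + r)"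
    unfolding *(7) using *(10) by (intro reflections_on_add proj_add3 *) auto
  from reflections_on_one[OF this] have "M \<in> Phi (c + r) r" by (auto simp: Phi_def)
  from det_Phi[OF this] det have "(-1 :: real) ^ p = (-1) ^ c"
    by (simp add: power_add)
  then have par: "even c \<longleftrightarrow> even p" by (metis neg_one_even_power neg_one_odd_power one_neq_neg_one)
  have part: "\<exists>R. proj R \<and> X ** R = R \<and> trace R = real s" if "proj X" "trace X = real x" "even x = even s" "s \<le> 1"
    for X :: "real^'n^'n" and x s
  proof -
    have "s \<le> x" using that by (cases s; cases x) auto
    then obtain y where "x = s + y" using le_Suc_ex by blast
    then show ?thesis using proj_subspace_avoiding_le[OF that(1), of "{}" y s] that(2) by auto
  qed
  obtain E' where E': "proj E'" "E ** E' = E'" "trace E' = real p" using part[OF *(1) cd(1) par pq(1)] by blast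
  have "even d \<longleftrightarrow> even q" using sum n par by presburger
  then obtain F' where F': "proj F'" "F ** F' = F'" "trace F' = real q" using part[OF *(2) cd(2) _ pq(2)] by blast
  have "M ** E' = - E'" using E'(2) *(8) by (metis matrix_minus_left matrix_mul_assoc)
  moreover have "M ** F' = F'" using F'(2) *(9) by (metis matrix_mul_assoc)
  moreover have "E' ** F' = 0"
    using proj_commute_mult[OF *(1) E'(1,2)] F'(2) *(4)
    by (metis matrix_mul_assoc matrix_zero_left matrix_zero_right)
  ultimately have "\<exists>X\<in>Gr (p + l). \<exists>Y\<in>Gr l. Y *v 0 = - 0 \<and> M = X ** Y"
    using E'(1,3) F'(1,3) n det by (intro orthogonal_factorization[OF M]) auto
  then show ?thesis by (auto simp: Phi_def)
qed

lemma Phi_eq_SO_group: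
  assumes "CARD('n) = 2 * k \<or> CARD('n) = 2 * k + 1"
  shows "(Phi k k :: (real^'n^'n) set) = SO_group"
proof (intro equalityI subsetI)
  fix M :: "real^'n^'n" assume "M \<in> Phi k k"
  then show "M \<in> SO_group"
    using Phi_orthogonal[of M k k] det_Phi[of M k k] by (simp add: SO_group_def O_group_def flip: mult_2)
next
  fix M :: "real^'n^'n" assume "M \<in> SO_group"
  then have "M \<in> Phi (0 + k) k"
    using assms by (intro orthogonal_in_Phi[of M 0 "CARD('n) - 2 * k"]) (auto simp: SO_group_def O_group_def)
  then show "M \<in> Phi k k" by simp
qed

lemma Phi_eq_SO_minus:
  assumes "CARD('n) = 2 * l + 1 \<or> CARD('n) = 2 * l + 2"
  shows "(Phi (l + 1) l :: (real^'n^'n) set) = SO_minus"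
proof (intro equalityI subsetI)
  fix M :: "real^'n^'n" assume "M \<in> Phi (l + 1) l"
  then show "M \<in> SO_minus"
    using Phi_orthogonal[of M "l + 1" l] det_Phi[of M "l + 1" l]
    by (simp add: SO_minus_def O_group_def flip: mult_2)
next
  fix M :: "real^'n^'n" assume "M \<in> SO_minus"
  then have "M \<in> Phi (1 + l) l"
    using assms by (intro orthogonal_in_Phi[of M 1 "CARD('n) - 2 * l - 1"]) (auto simp: SO_minus_def O_group_def)
  then show "M \<in> Phi (l + 1) l" by simp
qed

section \<open>Charts of the Grassmannian\<close>

lemma coord_poly_if:
  "(c \<Longrightarrow> coord_poly A f) \<Longrightarrow> (\<not> c \<Longrightarrow> coord_poly A g) \<Longrightarrow> coord_poly A (\<lambda>t. if c then f t else g t)"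
  by (cases c) auto

definition matrix_poly :: "'p set \<Rightarrow> (('p \<Rightarrow> real) \<Rightarrow> real^'n^'m) \<Rightarrow> bool" where
  "matrix_poly A M \<longleftrightarrow> (\<forall>i j. coord_poly A (\<lambda>t. M t $ i $ j))"

lemma matrix_poly_const: "matrix_poly A (\<lambda>t. C)"
  by (simp add: matrix_poly_def coord_poly_const)

lemma matrix_poly_add: "matrix_poly A M \<Longrightarrow> matrix_poly A N \<Longrightarrow> matrix_poly A (\<lambda>t. M t + N t)"
  by (simp add: matrix_poly_def coord_poly_add)

lemma matrix_poly_diff: "matrix_poly A M \<Longrightarrow> matrix_poly A N \<Longrightarrow> matrix_poly A (\<lambda>t. M t - N t)"
  by (simp add: matrix_poly_def coord_poly_diff)

lemma matrix_poly_mult: "matrix_poly A M \<Longrightarrow> matrix_poly A N \<Longrightarrow> matrix_poly A (\<lambda>t. M t ** N t)"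
  by (auto simp: matrix_poly_def matrix_matrix_mult_def intro!: coord_poly_sum coord_poly_mult)

lemma matrix_poly_transpose: "matrix_poly A M \<Longrightarrow> matrix_poly A (\<lambda>t. transpose (M t))"
  by (simp add: matrix_poly_def transpose_def)

lemma coord_poly_det: "matrix_poly A M \<Longrightarrow> coord_poly A (\<lambda>t. det (M t))"
  unfolding det_def matrix_poly_def
  by (intro coord_poly_sum coord_poly_mult coord_poly_prod coord_poly_const) auto

text \<open>The usual adjugate, with each entry as a Cramer numerator: polynomial in
  \<open>G\<close>, and \<open>det G\<close> times the inverse if there is one.\<close>

definition adjugate :: "real^'n^'n \<Rightarrow> real^'n^'n" where
  "adjugate G = (\<chi> k j. det (\<chi> i l. if l = k then axis j 1 $ i else G $ i $ l))"

lemma matrix_poly_adjugate: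
  assumes "matrix_poly A M"
  shows "matrix_poly A (\<lambda>t. adjugate (M t))"
proof -
  have "coord_poly A (\<lambda>t. det (\<chi> i l. if l = k then axis j 1 $ i else M t $ i $ l))" for k j
    using assms by (intro coord_poly_det) (auto simp: matrix_poly_def intro!: coord_poly_if coord_poly_const)
  then show ?thesis by (simp add: matrix_poly_def adjugate_def)
qed

lemma inverse_eq_adjugate:
  fixes G :: "real^'n^'n"
  assumes "G ** B = mat 1"
  shows "det G *\<^sub>R B = adjugate G"
proof -
  have "adjugate G $ k $ j = det G * B $ k $ j" for k j
  proof -
    have eq: "G *v (B *v axis j 1) = axis j 1" by (simp add: matrix_vector_mul_assoc assms)
    show ?thesis
      using cramer_lemma[of k G "B *v axis j 1"] unfolding eq
      by (simp add: adjugate_def mult.commute matrix_vector_mult_basis column_def)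
  qed
  then show ?thesis by (simp add: vec_eq_iff)
qed

lemma inverse_exists:
  fixes G :: "real^'n^'n"
  assumes "\<And>x. G *v x = 0 \<Longrightarrow> x = 0"
  shows "\<exists>B. G ** B = mat 1 \<and> B ** G = mat 1"
  using assms by (metis matrix_left_invertible_ker matrix_left_right_inverse)

lemma det_nonzero_iff_inverse:
  fixes G :: "real^'n^'n"
  shows "det G \<noteq> 0 \<longleftrightarrow> (\<exists>B. G ** B = mat 1 \<and> B ** G = mat 1)"
  by (metis invertible_def invertible_det_nz)

section \<open>The Cayley transform\<close>

lemma skew_inner:
  fixes K :: "real^'n^'n"
  assumes "transpose K = - K"
  shows "x \<bullet> (K *v x) = 0"
proof -
  have "x \<bullet> (K *v x) = (transpose K *v x) \<bullet> x"
    by (metis dot_lmul_matrix transpose_matrix_vector)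
  also have "transpose K *v x = - (K *v x)"
    unfolding assms by (simp add: matrix_vector_mult_def vec_eq_iff sum_negf)
  finally show ?thesis by (simp add: inner_commute)
qed

lemma one_plus_skew_inverse:
  fixes K :: "real^'n^'n"
  assumes "transpose K = - K"
  shows "\<exists>B. (mat 1 + K) ** B = mat 1 \<and> B ** (mat 1 + K) = mat 1"
proof (rule inverse_exists)
  fix x assume "(mat 1 + K) *v x = 0"
  then have "x \<bullet> (x + K *v x) = 0" by (simp add: matrix_vector_mult_add_rdistrib)
  then show "x = 0" by (simp add: inner_add_right skew_inner[OF assms])
qed

definition cayley :: "real^'n^'n \<Rightarrow> real^'n^'n" where
  "cayley K = (mat 1 - K) ** matrix_inv (mat 1 + K)"

lemma cayley_eq:
  assumes "(mat 1 + K) ** B = mat 1" "B ** (mat 1 + K) = mat 1"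
  shows "cayley K = (mat 1 - K) ** B"
proof -
  have "matrix_inv (mat 1 + K) = B"
    unfolding matrix_inv_def
    by (rule some_equality) (use assms in simp, metis assms(1) matrix_mul_assoc matrix_mul_lid matrix_mul_rid)
  then show ?thesis by (simp add: cayley_def)
qed

lemma det_cayley_scaleR:
  assumes "det (mat 1 + K) \<noteq> 0"
  shows "cayley K = (1 / det (mat 1 + K)) *\<^sub>R ((mat 1 - K) ** adjugate (mat 1 + K))"
proof -
  obtain B where B: "(mat 1 + K) ** B = mat 1" "B ** (mat 1 + K) = mat 1"
    using assms det_nonzero_iff_inverse by blast
  show ?thesis
    unfolding cayley_eq[OF B] inverse_eq_adjugate[OF B(1), symmetric] using assms
    by (simp add: matrix_scaleR_right)
qed

lemma cayley_involution:
  fixes A :: "real^'n^'n"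
  assumes B: "(mat 1 + A) ** B = mat 1" "B ** (mat 1 + A) = mat 1"
  shows "cayley ((mat 1 - A) ** B) = A"
proof -
  let ?K = "(mat 1 - A) ** B"
  have 1: "mat 1 + ?K = 2 *\<^sub>R B"
  proof -
    have "mat 1 + ?K = ((mat 1 + A) + (mat 1 - A)) ** B" unfolding matrix_add_rdistrib[of "mat 1 + A" "mat 1 - A"] B(1) ..
    also have "(mat 1 + A) + (mat 1 - A) = 2 *\<^sub>R mat 1" by (simp add: scaleR_2)
    finally show ?thesis by (simp add: matrix_scaleR_left)
  qed
  have 2: "mat 1 - ?K = 2 *\<^sub>R (A ** B)"
  proof -
    have "mat 1 - ?K = ((mat 1 + A) - (mat 1 - A)) ** B" unfolding matrix_diff_rdistrib[of "mat 1 + A"] B(1) ..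
    also have "(mat 1 + A) - (mat 1 - A) = 2 *\<^sub>R A" by (simp add: scaleR_2)
    finally show ?thesis by (simp add: matrix_scaleR_left)
  qed
  have "cayley ?K = 2 *\<^sub>R (A ** B) ** ((1/2) *\<^sub>R (mat 1 + A))"
    unfolding 2[symmetric]
    by (rule cayley_eq) (simp_all only: 1 matrix_scaleR_left matrix_scaleR_right B scaleR_scaleR, simp_all)
  also have "\<dots> = A ** (B ** (mat 1 + A))" by (simp add: matrix_scaleR_left matrix_scaleR_right matrix_mul_assoc)
  finally show ?thesis by (simp add: B)
qed

text \<open>\<open>I\<close> indexes a coordinate subspace onto which the range of \<open>P\<close> projects isomorphically.\<close>
lemma proj_transversal:
  fixes P :: "real^'n^'n"
  assumes "proj P" "trace P = real k" "\<forall>z\<in>Z. P *v axis z 1 = 0"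
  shows "\<exists>I. card I = k \<and> I \<inter> Z = {} \<and> (\<forall>y. P *v y = y \<and> (\<forall>i\<in>I. y $ i = 0) \<longrightarrow> y = 0)
    \<and> (\<forall>x. P *v x = 0 \<and> (\<forall>i. i \<notin> I \<longrightarrow> x $ i = 0) \<longrightarrow> x = 0)"
  using assms
proof (induction k arbitrary: P Z)
  case 0
  then have "P = 0" using trace_proj_eq_0 by auto
  moreover have "x = 0" if "\<forall>i. x $ i = 0" for x :: "real^'n" using that by (simp add: vec_eq_iff)
  ultimately show ?case by (intro exI[of _ "{}"]) auto
next
  case (Suc k)
  have "P \<noteq> 0" using Suc.prems(2) by (auto simp: trace_ring)
  then obtain i where i: "P *v axis i 1 \<noteq> 0"
    by (auto simp: matrix_vector_mult_basis column_def vec_eq_iff)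
  define u where "u = P *v axis i 1"
  define v where "v = (1 / norm u) *\<^sub>R u"
  have u0: "u \<noteq> 0" using i by (simp add: u_def)
  have Pu: "P *v u = u" by (simp add: u_def matrix_vector_mul_assoc projD[OF Suc.prems(1)])
  have v: "norm v = 1" "P *v v = v" using u0 by (simp_all add: v_def matrix_vector_mult_scaleR Pu)
  note peel = proj_peel[OF Suc.prems(1) v]
  have "u \<bullet> axis i 1 = (P *v u) \<bullet> axis i 1" by (simp add: Pu)
  also have "\<dots> = u \<bullet> (P *v axis i 1)"
    by (metis Suc.prems(1) dot_lmul_matrix projD(1) transpose_matrix_vector)
  finally have vi: "v \<bullet> axis i 1 = norm u"
    using u0 by (simp add: v_def power2_norm_eq_inner[symmetric] power2_eq_square flip: u_def)
  have vi': "v $ i \<noteq> 0" using vi u0 by (simp add: inner_axis)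
  let ?P = "P - outer v v"
  \<comment> \<open>Since \<open>v\<close> is the direction of column \<open>i\<close> of
    \<open>P\<close>, removing it puts \<open>axis i 1\<close> into the kernel. The index
    \<open>i\<close> can therefore join \<open>Z\<close>, which keeps the later choices away from
    it.\<close>
  have Pi: "?P *v axis i 1 = 0"
    using u0 by (simp add: matrix_vector_mult_diff_rdistrib outer_vec vi flip: u_def) (simp add: v_def)
  have Pz: "\<forall>z\<in>insert i Z. ?P *v axis z 1 = 0"
  proof
    fix z assume "z \<in> insert i Z"
    show "?P *v axis z 1 = 0"
    proof (cases "z = i")
      case False
      then have "P *v axis z 1 = 0" using \<open>z \<in> insert i Z\<close> Suc.prems(3) by simp
      moreover from this have "?P *v axis z 1 = 0"
        by (rule proj_below[OF Suc.prems(1) peel(1), rotated])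
          (use peel(2) projD(2)[OF Suc.prems(1)] in \<open>simp add: matrix_diff_ldistrib\<close>)
      ultimately show ?thesis by simp
    qed (simp add: Pi)
  qed
  have "trace ?P = real k" using peel(3) Suc.prems(2) by simp
  from Suc.IH[OF peel(1) this Pz] obtain I where I: "card I = k" "I \<inter> insert i Z = {}"
    "\<forall>y. ?P *v y = y \<and> (\<forall>i\<in>I. y $ i = 0) \<longrightarrow> y = 0"
    "\<forall>x. ?P *v x = 0 \<and> (\<forall>i. i \<notin> I \<longrightarrow> x $ i = 0) \<longrightarrow> x = 0"
    by (elim exE conjE) (rule that; assumption)
  have coord: "(?P *v y) $ i = 0" for y
  proof -
    have "(?P *v y) $ i = (?P *v y) \<bullet> axis i 1" by (simp add: inner_axis)
    also have "\<dots> = y \<bullet> (?P *v axis i 1)"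
      by (metis peel(1) dot_lmul_matrix projD(1) transpose_matrix_vector)
    finally show ?thesis by (simp add: Pi)
  qed
  have split: "P *v y = ?P *v y + (v \<bullet> y) *\<^sub>R v" for y
    by (simp add: matrix_vector_mult_diff_rdistrib outer_vec)
  show ?case
  proof (intro exI[of _ "insert i I"] conjI allI impI)
    show "card (insert i I) = Suc k" using I(1,2) by simp
    show "insert i I \<inter> Z = {}" using I(2) i Suc.prems(3) by auto
  next
    fix y assume y: "P *v y = y \<and> (\<forall>j\<in>insert i I. y $ j = 0)"
    have "y $ i = (v \<bullet> y) * v $ i" using arg_cong[OF split[of y], of "\<lambda>w. w $ i"] y coord[of y] by simp
    then have vy: "v \<bullet> y = 0" using y vi' by simp
    have "?P *v y = y" using split[of y] y vy by simp
    then show "y = 0" using I(3)[rule_format, of y] y by blast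
  next
    fix x assume x: "P *v x = 0 \<and> (\<forall>j. j \<notin> insert i I \<longrightarrow> x $ j = 0)"
    have "?P *v x = 0"
      by (rule proj_below[OF Suc.prems(1) peel(1)])
        (use peel(2) projD(2)[OF Suc.prems(1)] x in \<open>simp_all add: matrix_diff_ldistrib\<close>)
    then have vx: "v \<bullet> x = 0" using split[of x] x v by auto
    define c where "c = x $ i"
    have Pc: "?P *v (x - c *\<^sub>R axis i 1) = 0"
      by (simp add: matrix_vector_mult_diff_distrib matrix_vector_mult_scaleR Pi \<open>?P *v x = 0\<close>)
    have "x - c *\<^sub>R axis i 1 = 0"
      by (rule I(4)[rule_format], rule conjI) (use Pc x in \<open>auto simp: axis_def c_def\<close>)
    then have xi: "x = c *\<^sub>R axis i 1" by (rule right_minus_eq[THEN iffD1])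
    then have "c * v $ i = 0" using vx by (simp add: inner_axis)
    then show "x = 0" using xi vi' by simp
  qed
qed

section \<open>Sign matrices and block skew matrices\<close>

definition signs :: "'n set \<Rightarrow> real^'n^'n" where
  "signs I = (\<chi> i j. if i = j then (if i \<in> I then 1 else -1) else 0)"

lemma signs_vec: "(signs I *v x) $ i = (if i \<in> I then x $ i else - x $ i)"
  by (simp add: signs_def matrix_vector_mult_def if_distrib[of "\<lambda>c. c * _"] sum.delta' cong: if_cong)

lemma signs_mult: "(signs I ** A) $ i $ j = (if i \<in> I then A $ i $ j else - A $ i $ j)"
  by (simp add: signs_def matrix_matrix_mult_def if_distrib[of "\<lambda>c. c * _"] sum.delta' cong: if_cong)

lemma transpose_signs: "transpose (signs I) = signs I"
  by (auto simp: signs_def transpose_def vec_eq_iff)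

lemma mult_signs: "(A ** signs I) $ i $ j = (if j \<in> I then A $ i $ j else - A $ i $ j)"
proof -
  have "A ** signs I = transpose (signs I ** transpose A)"
    by (simp add: matrix_transpose_mul transpose_signs)
  then show ?thesis by (simp add: transpose_def signs_mult)
qed

lemma signs_signs: "signs I ** signs I = mat 1"
  by (simp add: vec_eq_iff signs_mult) (simp add: signs_def mat_def)

text \<open>For \<open>J = - I\<close> these matrices anticommute with \<open>signs I\<close>; up to
  the factor \<open>signs I\<close> they are the tangent vectors of the Grassmannian at that point.
  Deleting from \<open>J\<close> a set \<open>Z\<close> disjoint from \<open>I\<close> puts the
  vectors \<open>axis z 1\<close> into the kernel.\<close>

definition skew :: "'n set \<Rightarrow> 'n set \<Rightarrow> ('n \<times> 'n \<Rightarrow> real) \<Rightarrow> real^'n^'n" where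
  "skew I J t = (\<chi> i j. if i \<in> I \<and> j \<in> J then t (i, j) else if j \<in> I \<and> i \<in> J then - t (j, i) else 0)"

lemma transpose_skew: "I \<inter> J = {} \<Longrightarrow> transpose (skew I J t) = - skew I J t"
  by (auto simp: skew_def transpose_def vec_eq_iff)

text \<open>For a suitable \<open>I\<close> the matrix A = \<open>signs I ** X\<close> has no
  eigenvalue -1, so it is the Cayley transform of some K. Orthogonality of A makes K skew,
  conjugation by \<open>signs I\<close>, which transposes A, forces the blocks of K inside
  \<open>I\<close> and inside its complement to vanish, and vectors fixed by A lie in the kernel of
  K.\<close>

lemma Gr_chart:
  fixes X :: "real^'n^'n"
  assumes X: "X \<in> Gr k" and Z: "\<And>z. z \<in> Z \<Longrightarrow> X *v axis z 1 = - axis z 1"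
  shows "\<exists>I t. card I = k \<and> I \<inter> Z = {} \<and> X = signs I ** cayley (skew I (- I - Z) t)"
proof -
  obtain P where P: "proj P" "trace P = real k" "X = P + P - mat 1" using X Gr_iff by blast
  have XX: "X ** X = mat 1" "transpose X = X"
    using projD[OF P(1)] by (simp_all add: P(3) matrix_ring matrix_numeral transpose_ring)
  have Xv: "X *v x = (P *v x + P *v x) - x" for x
    by (simp add: P(3) matrix_vector_mult_add_rdistrib matrix_vector_mult_diff_rdistrib matrix_numeral)
  have "\<forall>z\<in>Z. P *v axis z 1 = 0"
  proof
    fix z assume "z \<in> Z"
    have "2 *\<^sub>R (P *v axis z 1) = 0"
      using Z[OF \<open>z \<in> Z\<close>] Xv[of "axis z 1"] unfolding scaleR_2 by simp
    then show "P *v axis z 1 = 0" by simp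
  qed
  from proj_transversal[OF P(1,2) this] obtain I where I: "card I = k" "I \<inter> Z = {}"
    "\<forall>y. P *v y = y \<and> (\<forall>i\<in>I. y $ i = 0) \<longrightarrow> y = 0"
    "\<forall>x. P *v x = 0 \<and> (\<forall>i. i \<notin> I \<longrightarrow> x $ i = 0) \<longrightarrow> x = 0"
    by (elim exE conjE) (rule that; assumption)
  let ?D = "signs I"
  define A where "A = ?D ** X"
  have TA: "transpose A = X ** ?D" by (simp add: A_def matrix_transpose_mul XX transpose_signs)
  have DAD: "?D ** A ** ?D = transpose A"
    unfolding TA unfolding A_def by (simp add: matrix_mul_assoc signs_signs)
  have AA: "transpose A ** A = mat 1"
    by (metis A_def TA XX(1) matrix_mul_assoc matrix_mul_rid signs_signs)
  \<comment> \<open>For a kernel vector x, P x vanishes on \<open>I\<close> and agrees with x off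
    \<open>I\<close>; the two halves of transversality give first P x = 0 and then x = 0.\<close>
  have "x = 0" if x: "(mat 1 + A) *v x = 0" for x
  proof -
    have "?D *v (X *v x) = - x"
      using x by (simp add: matrix_vector_mult_add_rdistrib A_def matrix_vector_mul_assoc add_eq_0_iff)
    then have "X *v x = - (?D *v x)"
      by (metis (no_types, lifting) signs_signs matrix_vector_mul_assoc matrix_vector_mul_lid
          linear_neg matrix_vector_mul_linear)
    then have *: "(P *v x) $ i + (P *v x) $ i - x $ i = - (?D *v x) $ i" for i
      using Xv[of x] by (simp add: vec_eq_iff)
    have 1: "(P *v x) $ i = 0" if "i \<in> I" for i using *[of i] that by (simp add: signs_vec)
    have 2: "(P *v x) $ i = x $ i" if "i \<notin> I" for i using *[of i] that by (simp add: signs_vec)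
    have "P *v x = 0" by (rule I(3)[rule_format], rule conjI) (use 1 projD(2)[OF P(1)] in \<open>auto simp: matrix_vector_mul_assoc\<close>)
    then show "x = 0" using I(4)[rule_format, of x] 2 by simp
  qed
  from inverse_exists[OF this] obtain B where B: "(mat 1 + A) ** B = mat 1" "B ** (mat 1 + A) = mat 1" by blast
  define K where "K = (mat 1 - A) ** B"
  have KB: "K = B ** (mat 1 - A)"
  proof -
    have "(mat 1 + A) ** (mat 1 - A) = (mat 1 - A) ** (mat 1 + A)" by (simp add: matrix_ring)
    then show ?thesis unfolding K_def by (metis B matrix_mul_assoc matrix_mul_lid matrix_mul_rid)
  qed
  have TB: "?D ** B ** ?D = transpose B"
  proof -
    have 1: "(mat 1 + transpose A) ** (?D ** B ** ?D) = mat 1"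
    proof -
      have "(mat 1 + transpose A) ** ?D = ?D ** (mat 1 + A)"
        by (simp add: matrix_ring flip: DAD) (simp add: A_def matrix_mul_assoc signs_signs flip: matrix_mul_assoc)
      then have "(mat 1 + transpose A) ** (?D ** B ** ?D) = ?D ** ((mat 1 + A) ** B) ** ?D"
        by (simp add: matrix_mul_assoc)
      then show ?thesis by (simp add: B signs_signs)
    qed
    have 2: "transpose B ** (mat 1 + transpose A) = mat 1"
      using arg_cong[OF B(1), of transpose] by (simp add: transpose_ring)
    from 1 2 show ?thesis by (metis matrix_mul_assoc matrix_mul_lid matrix_mul_rid)
  qed
  have DKD: "?D ** K ** ?D = transpose K"
  proof -
    have "?D ** K ** ?D = (?D ** (mat 1 - A) ** ?D) ** (?D ** B ** ?D)"
      by (metis K_def matrix_mul_assoc matrix_mul_rid signs_signs)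
    also have "?D ** (mat 1 - A) ** ?D = mat 1 - transpose A"
      by (simp add: matrix_ring signs_signs DAD)
    also have "(mat 1 - transpose A) ** (?D ** B ** ?D) = transpose K"
      by (simp add: KB TB transpose_ring)
    finally show ?thesis .
  qed
  have TK: "transpose K = - K"
  proof -
    have "transpose K ** (mat 1 + transpose A) = mat 1 - transpose A"
      using arg_cong[OF B(1), of transpose]
      by (simp add: KB transpose_ring flip: matrix_mul_assoc)
    then have "transpose K ** ((mat 1 + transpose A) ** A) = (mat 1 - transpose A) ** A"
      by (simp add: matrix_mul_assoc)
    then have "transpose K ** (mat 1 + A) = - (mat 1 - A)"
      by (simp add: matrix_ring AA add.commute)
    then have "transpose K = - (mat 1 - A) ** B"
      by (metis B(1) matrix_mul_assoc matrix_mul_rid)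
    then show ?thesis by (simp only: K_def matrix_minus_left)
  qed
  have K1: "K $ i $ j = 0" if "i \<in> I \<longleftrightarrow> j \<in> I" for i j
  proof -
    have "(?D ** K ** ?D) $ i $ j = - K $ i $ j" using DKD TK by (simp add: vec_eq_iff)
    then show ?thesis using that by (auto simp: mult_signs signs_mult split: if_splits)
  qed
  have Ksym: "K $ i $ j = - K $ j $ i" for i j
  proof -
    have "transpose K $ j $ i = (- K) $ j $ i" by (simp only: TK)
    then show ?thesis by (simp add: transpose_def)
  qed
  have Kz: "K $ i $ z = 0" if "z \<in> Z" for i z
  proof -
    have "?D *v axis z 1 = - axis z 1"
      using I(2) that by (auto simp: vec_eq_iff signs_vec axis_def)
    then have "A *v axis z 1 = axis z 1"
      by (simp add: A_def Z[OF that] linear_neg[OF matrix_vector_mul_linear[of ?D]]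
          flip: matrix_vector_mul_assoc)
    then have "K *v axis z 1 = 0"
      by (simp add: KB matrix_vector_mult_diff_rdistrib flip: matrix_vector_mul_assoc)
    then show ?thesis by (simp add: matrix_vector_mult_basis column_def vec_eq_iff)
  qed
  have "K = skew I (- I - Z) (\<lambda>(i, j). K $ i $ j)"
  proof -
    have "K $ i $ j = skew I (- I - Z) (\<lambda>(i, j). K $ i $ j) $ i $ j" for i j
    proof (cases "i \<in> I \<longleftrightarrow> j \<in> I")
      case True
      with K1[OF True] show ?thesis by (auto simp: skew_def)
    next
      case False
      then consider "i \<in> I" "j \<notin> I" | "i \<notin> I" "j \<in> I" by blast
      then show ?thesis
      proof cases
        case 1
        then show ?thesis using Kz[of j i] by (cases "j \<in> Z") (auto simp: skew_def)
      next
        case 2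
        then show ?thesis
          unfolding Ksym[of i j] using Kz[of i j] by (cases "i \<in> Z") (auto simp: skew_def)
      qed
    qed
    then show ?thesis unfolding vec_eq_iff by blast
  qed
  moreover have "X = ?D ** cayley K"
    unfolding K_def cayley_involution[OF B] by (simp add: A_def matrix_mul_assoc signs_signs)
  ultimately show ?thesis using I(1,2) by metis
qed

lemma rational_chart_matrix:
  fixes M :: "('p \<Rightarrow> real) \<Rightarrow> real^'n^'n"
  assumes q: "coord_poly A q" and M: "matrix_poly A M"
    and \<phi>: "\<And>t. q t \<noteq> 0 \<Longrightarrow> \<phi> t = (1 / q t) *\<^sub>R M t"
  shows "rational_chart A q \<phi>"
  unfolding rational_chart_def
proof (intro conjI ballI q)
  fix b :: "real^'n^'n" assume "b \<in> Basis"
  then obtain i j where b: "b = axis i (axis j 1)" by (auto simp: Basis_vec_def)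
  have "\<phi> t \<bullet> b = M t $ i $ j / q t" if "q t \<noteq> 0" for t
    by (simp add: \<phi>[OF that] b inner_axis)
  then show "\<exists>p. coord_poly A p \<and> (\<forall>t. q t \<noteq> 0 \<longrightarrow> \<phi> t \<bullet> b = p t / q t)"
    using M by (auto simp: matrix_poly_def)
qed

lemma matrix_poly_skew:
  assumes "\<And>i j. i \<in> I \<Longrightarrow> j \<in> J \<Longrightarrow> h (i, j) \<in> A"
  shows "matrix_poly A (\<lambda>t. skew I J (\<lambda>x. t (h x)))"
  unfolding matrix_poly_def
proof (intro allI)
  fix i j
  show "coord_poly A (\<lambda>t. skew I J (\<lambda>x. t (h x)) $ i $ j)"
    unfolding skew_def vec_lambda_beta
    by (intro coord_poly_if coord_poly_uminus coord_poly_var coord_poly_const assms) auto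
qed

lemma semialg_dim_Phi_le:
  assumes k: "k' \<le> k" "k < CARD('n)" "k + k' \<le> CARD('n)"
  shows "semialg_dim (Phi k k' :: (real^'n^'n) set)
     \<le> ereal (real (k * (CARD('n) - k) + k' * (CARD('n) - k' - 1)))"
proof -
  fix e :: 'n
  \<comment> \<open>The tags \<open>Inl\<close> and \<open>Inr\<close> keep the parameters of the
    two factors apart. The second factor is normalized at \<open>axis e 1\<close>, so
    \<open>e\<close> is excluded from its positions, which leaves k'(n-k'-1) of them.\<close>
  define A where "A = (\<lambda>(I, J). Inl ` (I \<times> (- I)) \<union> Inr ` (J \<times> (- J - {e})) :: ('n \<times> 'n + 'n \<times> 'n) set)"
  define K where "K = (\<lambda>(I :: 'n set, J :: 'n set) t :: 'n \<times> 'n + 'n \<times> 'n \<Rightarrow> real. skew I (- I) (\<lambda>x. t (Inl x)))"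
  define L where "L = (\<lambda>(I :: 'n set, J :: 'n set) t :: 'n \<times> 'n + 'n \<times> 'n \<Rightarrow> real. skew J (- J - {e}) (\<lambda>x. t (Inr x)))"
  define q where "q = (\<lambda>c t. det (mat 1 + K c t) * det (mat 1 + L c t))"
  define \<phi> where "\<phi> = (\<lambda>c t. (signs (fst c) ** cayley (K c t)) ** (signs (snd c) ** cayley (L c t)))"
  let ?C = "{I. card I = k} \<times> {J. card J = k' \<and> e \<notin> J}"
  have mK: "matrix_poly (A c) (K c)" and mL: "matrix_poly (A c) (L c)" for c
    by (cases c; auto simp: K_def L_def A_def intro!: matrix_poly_skew)+
  show ?thesis
  proof (rule semialg_dim_le_charts[where I = ?C and A = A and q = q and \<phi> = \<phi>])
    show "rational_chart (A c) (q c) (\<phi> c)" for c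
    proof (rule rational_chart_matrix)
      show "coord_poly (A c) (q c)"
        unfolding q_def by (intro coord_poly_mult coord_poly_det matrix_poly_add matrix_poly_const mK mL)
      show "matrix_poly (A c) (\<lambda>t. (signs (fst c) ** ((mat 1 - K c t) ** adjugate (mat 1 + K c t))) **
          (signs (snd c) ** ((mat 1 - L c t) ** adjugate (mat 1 + L c t))))"
        by (intro matrix_poly_mult matrix_poly_add matrix_poly_diff matrix_poly_const matrix_poly_adjugate mK mL)
      fix t assume "q c t \<noteq> 0"
      then have "det (mat 1 + K c t) \<noteq> 0" "det (mat 1 + L c t) \<noteq> 0" by (auto simp: q_def)
      then show "\<phi> c t = (1 / q c t) *\<^sub>R ((signs (fst c) ** ((mat 1 - K c t) ** adjugate (mat 1 + K c t))) **
          (signs (snd c) ** ((mat 1 - L c t) ** adjugate (mat 1 + L c t))))"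
        by (simp add: \<phi>_def q_def det_cayley_scaleR matrix_scaleR_left matrix_scaleR_right)
    qed
    show "finite (A c)" for c by (cases c) (simp add: A_def)
    show "card (A c) = k * (CARD('n) - k) + k' * (CARD('n) - k' - 1)" if "c \<in> ?C" for c
    proof -
      obtain I J where c: "c = (I, J)" "card I = k" "card J = k'" "e \<notin> J" using \<open>c \<in> ?C\<close> by auto
      have "card (A c) = card (Inl ` (I \<times> - I) :: ('n \<times> 'n + 'n \<times> 'n) set) + card (Inr ` (J \<times> (- J - {e})) :: ('n \<times> 'n + 'n \<times> 'n) set)"
        unfolding A_def c by (simp, subst card_Un_disjoint) auto
      also have "\<dots> = k * (CARD('n) - k) + k' * (CARD('n) - k' - 1)"
        using c by (simp add: card_image card_cartesian_product Compl_eq_Diff_UNIV card_Diff_subset)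
      finally show ?thesis .
    qed
    fix M :: "real^'n^'n" assume "M \<in> Phi k k'"
    from Phi_normalized[OF this k(1,3), of "axis e 1"] obtain X Y where
      XY: "X \<in> Gr k" "Y \<in> Gr k'" "Y *v axis e 1 = - axis e 1" "M = X ** Y" by blast
    obtain I s where I: "card I = k" "X = signs I ** cayley (skew I (- I) s)"
      using Gr_chart[OF XY(1), of "{}"] by auto
    obtain J u where J: "card J = k'" "e \<notin> J" "Y = signs J ** cayley (skew J (- J - {e}) u)"
      using Gr_chart[OF XY(2), of "{e}"] XY(3) by auto
    have "q (I, J) (case_sum s u) \<noteq> 0"
    proof -
      have "transpose (K (I, J) (case_sum s u)) = - K (I, J) (case_sum s u)"
        "transpose (L (I, J) (case_sum s u)) = - L (I, J) (case_sum s u)"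
        by (simp_all add: K_def L_def transpose_skew) (rule transpose_skew, auto)
      from this[THEN one_plus_skew_inverse]
      have "det (mat 1 + K (I, J) (case_sum s u)) \<noteq> 0" "det (mat 1 + L (I, J) (case_sum s u)) \<noteq> 0"
        by (simp_all only: det_nonzero_iff_inverse)
      then show ?thesis by (simp add: q_def)
    qed
    moreover have "M = \<phi> (I, J) (case_sum s u)"
      by (simp add: \<phi>_def K_def L_def XY(4) I(2) J(3))
    ultimately show "\<exists>c\<in>?C. \<exists>t. q c t \<noteq> 0 \<and> M = \<phi> c t"
      using I(1) J(1,2) by (intro bexI[of _ "(I, J)"] exI[of _ "case_sum s u"]) auto
  qed simp
qed

section \<open>A chart with independent parameters\<close>

lemma uminus_matrix_vec: "(- A :: real^'n^'m) *v x = - (A *v x)" "A *v (- x) = - (A *v x)"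
  by (simp_all add: matrix_vector_mult_def vec_eq_iff sum_negf)

lemma real_polynomial_function_entry: "real_polynomial_function (\<lambda>M :: real^'n^'m. M $ i $ j)"
proof -
  have "bounded_linear (\<lambda>M :: real^'n^'m. M $ i $ j)"
    using bounded_linear_compose[OF bounded_linear_vec_nth bounded_linear_vec_nth] by blast
  then show ?thesis by (rule real_polynomial_function.intros(1))
qed

lemma real_polynomial_function_det:
  fixes N :: "'a::real_normed_vector \<Rightarrow> real^'n^'n"
  assumes "\<And>i j. real_polynomial_function (\<lambda>x. N x $ i $ j)"
  shows "real_polynomial_function (\<lambda>x. det (N x))"
  unfolding det_def
  by (intro real_polynomial_function_sum real_polynomial_function.intros(4)
      real_polynomial_function_prod real_polynomial_function.intros(2) assms) auto

lemma real_polynomial_function_if: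
  "(c \<Longrightarrow> real_polynomial_function f) \<Longrightarrow> (\<not> c \<Longrightarrow> real_polynomial_function g)
    \<Longrightarrow> real_polynomial_function (\<lambda>x. if c then f x else g x)"
  by (cases c) auto

section \<open>Cayley transforms of skew matrices\<close>

lemma cayley_inverse:
  fixes A :: "real^'n^'n"
  assumes A: "transpose A = - A"
  obtains B where "(mat 1 + A) ** B = mat 1" "B ** (mat 1 + A) = mat 1"
    "cayley A = (mat 1 - A) ** B" "cayley A = B ** (mat 1 - A)"
proof -
  obtain B where B: "(mat 1 + A) ** B = mat 1" "B ** (mat 1 + A) = mat 1"
    using one_plus_skew_inverse[OF A] by blast
  have "(mat 1 + A) ** (mat 1 - A) = (mat 1 - A) ** (mat 1 + A)" by (simp add: matrix_ring)
  then have "(mat 1 - A) ** B = B ** (mat 1 - A)"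
    by (metis B matrix_mul_assoc matrix_mul_lid matrix_mul_rid)
  with B cayley_eq[OF B] show ?thesis using that by metis
qed

lemma orthogonal_cayley:
  fixes A :: "real^'n^'n"
  assumes A: "transpose A = - A"
  shows "orthogonal_matrix (cayley A)" "det (cayley A) = 1"
proof -
  obtain B where B: "(mat 1 + A) ** B = mat 1" "B ** (mat 1 + A) = mat 1"
    "cayley A = (mat 1 - A) ** B" "cayley A = B ** (mat 1 - A)" using cayley_inverse[OF A] .
  have T1: "transpose (mat 1 - A) = mat 1 + A" by (simp add: transpose_ring A)
  have T2: "transpose (mat 1 + A) = mat 1 - A" by (simp add: transpose_ring A)
  have TB: "transpose B ** (mat 1 - A) = mat 1" "(mat 1 - A) ** transpose B = mat 1"
    using B(1,2) by (metis T2 matrix_transpose_mul transpose_mat)+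
  have "transpose (cayley A) = transpose B ** (mat 1 + A)"
    by (simp add: B(3) matrix_transpose_mul T1)
  then have "transpose (cayley A) ** cayley A = transpose B ** ((mat 1 + A) ** B) ** (mat 1 - A)"
    by (simp add: B(4) matrix_mul_assoc)
  then show "orthogonal_matrix (cayley A)" by (simp add: orthogonal_matrix B TB)
  have "det (mat 1 - A) = det (mat 1 + A)" using T1 by (metis det_transpose)
  then have "det (cayley A) = det ((mat 1 + A) ** B)" by (simp add: B(3) det_mul)
  then show "det (cayley A) = 1" by (simp add: B)
qed

lemma cayley_kernel:
  fixes A Y :: "real^'n^'n"
  assumes A: "transpose A = - A" and Y: "A ** Y = 0"
  shows "cayley A ** Y = Y"
proof -
  obtain B where B: "(mat 1 + A) ** B = mat 1" "B ** (mat 1 + A) = mat 1"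
    "cayley A = (mat 1 - A) ** B" "cayley A = B ** (mat 1 - A)" using cayley_inverse[OF A] .
  have "(mat 1 - A) ** Y = (mat 1 + A) ** Y" by (simp add: matrix_ring Y)
  then have "cayley A ** Y = B ** ((mat 1 + A) ** Y)" by (simp add: B(4) flip: matrix_mul_assoc)
  then show ?thesis by (simp add: matrix_mul_assoc B)
qed

lemma cayley_no_eigenvalue_minus_one:
  fixes A :: "real^'n^'n"
  assumes A: "transpose A = - A" and w: "cayley A *v w = - w"
  shows "w = 0"
proof -
  obtain B where B: "(mat 1 + A) ** B = mat 1" "B ** (mat 1 + A) = mat 1"
    "cayley A = (mat 1 - A) ** B" "cayley A = B ** (mat 1 - A)" using cayley_inverse[OF A] .
  have "(mat 1 + A) *v (cayley A *v w) = (mat 1 - A) *v w"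
    by (simp add: B(4) matrix_vector_mul_assoc) (simp add: matrix_mul_assoc B)
  then have "(mat 1 - A) *v w = - ((mat 1 + A) *v w)"
    unfolding w by (simp add: linear_neg[OF matrix_vector_mul_linear])
  then have "w + w = 0"
    by (simp add: matrix_vector_mult_diff_rdistrib matrix_vector_mult_add_rdistrib algebra_simps)
  then have "2 *\<^sub>R w = 0" by (simp only: scaleR_2)
  then show ?thesis by simp
qed

text \<open>Presents \<open>A\<close> as the solution of a linear system whose coefficients are
  polynomial in its Cayley transform, ready for Cramer's rule.\<close>

lemma one_plus_cayley:
  fixes A :: "real^'n^'n"
  assumes A: "transpose A = - A"
  shows "(mat 1 + cayley A) ** A = mat 1 - cayley A" "det (mat 1 + cayley A) \<noteq> 0"
proof -
  obtain B where B: "(mat 1 + A) ** B = mat 1" "B ** (mat 1 + A) = mat 1"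
    "cayley A = (mat 1 - A) ** B" "cayley A = B ** (mat 1 - A)" using cayley_inverse[OF A] .
  have "cayley A ** (mat 1 + A) = mat 1 - A" by (simp add: B(3) B(2) flip: matrix_mul_assoc)
  then have "cayley A + cayley A ** A = mat 1 - A" by (simp add: matrix_ring)
  then have CA: "cayley A ** A = mat 1 - A - cayley A" by (metis add_diff_cancel_left')
  show "(mat 1 + cayley A) ** A = mat 1 - cayley A" by (simp add: matrix_add_rdistrib CA)
  have "(mat 1 + cayley A) ** (mat 1 + A) = 2 *\<^sub>R mat 1"
    unfolding matrix_add_ldistrib matrix_add_rdistrib CA by (simp add: scaleR_2)
  then have "det (mat 1 + cayley A) * det (mat 1 + A) = det (2 *\<^sub>R mat 1 :: real^'n^'n)"
    by (simp flip: det_mul)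
  also have "\<dots> \<noteq> 0"
    by (subst det_diagonal) (auto simp: mat_def)
  finally show "det (mat 1 + cayley A) \<noteq> 0" by auto
qed

text \<open>
  \<open>J\<close>, \<open>B\<close> and \<open>F\<close> have \<open>k - k'\<close>, \<open>2k'\<close> and \<open>n - k - k'\<close> elements. The parameters are indexed by
  \<open>J \<times> - J\<close> (the \<open>-1\<close>-eigenspace is the image of the coordinate subspace \<open>J\<close> under \<open>tilt\<close>), by the orientation
  \<open>T\<close> of the complete graph on \<open>B\<close> (entries of a skew form on \<open>B\<close>, based at the perfect matching \<open>\<sigma>\<close>), and by
  \<open>B \<times> F\<close> (the shear that moves the kernel of this form away from the coordinate subspace \<open>J \<union> F\<close>).
\<close>
locale Phi_chart =
  fixes J B F :: "'n::finite set" and T :: "('n \<times> 'n) set" and \<sigma> :: "'n \<Rightarrow> 'n"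
  assumes cover: "J \<union> B \<union> F = UNIV" and disj: "J \<inter> B = {}" "J \<inter> F = {}" "B \<inter> F = {}"
    and T: "T \<subseteq> B \<times> B" "\<And>i j. i \<in> B \<Longrightarrow> j \<in> B \<Longrightarrow> i \<noteq> j \<Longrightarrow> (i, j) \<in> T \<or> (j, i) \<in> T"
      "\<And>i j. (i, j) \<in> T \<Longrightarrow> (j, i) \<notin> T"
    and \<sigma>: "\<And>i. i \<in> B \<Longrightarrow> \<sigma> i \<in> B" "\<And>i. i \<in> B \<Longrightarrow> \<sigma> i \<noteq> i" "\<And>i. i \<in> B \<Longrightarrow> \<sigma> (\<sigma> i) = i"
begin

text \<open>The offset 1 on the pairs matched by \<open>\<sigma>\<close> makes the form at parameter
  0 nondegenerate on \<open>B\<close>. The parameters of the shear are thus visible while all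
  parameters in \<open>T\<close> are still zero.\<close>

definition form :: "('n \<times> 'n \<Rightarrow> real) \<Rightarrow> real^'n^'n" where
  "form t = (\<chi> i j. if (i, j) \<in> T then t (i, j) + (if j = \<sigma> i then 1 else 0)
     else if (j, i) \<in> T then - (t (j, i) + (if i = \<sigma> j then 1 else 0)) else 0)"

definition shear :: "('n \<times> 'n \<Rightarrow> real) \<Rightarrow> real^'n^'n" where
  "shear t = (\<chi> i j. if i \<in> B \<and> j \<in> F then t (i, j) else if i = j then 1 else 0)"

definition tilt :: "('n \<times> 'n \<Rightarrow> real) \<Rightarrow> real^'n^'n" where
  "tilt t = mat 1 + skew J (- J) t"

text \<open>The adjugate replaces the inverse of \<open>tilt\<close>, so that \<open>generator\<close> is polynomial in the parameters.\<close>
definition generator :: "('n \<times> 'n \<Rightarrow> real) \<Rightarrow> real^'n^'n" where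
  "generator t = transpose (shear t ** adjugate (tilt t)) ** form t ** (shear t ** adjugate (tilt t))"

definition reflector :: "('n \<times> 'n \<Rightarrow> real) \<Rightarrow> real^'n^'n" where
  "reflector t = signs J ** cayley (skew J (- J) t)"

text \<open>\<open>reflector t\<close> is 2P - I for the projection P onto the tilted subspace; the
  sign turns it into I - 2P, which is -1 there.\<close>

definition chart :: "('n \<times> 'n \<Rightarrow> real) \<Rightarrow> real^'n^'n" where
  "chart t = - (cayley (generator t) ** reflector t)"

lemma transpose_form: "transpose (form t) = - form t"
  using T(3) by (auto simp: form_def transpose_def vec_eq_iff)

lemma transpose_generator: "transpose (generator t) = - generator t"
  by (simp add: generator_def matrix_transpose_mul transpose_form matrix_minus_left matrix_minus_right
      matrix_mul_assoc)

lemma form_column: "j \<notin> B \<Longrightarrow> form t $ i $ j = 0"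
  using T(1) by (auto simp: form_def)

lemma transpose_skew_J: "transpose (skew J (- J) t) = - skew J (- J) t"
  by (rule transpose_skew) auto

lemma tilt_inverse:
  obtains H where "tilt t ** H = mat 1" "H ** tilt t = mat 1" "adjugate (tilt t) = det (tilt t) *\<^sub>R H"
    "det (tilt t) \<noteq> 0"
proof -
  obtain H where H: "tilt t ** H = mat 1" "H ** tilt t = mat 1"
    using one_plus_skew_inverse[OF transpose_skew_J] unfolding tilt_def by blast
  moreover have "det (tilt t) \<noteq> 0" using H det_nonzero_iff_inverse by blast
  ultimately show ?thesis using inverse_eq_adjugate[OF H(1)] that by metis
qed

lemma signs_skew: "signs J ** skew J (- J) t = - (skew J (- J) t ** signs J)"
  by (simp add: vec_eq_iff mult_signs signs_mult) (simp add: skew_def)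

text \<open>\<open>signs J\<close> anticommutes with the skew part, so moving it across turns I
  minus the skew part into \<open>tilt t\<close>.\<close>

lemma reflector_eq:
  assumes H: "tilt t ** H = mat 1" "H ** tilt t = mat 1"
  shows "reflector t = tilt t ** signs J ** H"
proof -
  have "reflector t = signs J ** ((mat 1 - skew J (- J) t) ** H)"
    using H unfolding reflector_def tilt_def by (subst cayley_eq[of _ H]) auto
  also have "\<dots> = tilt t ** signs J ** H"
    by (simp add: matrix_mul_assoc tilt_def matrix_ring signs_skew)
  finally show ?thesis .
qed

lemma chart_orthogonal: "reflector t \<in> Gr (card J)" "orthogonal_matrix (chart t)"
proof -
  obtain H where H: "tilt t ** H = mat 1" "H ** tilt t = mat 1" using tilt_inverse by blast
  let ?K = "skew J (- J) t"
  have "transpose (signs J) ** signs J = mat 1" by (simp add: transpose_signs signs_signs)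
  then have o: "orthogonal_matrix (reflector t)"
    unfolding reflector_def
    by (intro orthogonal_matrix_mul orthogonal_cayley transpose_skew_J) (simp add: orthogonal_matrix)
  have "reflector t ** reflector t = tilt t ** signs J ** (H ** tilt t) ** signs J ** H"
    unfolding reflector_eq[OF H] by (simp only: matrix_mul_assoc)
  also have "\<dots> = tilt t ** (signs J ** signs J) ** H" by (simp only: H matrix_mul_rid matrix_mul_assoc)
  also have "\<dots> = mat 1" by (simp add: signs_signs H)
  finally have sq: "reflector t ** reflector t = mat 1" .
  have "trace (reflector t) = trace (H ** (tilt t ** signs J))"
    unfolding reflector_eq[OF H] by (rule trace_mul_sym)
  also have "\<dots> = trace (signs J :: real^'n^'n)" by (simp add: matrix_mul_assoc H)
  also have "\<dots> = (\<Sum>i\<in>UNIV. 2 * (if i \<in> J then 1 else 0) - 1)"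
    unfolding trace_def signs_def by (intro sum.cong) auto
  also have "\<dots> = 2 * real (card J) - real CARD('n)"
    by (simp add: sum_subtractf sum.If_cases flip: sum_distrib_left)
  finally show "reflector t \<in> Gr (card J)" using o sq by (simp add: Gr_def O_group_def)
  have "orthogonal_matrix (cayley (generator t) ** reflector t)"
    by (intro orthogonal_matrix_mul orthogonal_cayley transpose_generator o)
  then show "orthogonal_matrix (chart t)"
    by (simp add: chart_def orthogonal_matrix transpose_ring matrix_minus_left matrix_minus_right)
qed

text \<open>Columns of \<open>form t\<close> outside \<open>B\<close> are zero, so only the rows in
  \<open>B\<close> of its right factor matter.\<close>

lemma generator_kernel:
  assumes "\<And>i j. i \<in> B \<Longrightarrow> (shear t ** adjugate (tilt t) ** Y) $ i $ j = 0"
  shows "generator t ** Y = 0"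
proof -
  have "(form t ** (shear t ** adjugate (tilt t) ** Y)) $ i $ j = 0" for i j
    unfolding matrix_matrix_mult_def[of "form t"]
    using assms form_column by (simp, intro sum.neutral) (metis mult_eq_0_iff)
  then have "form t ** (shear t ** adjugate (tilt t) ** Y) = 0" by (simp add: vec_eq_iff)
  moreover have "generator t ** Y = transpose (shear t ** adjugate (tilt t)) **
      (form t ** (shear t ** adjugate (tilt t) ** Y))"
    by (simp only: generator_def matrix_mul_assoc)
  ultimately show ?thesis by (simp add: matrix_zero_right)
qed

text \<open>\<open>mat 1 + reflector t\<close> is twice the projection onto the tilted subspace.
  Undoing the tilt brings its range back into the coordinates \<open>J\<close>, and the shear
  carries nothing from \<open>J\<close> into \<open>B\<close>.\<close>

lemma generator_reflector_kernel: "generator t ** (mat 1 + reflector t) = 0"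
proof (rule generator_kernel)
  fix i j assume i: "i \<in> B"
  obtain H where H: "tilt t ** H = mat 1" "H ** tilt t = mat 1" "adjugate (tilt t) = det (tilt t) *\<^sub>R H"
    using tilt_inverse by blast
  have "H ** (mat 1 + reflector t) = H + (H ** tilt t) ** signs J ** H"
    unfolding reflector_eq[OF H(1,2)] by (simp only: matrix_add_ldistrib matrix_mul_rid matrix_mul_assoc)
  also have "\<dots> = (mat 1 + signs J) ** H" by (simp add: H matrix_ring)
  finally have HR: "H ** (mat 1 + reflector t) = (mat 1 + signs J) ** H" .
  have "(shear t ** (mat 1 + signs J)) $ i $ l = 0" for l
  proof -
    have eq: "(mat 1 + signs J :: real^'n^'n) $ r $ l = (if r = l \<and> l \<in> J then 2 else 0)" for r
      by (simp add: mat_def signs_def)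
    have "(shear t ** (mat 1 + signs J)) $ i $ l = (\<Sum>r\<in>UNIV. if r = l then (if l \<in> J then shear t $ i $ r * 2 else 0) else 0)"
      unfolding matrix_matrix_mult_def vec_lambda_beta eq by (intro sum.cong) auto
    also have "\<dots> = (if l \<in> J then shear t $ i $ l * 2 else 0)" by simp
    also have "\<dots> = 0" using i disj by (auto simp: shear_def)
    finally show ?thesis .
  qed
  then have "(shear t ** (mat 1 + signs J) ** H) $ i $ j = 0"
    unfolding matrix_matrix_mult_def[of _ H] by simp
  moreover have "shear t ** adjugate (tilt t) ** (mat 1 + reflector t)
      = det (tilt t) *\<^sub>R (shear t ** (mat 1 + signs J) ** H)"
    by (simp add: H(3) matrix_scaleR_left matrix_scaleR_right HR flip: matrix_mul_assoc)
  ultimately show "(shear t ** adjugate (tilt t) ** (mat 1 + reflector t)) $ i $ j = 0" by simp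
qed

text \<open>The criterion of \<open>orthogonal_factorization\<close> applies: the chart is -1 on the
  tilted subspace, and 1 on the vectors orthogonal to it that lie in the kernel of the
  generator.\<close>

lemma chart_in_Phi:
  assumes l: "card B = 2 * l"
  shows "chart t \<in> Phi (card J + l) l"
proof -
  obtain P where P: "proj P" "trace P = real (card J)" "reflector t = P + P - mat 1"
    using chart_orthogonal(1) Gr_iff by blast
  have n: "CARD('n) = card J + card F + 2 * l"
  proof -
    have "CARD('n) = card (J \<union> B \<union> F)" using cover by simp
    also have "\<dots> = card J + card B + card F"
      using disj by (simp add: card_Un_disjoint Int_Un_distrib2)
    finally show ?thesis using l by simp
  qed
  have AP: "generator t ** P = 0"
  proof -
    have "generator t ** (2 *\<^sub>R P) = 0"
      using generator_reflector_kernel[of t] unfolding P(3) by (simp add: scaleR_2)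
    then show ?thesis by (simp add: matrix_scaleR_right)
  qed
  note cP = cayley_kernel[OF transpose_generator AP]
  have MP: "chart t ** P = - P"
  proof -
    have "reflector t ** P = P" using projD(2)[OF P(1)] by (simp add: P(3) matrix_ring matrix_numeral)
    then show ?thesis by (simp add: chart_def matrix_minus_left cP flip: matrix_mul_assoc)
  qed
  have P': "proj (mat 1 - P)" by (rule proj_diff[OF proj_one P(1)]) simp
  \<comment> \<open>These are the rows of \<open>shear t ** adjugate (tilt t)\<close> with index in
    \<open>B\<close>: at most \<open>2 * l\<close> linear conditions that put a vector into the
    kernel of the generator, which leaves room for \<open>card F\<close> dimensions.\<close>
  define W where "W = (\<lambda>i. transpose (shear t ** adjugate (tilt t)) *v axis i 1) ` B"
  have "card W \<le> 2 * l" unfolding W_def using card_image_le[of B] l by (metis finite)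
  moreover have "trace (mat 1 - P) = real (card F + 2 * l)" by (simp add: trace_ring P(2) n)
  moreover have "finite W" by (simp add: W_def)
  ultimately obtain R where R: "proj R" "(mat 1 - P) ** R = R" "trace R = real (card F)" "\<forall>w\<in>W. R *v w = 0"
    using proj_subspace_avoiding_le[OF P'] by blast
  have PR: "P ** R = 0" using R(2) by (simp add: matrix_ring)
  have "generator t ** R = 0"
  proof (rule generator_kernel)
    fix i j assume "i \<in> B"
    let ?Y = "shear t ** adjugate (tilt t)"
    have "R *v (transpose ?Y *v axis i 1) = 0" using R(4) \<open>i \<in> B\<close> by (auto simp: W_def)
    then have "transpose (?Y ** R) *v axis i 1 = 0"
      using projD(1)[OF R(1)] by (simp add: matrix_transpose_mul matrix_vector_mul_assoc del: transpose_matrix_vector)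
    then show "(?Y ** R) $ i $ j = 0"
      by (simp add: matrix_vector_mult_basis column_def vec_eq_iff transpose_def del: transpose_matrix_vector)
  qed
  note cR = cayley_kernel[OF transpose_generator this]
  have MR: "chart t ** R = R"
  proof -
    have "reflector t ** R = - R" by (simp add: P(3) matrix_ring matrix_numeral PR)
    then show ?thesis by (simp add: chart_def matrix_minus_left matrix_minus_right cR flip: matrix_mul_assoc)
  qed
  have det: "det (chart t) = (-1) ^ card J"
  proof -
    have "chart t = cayley (generator t) ** ((mat 1 - P) + (mat 1 - P) - mat 1)"
      by (simp add: chart_def P(3) flip: matrix_minus_right)
    moreover have "trace (mat 1 - P) = real (card F + 2 * l)" by (simp add: trace_ring P(2) n)
    ultimately have "det (chart t) = (-1) ^ (CARD('n) + (card F + 2 * l))"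
      by (simp only: det_mul orthogonal_cayley(2)[OF transpose_generator] det_reflection[OF P'] mult_1)
    moreover have "even (CARD('n) + (card F + 2 * l)) \<longleftrightarrow> even (card J)" using n by simp
    ultimately show ?thesis by (simp add: minus_one_power_iff)
  qed
  from orthogonal_factorization[OF chart_orthogonal(2) P(1,2) MP R(1,3) MR PR n det, of 0]
  show ?thesis by (auto simp: Phi_def)
qed

lemma chart_rational:
  assumes A: "J \<times> - J \<union> T \<union> B \<times> F \<subseteq> A"
  shows "rational_chart A (\<lambda>t. det (tilt t) * det (mat 1 + generator t)) chart"
proof (rule rational_chart_matrix)
  have K: "matrix_poly A (\<lambda>t. skew J (- J) t)"
    using matrix_poly_skew[of J "- J" "\<lambda>x. x" A] A by auto
  have tilt: "matrix_poly A tilt"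
    unfolding tilt_def by (intro matrix_poly_add matrix_poly_const K)
  have form: "matrix_poly A form"
    unfolding matrix_poly_def form_def vec_lambda_beta using A
    by (intro allI coord_poly_if coord_poly_uminus coord_poly_add coord_poly_var coord_poly_const) auto
  have shear: "matrix_poly A shear"
    unfolding matrix_poly_def shear_def vec_lambda_beta using A
    by (intro allI coord_poly_if coord_poly_var coord_poly_const) auto
  have gen: "matrix_poly A generator"
    unfolding generator_def
    by (intro matrix_poly_mult matrix_poly_transpose matrix_poly_adjugate tilt form shear)
  show "coord_poly A (\<lambda>t. det (tilt t) * det (mat 1 + generator t))"
    by (intro coord_poly_mult coord_poly_det matrix_poly_add matrix_poly_const gen tilt)
  show "matrix_poly A (\<lambda>t. 0 - ((mat 1 - generator t) ** adjugate (mat 1 + generator t)) **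
      (signs J ** ((mat 1 - skew J (- J) t) ** adjugate (tilt t))))"
    by (intro matrix_poly_mult matrix_poly_diff matrix_poly_add matrix_poly_const matrix_poly_adjugate gen tilt K)
  fix t assume "det (tilt t) * det (mat 1 + generator t) \<noteq> 0"
  then have d: "det (mat 1 + skew J (- J) t) \<noteq> 0" "det (mat 1 + generator t) \<noteq> 0" by (auto simp: tilt_def)
  show "chart t = (1 / (det (tilt t) * det (mat 1 + generator t))) *\<^sub>R
      (0 - ((mat 1 - generator t) ** adjugate (mat 1 + generator t)) **
      (signs J ** ((mat 1 - skew J (- J) t) ** adjugate (tilt t))))"
    unfolding chart_def reflector_def det_cayley_scaleR[OF d(1)] det_cayley_scaleR[OF d(2)] tilt_def
    by (simp add: matrix_scaleR_left matrix_scaleR_right)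
qed

lemma chart_denominator: "det (tilt t) * det (mat 1 + generator t) \<noteq> 0"
proof -
  have "det (tilt t) \<noteq> 0" using tilt_inverse by blast
  moreover have "det (mat 1 + generator t) \<noteq> 0"
    using one_plus_skew_inverse[OF transpose_generator] det_nonzero_iff_inverse by blast
  ultimately show ?thesis by simp
qed

section \<open>Recovering the parameters from the matrix\<close>

definition row_mix :: "real^'n^'n \<Rightarrow> real^'n^'n" where
  "row_mix M = (\<chi> i j. if i \<in> J then mat 1 $ i $ j else (M + mat 1) $ i $ j)"

lemma row_mix_vec: "(row_mix M *v x) $ i = (if i \<in> J then x $ i else (M *v x + x) $ i)"
proof -
  have "(row_mix M *v x) $ i = (if i \<in> J then (mat 1 *v x) $ i else ((M + mat 1) *v x) $ i)"
    by (simp add: row_mix_def matrix_vector_mult_def)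
  then show ?thesis by (simp add: matrix_vector_mult_add_rdistrib)
qed

text \<open>Let M be \<open>chart t\<close>. A kernel vector z is orthogonal to M z + z, because in
  each coordinate one of the two is zero; as M is an isometry, M z = - z. So z is the image under
  the tilt of some u supported on \<open>J\<close>; on \<open>J\<close> the two have the same
  coordinates, and those of z are zero.\<close>

lemma det_row_mix_chart: "det (row_mix (chart t)) \<noteq> 0"
proof -
  let ?M = "chart t"
  obtain P where P: "proj P" "reflector t = P + P - mat 1"
    using chart_orthogonal(1) Gr_iff by blast
  obtain H where H: "tilt t ** H = mat 1" "H ** tilt t = mat 1" using tilt_inverse by blast
  have "z = 0" if z: "row_mix ?M *v z = 0" for z
  proof -
    have zJ: "z $ i = 0" if "i \<in> J" for i using row_mix_vec[of ?M z i] z that by simp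
    have zM: "(?M *v z + z) $ i = 0" if "i \<notin> J" for i using row_mix_vec[of ?M z i] z that by simp
    have zz: "z \<bullet> (?M *v z + z) = 0"
      unfolding inner_vec_def by (intro sum.neutral ballI) (metis inner_zero_left inner_zero_right zJ zM)
    have "(?M *v z) \<bullet> (?M *v z) = z \<bullet> z"
      using orthogonal_matrix_vec(1)[OF chart_orthogonal(2), of t z]
      by (metis dot_lmul_matrix inner_commute transpose_matrix_vector)
    then have "(?M *v z + z) \<bullet> (?M *v z + z) = 0"
      using zz by (simp add: inner_add_left inner_add_right inner_commute)
    then have "?M *v z = - z" by (simp add: add_eq_0_iff2)
    then have Cz: "cayley (generator t) *v (reflector t *v z) = z"
      by (simp add: chart_def uminus_matrix_vec flip: matrix_vector_mul_assoc)
    have "generator t ** (2 *\<^sub>R P) = 0"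
      using generator_reflector_kernel[of t] unfolding P(2) by (simp add: scaleR_2)
    then have "generator t ** P = 0" by (simp add: matrix_scaleR_right)
    note cP = cayley_kernel[OF transpose_generator this]
    let ?C = "cayley (generator t)"
    have CP: "?C *v (P *v z) = P *v z" by (simp add: matrix_vector_mul_assoc cP)
    have "?C *v (z - P *v z) = - (z - P *v z)"
    proof -
      have "z - P *v z = P *v z - reflector t *v z"
        by (simp add: P(2) matrix_vector_mult_diff_rdistrib matrix_vector_mult_add_rdistrib matrix_numeral)
      then have "?C *v (z - P *v z) = P *v z - z"
        by (simp only: matrix_vector_mult_diff_distrib CP Cz)
      then show ?thesis by simp
    qed
    from cayley_no_eigenvalue_minus_one[OF transpose_generator this] have "P *v z = z" by simp
    then have Rz: "reflector t *v z = z"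
      by (simp add: P(2) matrix_vector_mult_diff_rdistrib matrix_vector_mult_add_rdistrib matrix_numeral)
    define u where "u = H *v z"
    have zu: "z = tilt t *v u" by (simp add: u_def matrix_vector_mul_assoc H)
    have "signs J *v u = H *v (tilt t ** signs J ** H *v z)"
      by (simp add: u_def matrix_vector_mul_assoc matrix_mul_assoc H)
    also have "\<dots> = u" using Rz by (simp add: reflector_eq[OF H] u_def)
    finally have u0: "u $ i = 0" if "i \<notin> J" for i
      using that signs_vec[of J u i] by simp
    have "z $ i = u $ i" if "i \<in> J" for i
    proof -
      have "(skew J (- J) t *v u) $ i = (\<Sum>j\<in>UNIV. skew J (- J) t $ i $ j * u $ j)"
        by (simp add: matrix_vector_mult_def)
      also have "\<dots> = 0"
        using that u0 by (intro sum.neutral ballI) (auto simp: skew_def)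
      finally show ?thesis by (simp add: zu tilt_def matrix_vector_mult_add_rdistrib)
    qed
    with zJ u0 have "u = 0" by (metis vec_eq_iff zero_index)
    then show "z = 0" by (simp add: zu)
  qed
  then show ?thesis using inverse_exists det_nonzero_iff_inverse by blast
qed

text \<open>A Cramer numerator for the system with matrix \<open>row_mix M\<close> and right-hand
  side \<open>axis b 1\<close>, which asks for a vector of the -1-eigenspace with given
  \<open>J\<close>-coordinates. For \<open>chart t\<close> and \<open>b\<close> in \<open>J\<close>
  the solution is column \<open>b\<close> of \<open>tilt t\<close>, whose entry at \<open>a\<close>
  outside \<open>J\<close> is \<open>- t (b, a)\<close>.\<close>

definition tilt_coord :: "'n \<Rightarrow> 'n \<Rightarrow> real^'n^'n \<Rightarrow> real" where
  "tilt_coord b a M = det (\<chi> i j. if j = a then axis b 1 $ i else row_mix M $ i $ j)"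

lemma tilt_coord_poly: "real_polynomial_function (tilt_coord b a)"
  unfolding tilt_coord_def row_mix_def
  by (intro real_polynomial_function_det)
    (auto intro!: real_polynomial_function_if real_polynomial_function.intros(2,3) real_polynomial_function_entry)

lemma tilt_coord_chart:
  assumes "b \<in> J" "a \<notin> J"
  shows "tilt_coord b a (chart t) = - t (b, a) * det (row_mix (chart t))"
proof -
  obtain P where P: "proj P" "reflector t = P + P - mat 1"
    using chart_orthogonal(1) Gr_iff by blast
  obtain H where H: "tilt t ** H = mat 1" "H ** tilt t = mat 1" using tilt_inverse by blast
  define g where "g = tilt t *v axis b 1"
  have gi: "g $ i = tilt t $ i $ b" for i
    by (simp add: g_def matrix_vector_mult_basis column_def)
  have ga: "g $ a = - t (b, a)"
    using assms by (auto simp: gi tilt_def skew_def mat_def)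
  have gJ: "g $ i = axis b 1 $ i" if "i \<in> J" for i
    using assms that by (auto simp: gi tilt_def skew_def mat_def axis_def)
  have "reflector t *v g = tilt t *v (signs J *v ((H ** tilt t) *v axis b 1))"
    by (simp only: reflector_eq[OF H] g_def matrix_vector_mul_assoc matrix_mul_assoc)
  also have "signs J *v ((H ** tilt t) *v axis b 1) = axis b 1"
    using assms by (auto simp: H vec_eq_iff signs_vec axis_def)
  finally have Rg: "reflector t *v g = g" by (simp add: g_def)
  have "generator t *v (g + g) = 0"
    using arg_cong[OF generator_reflector_kernel[of t], of "\<lambda>Y. Y *v g"] Rg
    by (simp add: matrix_vector_mult_add_rdistrib flip: matrix_vector_mul_assoc)
  then have "generator t *v g = 0"
    by (metis matrix_vector_mult_scaleR scaleR_2 scaleR_eq_0_iff zero_neq_numeral)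
  \<comment> \<open>\<open>outer g g\<close> turns the vector into a square matrix, the form in
    which \<open>cayley_kernel\<close> is stated.\<close>
  then have "generator t ** outer g g = 0" by (simp add: mult_outer outer_linear)
  from cayley_kernel[OF transpose_generator this] have Cg: "outer (cayley (generator t) *v g) g = outer g g"
    by (simp add: mult_outer)
  have "cayley (generator t) *v g = g"
  proof (cases "g = 0")
    case False
    have "outer (cayley (generator t) *v g) g *v g = outer g g *v g" by (simp only: Cg)
    with False show ?thesis by (simp add: outer_vec)
  qed simp
  then have Mg: "chart t *v g = - g"
    using Rg by (simp add: chart_def uminus_matrix_vec flip: matrix_vector_mul_assoc)
  have Ng: "row_mix (chart t) *v g = axis b 1"
    using assms by (auto simp: vec_eq_iff row_mix_vec gJ Mg axis_def)
  show ?thesis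
    using cramer_lemma[of a "row_mix (chart t)" g] unfolding Ng by (simp add: tilt_coord_def ga)
qed

text \<open>While the tilt is trivial, \<open>- M ** signs J\<close> for M = \<open>chart t\<close>
  is the Cayley transform of the generator, and this is the Cramer numerator of entry
  \<open>(i, j)\<close> in the system of \<open>one_plus_cayley\<close>;
  \<open>generator_denom\<close> is the determinant of that system.\<close>

definition generator_coord :: "'n \<Rightarrow> 'n \<Rightarrow> real^'n^'n \<Rightarrow> real" where
  "generator_coord i j M = det (\<chi> r s. if s = i then (mat 1 + M ** signs J) $ r $ j
     else (mat 1 - M ** signs J) $ r $ s)"

definition generator_denom :: "real^'n^'n \<Rightarrow> real" where
  "generator_denom M = det (mat 1 - M ** signs J)"

lemma real_polynomial_function_mult_signs:
  "real_polynomial_function (\<lambda>M :: real^'n^'n. (M ** signs J) $ r $ s)"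
  unfolding mult_signs
  by (intro real_polynomial_function_if real_polynomial_function_entry real_polynomial_function_minus)

lemma generator_coord_poly: "real_polynomial_function (generator_coord i j)"
  and generator_denom_poly: "real_polynomial_function generator_denom"
  unfolding generator_coord_def generator_denom_def
  by (intro real_polynomial_function_det;
      auto intro!: real_polynomial_function_if real_polynomial_function.intros(2,3)
        real_polynomial_function_diff real_polynomial_function_mult_signs)+

lemma generator_coord_chart:
  assumes t: "\<And>b a. b \<in> J \<Longrightarrow> a \<notin> J \<Longrightarrow> t (b, a) = 0"
  shows "generator_coord i j (chart t) = generator t $ i $ j * generator_denom (chart t)"
    "generator_denom (chart t) \<noteq> 0" "generator t = transpose (shear t) ** form t ** shear t"
proof -
  have K: "skew J (- J) t = 0" using t by (auto simp: skew_def vec_eq_iff)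
  have c0: "cayley 0 = (mat 1 :: real^'n^'n)"
    by (subst cayley_eq[of _ "mat 1"]) auto
  have "chart t = - (cayley (generator t) ** signs J)"
    by (simp add: chart_def reflector_def K c0)
  then have MD: "chart t ** signs J = - cayley (generator t)"
    by (simp add: matrix_minus_left signs_signs flip: matrix_mul_assoc)
  have "adjugate (mat 1) = (mat 1 :: real^'n^'n)"
    by (metis inverse_eq_adjugate det_I matrix_mul_lid scaleR_one)
  then show "generator t = transpose (shear t) ** form t ** shear t"
    by (simp add: generator_def tilt_def K)
  note 1 = one_plus_cayley[OF transpose_generator[of t]]
  show "generator_denom (chart t) \<noteq> 0" using 1(2) by (simp add: generator_denom_def MD)
  have e: "(mat 1 + cayley (generator t)) *v (generator t *v axis j 1) = column j (mat 1 - cayley (generator t))"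
  proof -
    have "(mat 1 + cayley (generator t)) *v (generator t *v axis j 1)
        = ((mat 1 + cayley (generator t)) ** generator t) *v axis j 1"
      by (rule matrix_vector_mul_assoc)
    then show ?thesis unfolding 1(1) by (simp only: matrix_vector_mult_basis)
  qed
  show "generator_coord i j (chart t) = generator t $ i $ j * generator_denom (chart t)"
    using cramer_lemma[of i "mat 1 + cayley (generator t)" "generator t *v axis j 1"]
    unfolding e generator_coord_def generator_denom_def MD column_def vec_lambda_beta
      add_uminus_conv_diff diff_minus_eq_add
    by (simp add: matrix_vector_mult_basis column_def)
qed

text \<open>For \<open>i\<close> in \<open>B\<close> the row \<open>i\<close> of
  \<open>transpose (shear t)\<close> is a unit row, so only the shear on the right acts: it leaves
  the columns in \<open>B\<close> alone and mixes them into the columns in \<open>F\<close>.\<close>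

lemma generator_entries:
  assumes t: "\<And>b a. b \<in> J \<Longrightarrow> a \<notin> J \<Longrightarrow> t (b, a) = 0" and i: "i \<in> B"
  shows "j \<in> B \<Longrightarrow> generator t $ i $ j = form t $ i $ j"
    "j \<in> F \<Longrightarrow> generator t $ i $ j = (\<Sum>r\<in>B. form t $ i $ r * t (r, j))"
proof -
  have row: "(transpose (shear t) ** Y) $ i $ s = Y $ i $ s" for Y :: "real^'n^'n" and s
  proof -
    have "(transpose (shear t) ** Y) $ i $ s = (\<Sum>r\<in>UNIV. if r = i then Y $ r $ s else 0)"
      unfolding matrix_matrix_mult_def vec_lambda_beta
      using i disj by (intro sum.cong) (auto simp: transpose_def shear_def)
    then show ?thesis by simp
  qed
  have gt: "generator t = transpose (shear t) ** form t ** shear t"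
    using generator_coord_chart(3) t by blast
  have g: "generator t $ i $ j = (\<Sum>r\<in>UNIV. form t $ i $ r * shear t $ r $ j)" for j
    unfolding gt matrix_mul_assoc[symmetric] row by (simp add: matrix_matrix_mult_def)
  show "generator t $ i $ j = form t $ i $ j" if "j \<in> B"
  proof -
    have "generator t $ i $ j = (\<Sum>r\<in>UNIV. if r = j then form t $ i $ r else 0)"
      unfolding g using that disj by (intro sum.cong) (auto simp: shear_def)
    then show ?thesis by simp
  qed
  show "generator t $ i $ j = (\<Sum>r\<in>B. form t $ i $ r * t (r, j))" if "j \<in> F"
    unfolding g using that disj form_column
    by (intro sum.mono_neutral_cong_right) (auto simp: shear_def)
qed

end

context Phi_chart
begin

text \<open>With all parameters in \<open>T\<close> zero, the form is a signed permutation matrix on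
  \<open>B\<close>. Row \<open>\<sigma> i\<close> then picks the one term with \<open>r = i\<close>
  from the sum in \<open>generator_entries\<close>.\<close>

lemma form_pairing:
  assumes t: "\<And>x. x \<in> T \<Longrightarrow> t x = 0" and i: "i \<in> B" and r: "r \<in> B"
  shows "form t $ \<sigma> i $ r = (if r = i then form t $ \<sigma> i $ i else 0)" "form t $ \<sigma> i $ i \<noteq> 0"
proof -
  show "form t $ \<sigma> i $ r = (if r = i then form t $ \<sigma> i $ i else 0)"
  proof (cases "r = i")
    case False
    then have "\<sigma> i \<noteq> \<sigma> r" using \<sigma>(3) i r by metis
    with False show ?thesis by (auto simp: form_def t \<sigma>(3)[OF i])
  qed simp
  have "(\<sigma> i, i) \<in> T \<or> (i, \<sigma> i) \<in> T" using T(2) \<sigma>(1,2) i by blast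
  then show "form t $ \<sigma> i $ i \<noteq> 0"
    using i \<sigma>(3)[of i] by (auto simp: form_def t)
qed

text \<open>
  The parameters of the shear are switched on first, then those of the skew form and finally those of the
  \<open>-1\<close>-eigenspace; in this order each can be read off from \<open>chart t\<close> by Cramer's rule.
\<close>
lemma semialg_dim_Phi_ge_chart:
  assumes l: "card B = 2 * l"
  shows "ereal (real (card B * card F + card T + card J * card (- J))) \<le> semialg_dim (Phi (card J + l) l :: (real^'n^'n) set)"
proof -
  obtain p1 p2 p3 where p: "set p1 = B \<times> F" "distinct p1" "set p2 = T" "distinct p2"
    "set p3 = J \<times> - J" "distinct p3"
    using finite_distinct_list[of "B \<times> F"] finite_distinct_list[of T] finite_distinct_list[of "J \<times> - J"]
    by (metis finite)
  define ps where "ps = p1 @ p2 @ p3"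
  have dist: "distinct ps"
    using p T(1) disj by (auto simp: ps_def)
  have "length ps = card (B \<times> F) + card T + card (J \<times> - J)"
    unfolding ps_def using p by (metis add.assoc distinct_card length_append)
  then have len: "length ps = card B * card F + card T + card J * card (- J)"
    by (simp add: card_cartesian_product)
  have "ereal (real (length ps)) \<le> semialg_dim (Phi (card J + l) l :: (real^'n^'n) set)"
  proof (rule semialg_dim_ge_chart[OF chart_rational[OF order.refl] chart_denominator chart_in_Phi[OF l]])
    fix j assume j: "j < length ps"
    define x where "x = ps ! j"
    have x: "x \<notin> set (take j ps)" "x \<in> set (take (Suc j) ps)"
      using dist j by (auto simp: x_def take_Suc_conv_app_nth in_set_conv_nth nth_eq_iff_index_eq)
    define t1 where "t1 = (\<lambda>y. if y = x then 1 else (0::real))"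
    have t1: "\<forall>i. i \<notin> set (take (Suc j) ps) \<longrightarrow> t1 i = 0" using x by (auto simp: t1_def)
    show "\<exists>y. real_polynomial_function y \<and>
      (\<forall>t. det (tilt t) * det (mat 1 + generator t) \<noteq> 0 \<longrightarrow> (\<forall>i. i \<notin> set (take j ps) \<longrightarrow> t i = 0) \<longrightarrow> y (chart t) = 0) \<and>
      (\<exists>t. det (tilt t) * det (mat 1 + generator t) \<noteq> 0 \<and> (\<forall>i. i \<notin> set (take (Suc j) ps) \<longrightarrow> t i = 0) \<and> y (chart t) \<noteq> 0)"
    proof -
      have "\<exists>y. real_polynomial_function y \<and>
        (\<forall>t. (\<forall>i. i \<notin> set (take j ps) \<longrightarrow> t i = 0) \<longrightarrow> y (chart t) = 0) \<and> y (chart t1) \<noteq> 0"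
      proof (cases "j < length p1 + length p2")
        case False
        then have "x \<in> J \<times> - J"
          using j p(5) by (auto simp: x_def ps_def nth_append simp flip: p(5))
        then obtain b a where ba: "x = (b, a)" "b \<in> J" "a \<notin> J" by auto
        \<comment> \<open>\<open>tilt_coord_chart\<close> holds for any shear and form, whereas
          \<open>generator_coord_chart\<close> needs a trivial tilt; hence the tilt parameters come
          last.\<close>
        have "tilt_coord b a (chart t) = 0" if "\<forall>i. i \<notin> set (take j ps) \<longrightarrow> t i = 0" for t
          using that[rule_format, OF x(1)] by (simp add: tilt_coord_chart[OF ba(2,3)] ba(1))
        moreover have "tilt_coord b a (chart t1) \<noteq> 0"
          by (simp add: tilt_coord_chart[OF ba(2,3)] det_row_mix_chart t1_def ba(1))
        ultimately show ?thesis using tilt_coord_poly by blast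
      next
        case True
        have sub: "set (take (Suc j) ps) \<subseteq> B \<times> F \<union> T"
          using True p set_take_subset[of "Suc j - length p1" p2] set_take_subset[of "Suc j" p1]
          by (auto simp: ps_def)
        have J0: "t (b, a) = 0" if "\<forall>i. i \<notin> set (take (Suc j) ps) \<longrightarrow> t i = 0" "b \<in> J" "a \<notin> J" for t :: "_ \<Rightarrow> real" and b a
        proof -
          have "(b, a) \<notin> B \<times> F \<union> T" using that(2) disj T(1) by auto
          with sub that(1) show ?thesis by blast
        qed
        have step: "\<forall>i. i \<notin> set (take (Suc j) ps) \<longrightarrow> t i = 0" if "\<forall>i. i \<notin> set (take j ps) \<longrightarrow> t i = 0" for t :: "_ \<Rightarrow> real"
          using that set_take_subset_set_take[of j "Suc j" ps] by auto
        show ?thesis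
        proof (cases "j < length p1")
          case True
          have "x \<in> B \<times> F" using True by (auto simp: x_def ps_def nth_append simp flip: p(1))
          then obtain i m where im: "x = (i, m)" "i \<in> B" "m \<in> F" by auto
          have sub1: "set (take (Suc j) ps) \<subseteq> B \<times> F"
            using True p set_take_subset[of "Suc j" p1] by (auto simp: ps_def)
          have T0: "t y = 0" if "\<forall>i. i \<notin> set (take (Suc j) ps) \<longrightarrow> t i = 0" "y \<in> T" for t :: "_ \<Rightarrow> real" and y
          proof -
            have "y \<notin> B \<times> F" using that(2) disj T(1) by auto
            with sub1 that(1) show ?thesis by blast
          qed
          have val: "generator t $ \<sigma> i $ m = form t $ \<sigma> i $ i * t (i, m)"
            if t: "\<forall>i. i \<notin> set (take (Suc j) ps) \<longrightarrow> t i = 0" for t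
          proof -
            have "generator t $ \<sigma> i $ m = (\<Sum>r\<in>B. form t $ \<sigma> i $ r * t (r, m))"
              using J0[OF t] \<sigma>(1)[OF im(2)] im(3) by (intro generator_entries(2)) auto
            also have "\<dots> = (\<Sum>r\<in>B. if r = i then form t $ \<sigma> i $ i * t (i, m) else 0)"
              by (intro sum.cong refl) (subst form_pairing(1)[OF T0[OF t] im(2)], auto)
            finally show ?thesis using im(2) by simp
          qed
          have "generator_coord (\<sigma> i) m (chart t) = 0" if t: "\<forall>i. i \<notin> set (take j ps) \<longrightarrow> t i = 0" for t
            using generator_coord_chart(1)[of t "\<sigma> i" m] J0[OF step[OF t]] val[OF step[OF t]] t[rule_format, OF x(1)]
            by (simp add: im(1))
          moreover have "generator_coord (\<sigma> i) m (chart t1) \<noteq> 0"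
            using generator_coord_chart(1,2)[of t1] J0[OF t1] val[OF t1] form_pairing(2)[OF T0[OF t1] im(2) im(2)]
            by (simp add: t1_def im(1))
          ultimately show ?thesis using generator_coord_poly by blast
        next
          case False
          then have "x \<in> T"
            using True by (auto simp: x_def ps_def nth_append simp flip: p(3))
          then obtain i m where im: "x = (i, m)" "(i, m) \<in> T" "i \<in> B" "m \<in> B" using T(1) by auto
          \<comment> \<open>The offset of the form at a matched pair; it is subtracted with the
            factor \<open>generator_denom\<close> that \<open>generator_coord\<close>
            carries.\<close>
          define c :: real where "c = (if m = \<sigma> i then 1 else 0)"
          define y where "y M = generator_coord i m M - c * generator_denom M" for M
          have val: "y (chart t) = t (i, m) * generator_denom (chart t)"
            if t: "\<forall>i. i \<notin> set (take (Suc j) ps) \<longrightarrow> t i = 0" for t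
          proof -
            have "generator t $ i $ m = form t $ i $ m"
              using J0[OF t] im by (intro generator_entries(1)) auto
            then have "generator t $ i $ m = t (i, m) + c" using im by (simp add: form_def c_def)
            then show ?thesis
              using generator_coord_chart(1)[of t i m] J0[OF t] by (simp add: y_def algebra_simps)
          qed
          have "y (chart t) = 0" if "\<forall>i. i \<notin> set (take j ps) \<longrightarrow> t i = 0" for t
            using val[OF step[OF that]] that[rule_format, OF x(1)] by (simp add: im(1))
          moreover have "y (chart t1) \<noteq> 0"
            using val[OF t1] generator_coord_chart(2)[of t1] J0[OF t1] by (simp add: t1_def im(1))
          moreover have "real_polynomial_function y"
            unfolding y_def
            by (intro real_polynomial_function_diff real_polynomial_function.intros(2,4)
                generator_coord_poly generator_denom_poly)
          ultimately show ?thesis by blast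
        qed
      qed
      then obtain y where "real_polynomial_function y"
        "\<forall>t. (\<forall>i. i \<notin> set (take j ps) \<longrightarrow> t i = 0) \<longrightarrow> y (chart t) = 0" "y (chart t1) \<noteq> 0" by blast
      then show ?thesis using chart_denominator t1 by blast
    qed
  qed
  then show ?thesis by (simp add: len)
qed

end

section \<open>Counting the parameters\<close>

lemma orientation_exists:
  fixes B :: "'n::finite set"
  assumes "card B = 2 * l"
  shows "\<exists>T \<sigma>. T \<subseteq> B \<times> B \<and> (\<forall>i\<in>B. \<forall>j\<in>B. i \<noteq> j \<longrightarrow> (i, j) \<in> T \<or> (j, i) \<in> T)
    \<and> (\<forall>i j. (i, j) \<in> T \<longrightarrow> (j, i) \<notin> T) \<and> (\<forall>i\<in>B. \<sigma> i \<in> B \<and> \<sigma> i \<noteq> i \<and> \<sigma> (\<sigma> i) = i)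
    \<and> 2 * card T + card B = card B * card B"
proof -
  obtain g where g: "bij_betw g {0..<2 * l} B"
    using ex_bij_betw_nat_finite[of B] assms by auto
  define f where "f = inv_into {0..<2 * l} g"
  have f: "f i < 2 * l" "g (f i) = i" if "i \<in> B" for i
    using bij_betw_apply[OF bij_betw_inv_into[OF g] that] bij_betw_inv_into_right[OF g that] by (auto simp: f_def)
  have fg: "g a \<in> B" "f (g a) = a" if "a < 2 * l" for a
    using bij_betw_apply[OF g] bij_betw_inv_into_left[OF g] that by (auto simp: f_def)
  have f_eq: "i = j" if "i \<in> B" "j \<in> B" "f i = f j" for i j using f that by metis
  \<comment> \<open>Under the enumeration of \<open>B\<close>, the matching exchanges the
    neighbouring positions 2b and 2b + 1.\<close>
  define s where "s a = (if even a then a + 1 else a - 1)" for a :: nat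
  have s: "s a < 2 * l" "s a \<noteq> a" "s (s a) = a" if "a < 2 * l" for a
    using that by (auto simp: s_def elim!: evenE oddE)
  define \<sigma> where "\<sigma> i = g (s (f i))" for i
  define T where "T = {(i, j). i \<in> B \<and> j \<in> B \<and> f i < f j}"
  have "\<sigma> i \<in> B \<and> \<sigma> i \<noteq> i \<and> \<sigma> (\<sigma> i) = i" if "i \<in> B" for i
    using f[OF that] s[of "f i"] fg by (auto simp: \<sigma>_def) metis
  moreover have "2 * card T + card B = card B * card B"
  proof -
    have eq: "B \<times> B = T \<union> prod.swap ` T \<union> (\<lambda>i. (i, i)) ` B"
    proof (intro equalityI subsetI)
      fix x assume "x \<in> B \<times> B"
      then obtain i j where x: "x = (i, j)" "i \<in> B" "j \<in> B" by auto
      consider "f i < f j" | "f j < f i" | "i = j" using f_eq[OF x(2,3)] linorder_less_linear[of "f i" "f j"] by blast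
      then show "x \<in> T \<union> prod.swap ` T \<union> (\<lambda>i. (i, i)) ` B"
        using x by cases (auto simp: T_def image_iff)
    qed (auto simp: T_def)
    have "card (B \<times> B) = card (T \<union> prod.swap ` T) + card ((\<lambda>i. (i, i)) ` B)"
      unfolding eq by (rule card_Un_disjoint) (auto simp: T_def)
    also have "card (T \<union> prod.swap ` T) = card T + card (prod.swap ` T)"
      by (rule card_Un_disjoint) (auto simp: T_def)
    also have "card (prod.swap ` T) = card T" by (rule card_image) (auto simp: inj_on_def)
    also have "card ((\<lambda>i. (i, i)) ` B) = card B" by (rule card_image) (auto simp: inj_on_def)
    finally show ?thesis by (simp add: card_cartesian_product)
  qed
  moreover have "T \<subseteq> B \<times> B" "\<forall>i\<in>B. \<forall>j\<in>B. i \<noteq> j \<longrightarrow> (i, j) \<in> T \<or> (j, i) \<in> T"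
    "\<forall>i j. (i, j) \<in> T \<longrightarrow> (j, i) \<notin> T"
    using f_eq by (auto simp: T_def) (metis linorder_neqE_nat f_eq)
  ultimately show ?thesis by blast
qed

lemma semialg_dim_Phi_ge:
  assumes k: "k' \<le> k" "k + k' \<le> CARD('n)"
  shows "ereal (real k * (real CARD('n) - real k) + real k' * (real CARD('n) - real k') - real k')
    \<le> semialg_dim (Phi k k' :: (real^'n^'n) set)"
proof -
  have "k - k' \<le> card (UNIV :: 'n set)" using k by simp
  then obtain J :: "'n set" where J: "card J = k - k'" using obtain_subset_with_card_n by metis
  have "2 * k' \<le> card (- J)" using J k by (simp add: Compl_eq_Diff_UNIV card_Diff_subset)
  then obtain B where B: "B \<subseteq> - J" "card B = 2 * k'" using obtain_subset_with_card_n by metis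
  from orientation_exists[OF B(2)] obtain T \<sigma> where or: "T \<subseteq> B \<times> B" "\<forall>i\<in>B. \<forall>j\<in>B. i \<noteq> j \<longrightarrow> (i, j) \<in> T \<or> (j, i) \<in> T"
    "\<forall>i j. (i, j) \<in> T \<longrightarrow> (j, i) \<notin> T" "\<forall>i\<in>B. \<sigma> i \<in> B \<and> \<sigma> i \<noteq> i \<and> \<sigma> (\<sigma> i) = i"
    "2 * card T + card B = card B * card B"
    by (elim exE conjE) (rule that; assumption)
  define F where "F = - J - B"
  interpret Phi_chart J B F T \<sigma>
  proof
    show "J \<union> B \<union> F = UNIV" "J \<inter> B = {}" "J \<inter> F = {}" "B \<inter> F = {}"
      using B(1) by (auto simp: F_def)
    show "T \<subseteq> B \<times> B" by (rule or(1))
    show "(i, j) \<in> T \<or> (j, i) \<in> T" if "i \<in> B" "j \<in> B" "i \<noteq> j" for i j using or(2) that by blast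
    show "(j, i) \<notin> T" if "(i, j) \<in> T" for i j using or(3) that by blast
    show "\<sigma> i \<in> B" "\<sigma> i \<noteq> i" "\<sigma> (\<sigma> i) = i" if "i \<in> B" for i using or(4) that by blast+
  qed
  have cF: "card F = CARD('n) - k - k'"
    using B J k by (simp add: F_def card_Diff_subset Compl_eq_Diff_UNIV)
  have rF: "real (card F) = real CARD('n) - real k - real k'"
    unfolding cF using k by (simp add: of_nat_diff)
  have rJ: "real (card (- J)) = real CARD('n) - real k + real k'"
    using J k by (simp add: Compl_eq_Diff_UNIV card_Diff_subset of_nat_diff)
  have "real (2 * card T + 2 * k') = real (2 * k' * (2 * k'))" using or(5) B(2) by simp
  then have rT: "2 * real (card T) + 2 * real k' = 4 * (real k' * real k')" by simp
  have "real k * (real CARD('n) - real k) + real k' * (real CARD('n) - real k') - real k'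
    = real (card B * card F + card T + card J * card (- J))"
  proof -
    have "real (card B * card F + card T + card J * card (- J))
      = 2 * real k' * (real CARD('n) - real k - real k') + real (card T)
        + (real k - real k') * (real CARD('n) - real k + real k')"
      using B(2) J k by (simp add: rF rJ of_nat_diff)
    then show ?thesis using rT by (simp add: algebra_simps)
  qed
  moreover have "card J + k' = k" using J k by simp
  ultimately show ?thesis using semialg_dim_Phi_ge_chart[OF B(2)] by simp
qed

theorem theorem2p9:
  fixes k k' :: nat
  assumes "0 < k" and "0 < k'" and "k' \<le> k" and "k < CARD('n::finite)" and "k + k' \<le> CARD('n)"
  shows "semialg_dim (Phi k k' :: (real^'n^'n) set)
           = ereal (real k * (real CARD('n) - real k) + real k' * (real CARD('n) - real k') - real k')
       \<and> (k = k' \<and> (CARD('n) = 2 * k \<or> CARD('n) = 2 * k + 1)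
            \<longrightarrow> (Phi k k' :: (real^'n^'n) set) = SO_group)
       \<and> (k = k' + 1 \<and> (CARD('n) = 2 * k - 1 \<or> CARD('n) = 2 * k)
            \<longrightarrow> (Phi k k' :: (real^'n^'n) set) = SO_minus)"
proof (intro conjI impI)
  \<comment> \<open>The natural subtraction \<open>CARD('n) - k' - 1\<close> is not truncated, since
    \<open>k' \<le> k\<close> and \<open>k < CARD('n)\<close>.\<close>
  have "real (k * (CARD('n) - k) + k' * (CARD('n) - k' - 1))
    = real k * (real CARD('n) - real k) + real k' * (real CARD('n) - real k') - real k'"
  proof -
    have "real (CARD('n) - k) = real CARD('n) - real k" "real (CARD('n) - k' - 1) = real CARD('n) - real k' - 1"
      using assms by (simp_all add: of_nat_diff)
    then show ?thesis by (simp only: of_nat_add of_nat_mult) (simp add: algebra_simps)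
  qed
  then show "semialg_dim (Phi k k' :: (real^'n^'n) set)
      = ereal (real k * (real CARD('n) - real k) + real k' * (real CARD('n) - real k') - real k')"
    using semialg_dim_Phi_le[where 'n = 'n, OF assms(3,4,5)] semialg_dim_Phi_ge[where 'n = 'n, OF assms(3,5)]
    by (simp add: antisym)
next
  assume "k = k' \<and> (CARD('n) = 2 * k \<or> CARD('n) = 2 * k + 1)"
  then show "(Phi k k' :: (real^'n^'n) set) = SO_group" using Phi_eq_SO_group[where 'n = 'n, of k] by blast
next
  assume "k = k' + 1 \<and> (CARD('n) = 2 * k - 1 \<or> CARD('n) = 2 * k)"
  then show "(Phi k k' :: (real^'n^'n) set) = SO_minus" using Phi_eq_SO_minus[where 'n = 'n, of k'] by auto
qed

end
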